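(* Let $\mathsf f$ be an a.s. uniformly bounded additive functional on a uniformly elliptic Markov chain $\mathsf X$. If $\mathsf f$ is center-tight, then $H(\mathsf X,\mathsf f)=\mathbb R$. If $\mathsf f$ is not center-tight, then either $H(\mathsf X,\mathsf f)=\{0\}$, or $H(\mathsf X,\mathsf f)=t\mathbb Z$ for some $t\ge \pi/(6\,\mathrm{ess\,sup}|\mathsf f|)$.
   Context: A Markov chain $\mathsf X=\{X_n\}_{n\ge1}$ (possibly inhomogeneous) has complete separable metric state spaces $\mathfrak S_n\ni X_n$ with Borel $\sigma$-algebras, an initial distribution on $\mathfrak S_1$, and transition kernels $\pi_{n,n+1}(x,dy)$, so that $\mathbb P(X_{n+1}\in E\mid X_n,\dots,X_1)=\pi_{n,n+1}(X_n,E)$. It is uniformly elliptic if there are $0<\epsilon_0<1$, Borel probability measures $\mu_n$ on $\mathfrak S_n$ and measurable $p_n:\mathfrak S_n\times\mathfrak S_{n+1}\to[0,\infty)$ such that for all $n\ge1$: (a) $\pi_{n,n+1}(x,dy)=p_n(x,y)\mu_{n+1}(dy)$; (b) $0\le p_n\le1/\epsilon_0$; (c) $\int_{\mathfrak S_{n+1}}p_n(x,y)p_{n+1}(y,z)\mu_{n+1}(dy)>\epsilon_0$ for all $x\in\mathfrak S_n$, $z\in\mathfrak S_{n+2}$. By convention $\mu_n(E)=\mathbb P(X_n\in E)$. An additive functional is a sequence $\mathsf f=\{f_n\}$ of measurable $f_n:\mathfrak S_n\times\mathfrak S_{n+1}\to\mathbb R$; $S_N=\sum_{n=1}^Nf_n(X_n,X_{n+1})$;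 $\mathrm{ess\,sup}|\mathsf f|=\sup_n\mathrm{ess\,sup}|f_n(X_n,X_{n+1})|$; $\mathsf f$ is a.s. uniformly bounded if this is finite. $\mathsf f$ is center-tight if there are constants $m_N$ such that for every $\epsilon>0$ there is $M$ with $\mathbb P[|S_N-m_N|>M]<\epsilon$ for all $N$. Structure constants. The bridge distribution of $X_{n+1}$ given $X_n=x$, $X_{n+2}=z$ is the probability measure proportional to $p_n(x,y)p_{n+1}(y,z)\mu_{n+1}(dy)$. For $n\ge3$ a random position $n$ hexagon $P=\left(x_{n-2};\begin{smallmatrix}x_{n-1}\\ y_{n-1}\end{smallmatrix};\begin{smallmatrix}x_n\\ y_n\end{smallmatrix};y_{n+1}\right)$ is sampled as follows: $(x_{n-2},x_{n-1})$ is distributed like $(X_{n-2},X_{n-1})$; independently $(y_n,y_{n+1})$ is distributed like $(X_n,X_{n+1})$; given these, $x_n$ and $y_{n-1}$ are conditionally independent, $x_n$ having the bridge distribution of $X_n$ given $X_{n-1}=x_{n-1},X_{n+1}=y_{n+1}$, and $y_{n-1}$ the bridge distribution of $X_{n-1}$ given $X_{n-2}=x_{n-2},X_n=y_n$. The balance is $\Gamma(P)=f_{n-2}(x_{n-2},x_{n-1})+f_{n-1}(x_{n-1},x_n)+f_n(x_n,y_{n+1})-f_{n-2}(x_{n-2},y_{n-1})-f_{n-1}(y_{n-1},y_n)-f_n(y_n,y_{n+1})$. For $\xi\in\mathbb R$ set $d_n(\xi)=\mathbb E(|e^{i\xi\Gamma(P)}-1|^2)^{1/2}$. The co-range is $H(\mathsf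 X,\mathsf f)=\{\xi\in\mathbb R:\sum_{n=3}^\infty d_n(\xi)^2<\infty\}$. *)

theory Defs
  imports "HOL-Probability.Probability"
begin

text \<open>
  The state spaces are a sequence \<open>S :: nat \<Rightarrow> 'a metric\<close> of metric spaces whose carriers
  \<open>mspace (S n)\<close> are arbitrary sets in a common type; the carriers and the metrics may vary freely
  with \<open>n\<close>.  (Any sequence of metric spaces has this form: tag the points by the index.)
  All sequences are indexed by \<open>n \<ge> 1\<close>; the entries at index 0 are never used.
\<close>

definition metric_borel :: "'a metric \<Rightarrow> 'a measure" where
  "metric_borel m = sigma (mspace m) {U. openin (mtopology_of m) U}"

definition history :: "'w measure \<Rightarrow> (nat \<Rightarrow> 'a metric) \<Rightarrow> (nat \<Rightarrow> 'w \<Rightarrow> 'a) \<Rightarrow> nat \<Rightarrow> 'w measure"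
  where
  "history M S X n =
     vimage_algebra (space M) (\<lambda>\<omega>. \<lambda>i\<in>{1..n}. X i \<omega>) (\<Pi>\<^sub>M i\<in>{1..n}. metric_borel (S i))"

text \<open>The initial distribution is the law of \<open>X 1\<close>; \<open>\<pi> n x\<close> is the paper's
  \<open>\<pi>\<close> with subscript \<open>n, n + 1\<close>, evaluated at \<open>(x, dy)\<close>.\<close>

definition markov_chain ::
  "'w measure \<Rightarrow> (nat \<Rightarrow> 'a metric) \<Rightarrow> (nat \<Rightarrow> 'w \<Rightarrow> 'a) \<Rightarrow> (nat \<Rightarrow> 'a \<Rightarrow> 'a measure) \<Rightarrow> bool"
  where
  "markov_chain M S X \<pi> \<longleftrightarrow>
     prob_space M \<and>
     (\<forall>n\<ge>1. mcomplete_of (S n) \<and> separable_space (mtopology_of (S n))) \<and>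
     (\<forall>n\<ge>1. X n \<in> M \<rightarrow>\<^sub>M metric_borel (S n)) \<and>
     (\<forall>n\<ge>1. \<pi> n \<in> metric_borel (S n) \<rightarrow>\<^sub>M prob_algebra (metric_borel (S (n + 1)))) \<and>
     (\<forall>n\<ge>1. \<forall>E\<in>sets (metric_borel (S (n + 1))).
        AE \<omega> in M. real_cond_exp M (history M S X n) (indicator (X (n + 1) -` E \<inter> space M)) \<omega>
                     = measure (\<pi> n (X n \<omega>)) E)"

text \<open>\<open>\<mu>\<close> and \<open>p\<close> are parameters, not existentially quantified like \<open>\<epsilon>\<^sub>0\<close>, because the
  bridge distributions below are defined from them.\<close>

definition uniformly_elliptic ::
  "(nat \<Rightarrow> 'a metric) \<Rightarrow> (nat \<Rightarrow> 'a \<Rightarrow> 'a measure) \<Rightarrow> (nat \<Rightarrow> 'a measure) \<Rightarrow>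
   (nat \<Rightarrow> 'a \<Rightarrow> 'a \<Rightarrow> real) \<Rightarrow> bool"
  where
  "uniformly_elliptic S \<pi> \<mu> p \<longleftrightarrow>
     (\<forall>n\<ge>1. prob_space (\<mu> n) \<and> sets (\<mu> n) = sets (metric_borel (S n))) \<and>
     (\<forall>n\<ge>1. case_prod (p n) \<in>
        borel_measurable (metric_borel (S n) \<Otimes>\<^sub>M metric_borel (S (n + 1)))) \<and>
     (\<exists>\<epsilon>\<^sub>0. 0 < \<epsilon>\<^sub>0 \<and> \<epsilon>\<^sub>0 < 1 \<and>
       (\<forall>n\<ge>1.
         (\<forall>x\<in>mspace (S n). \<pi> n x = density (\<mu> (n + 1)) (\<lambda>y. ennreal (p n x y))) \<and>
         (\<forall>x\<in>mspace (S n). \<forall>y\<in>mspace (S (n + 1)). 0 \<le> p n x y \<and> p n x y \<le> 1 / \<epsilon>\<^sub>0) \<and>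
         (\<forall>x\<in>mspace (S n). \<forall>z\<in>mspace (S (n + 2)).
            (LINT y|\<mu> (n + 1). p n x y * p (n + 1) y z) > \<epsilon>\<^sub>0)))"

definition additive_functional ::
  "(nat \<Rightarrow> 'a metric) \<Rightarrow> (nat \<Rightarrow> 'a \<Rightarrow> 'a \<Rightarrow> real) \<Rightarrow> bool"
  where
  "additive_functional S f \<longleftrightarrow>
     (\<forall>n\<ge>1. case_prod (f n) \<in>
        borel_measurable (metric_borel (S n) \<Otimes>\<^sub>M metric_borel (S (n + 1))))"

definition partial_sum ::
  "(nat \<Rightarrow> 'w \<Rightarrow> 'a) \<Rightarrow> (nat \<Rightarrow> 'a \<Rightarrow> 'a \<Rightarrow> real) \<Rightarrow> nat \<Rightarrow> 'w \<Rightarrow> real"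
  where
  "partial_sum X f N \<omega> = (\<Sum>n=1..N. f n (X n \<omega>) (X (n + 1) \<omega>))"

definition ess_sup_functional ::
  "'w measure \<Rightarrow> (nat \<Rightarrow> 'w \<Rightarrow> 'a) \<Rightarrow> (nat \<Rightarrow> 'a \<Rightarrow> 'a \<Rightarrow> real) \<Rightarrow> ereal"
  where
  "ess_sup_functional M X f =
     (SUP n\<in>{1..}. esssup M (\<lambda>\<omega>. ereal \<bar>f n (X n \<omega>) (X (n + 1) \<omega>)\<bar>))"

definition as_uniformly_bounded ::
  "'w measure \<Rightarrow> (nat \<Rightarrow> 'w \<Rightarrow> 'a) \<Rightarrow> (nat \<Rightarrow> 'a \<Rightarrow> 'a \<Rightarrow> real) \<Rightarrow> bool"
  where
  "as_uniformly_bounded M X f \<longleftrightarrow> ess_sup_functional M X f < \<infinity>"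

definition center_tight ::
  "'w measure \<Rightarrow> (nat \<Rightarrow> 'w \<Rightarrow> 'a) \<Rightarrow> (nat \<Rightarrow> 'a \<Rightarrow> 'a \<Rightarrow> real) \<Rightarrow> bool"
  where
  "center_tight M X f \<longleftrightarrow>
     (\<exists>m :: nat \<Rightarrow> real. \<forall>\<epsilon>>0. \<exists>K :: real. \<forall>N\<ge>1.
        measure M {\<omega> \<in> space M. \<bar>partial_sum X f N \<omega> - m N\<bar> > K} < \<epsilon>)"

text \<open>\<open>bridge \<mu> p n x z\<close> is the bridge distribution at time \<open>n + 1\<close>, given the states \<open>x\<close> and \<open>z\<close>
  at times \<open>n\<close> and \<open>n + 2\<close>.\<close>

definition bridge ::
  "(nat \<Rightarrow> 'a measure) \<Rightarrow> (nat \<Rightarrow> 'a \<Rightarrow> 'a \<Rightarrow> real) \<Rightarrow> nat \<Rightarrow> 'a \<Rightarrow> 'a \<Rightarrow> 'a measure"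
  where
  "bridge \<mu> p n x z =
     density (\<mu> (n + 1))
       (\<lambda>y. ennreal (p n x y * p (n + 1) y z / (LINT u|\<mu> (n + 1). p n x u * p (n + 1) u z)))"

definition joint_law ::
  "'w measure \<Rightarrow> (nat \<Rightarrow> 'a metric) \<Rightarrow> (nat \<Rightarrow> 'w \<Rightarrow> 'a) \<Rightarrow> nat \<Rightarrow> ('a \<times> 'a) measure"
  where
  "joint_law M S X n =
     distr M (metric_borel (S n) \<Otimes>\<^sub>M metric_borel (S (n + 1))) (\<lambda>\<omega>. (X n \<omega>, X (n + 1) \<omega>))"

type_synonym 'a hexagon = "'a \<times> ('a \<times> 'a) \<times> ('a \<times> 'a) \<times> 'a"

text \<open>
  The law of the random position \<open>n\<close> hexagon, for \<open>n \<ge> 3\<close>.  The components of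
  \<open>(a, (b, b'), (c, c'), d')\<close> are
  \<open>a\<close> at time \<open>n - 2\<close>, the upper/lower states \<open>b\<close>/\<open>b'\<close> at time \<open>n - 1\<close>,
  the upper/lower states \<open>c\<close>/\<open>c'\<close> at time \<open>n\<close>, and \<open>d'\<close> at time \<open>n + 1\<close>;
  primed letters are the paper's \<open>y\<close>, unprimed letters are its \<open>x\<close>.
\<close>

definition hexagon_law ::
  "'w measure \<Rightarrow> (nat \<Rightarrow> 'a metric) \<Rightarrow> (nat \<Rightarrow> 'w \<Rightarrow> 'a) \<Rightarrow> (nat \<Rightarrow> 'a measure) \<Rightarrow>
   (nat \<Rightarrow> 'a \<Rightarrow> 'a \<Rightarrow> real) \<Rightarrow> nat \<Rightarrow> 'a hexagon measure"
  where
  "hexagon_law M S X \<mu> p n =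
     do {
       (a, b) \<leftarrow> joint_law M S X (n - 2);
       (c', d') \<leftarrow> joint_law M S X n;
       c \<leftarrow> bridge \<mu> p (n - 1) b d';
       b' \<leftarrow> bridge \<mu> p (n - 2) a c';
       return
         (metric_borel (S (n - 2)) \<Otimes>\<^sub>M
          (metric_borel (S (n - 1)) \<Otimes>\<^sub>M metric_borel (S (n - 1))) \<Otimes>\<^sub>M
          (metric_borel (S n) \<Otimes>\<^sub>M metric_borel (S n)) \<Otimes>\<^sub>M
          metric_borel (S (n + 1)))
         (a, (b, b'), (c, c'), d')
     }"

fun balance :: "(nat \<Rightarrow> 'a \<Rightarrow> 'a \<Rightarrow> real) \<Rightarrow> nat \<Rightarrow> 'a hexagon \<Rightarrow> real" where
  "balance f n (a, (b, b'), (c, c'), d') =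
     f (n - 2) a b + f (n - 1) b c + f n c d' - f (n - 2) a b' - f (n - 1) b' c' - f n c' d'"

definition structure_const ::
  "'w measure \<Rightarrow> (nat \<Rightarrow> 'a metric) \<Rightarrow> (nat \<Rightarrow> 'w \<Rightarrow> 'a) \<Rightarrow> (nat \<Rightarrow> 'a measure) \<Rightarrow>
   (nat \<Rightarrow> 'a \<Rightarrow> 'a \<Rightarrow> real) \<Rightarrow> (nat \<Rightarrow> 'a \<Rightarrow> 'a \<Rightarrow> real) \<Rightarrow> nat \<Rightarrow> real \<Rightarrow> real"
  where
  "structure_const M S X \<mu> p f n \<xi> =
     sqrt (LINT P|hexagon_law M S X \<mu> p n.
             (norm (exp (\<i> * complex_of_real (\<xi> * balance f n P)) - 1))\<^sup>2)"

text \<open>The index shift makes the series start at \<open>n = 3\<close>.\<close>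

definition co_range ::
  "'w measure \<Rightarrow> (nat \<Rightarrow> 'a metric) \<Rightarrow> (nat \<Rightarrow> 'w \<Rightarrow> 'a) \<Rightarrow> (nat \<Rightarrow> 'a measure) \<Rightarrow>
   (nat \<Rightarrow> 'a \<Rightarrow> 'a \<Rightarrow> real) \<Rightarrow> (nat \<Rightarrow> 'a \<Rightarrow> 'a \<Rightarrow> real) \<Rightarrow> real set"
  where
  "co_range M S X \<mu> p f = {\<xi>. summable (\<lambda>k. (structure_const M S X \<mu> p f (k + 3) \<xi>)\<^sup>2)}"

end

theory Submission
  imports Defs
begin

text \<open>
  Since \<open>\<bar>e\<^sup>i\<^sup>s - 1\<bar>\<close> is subadditive in \<open>s\<close>, the co-range is a subgroup of the reals.
  A hexagon is, up to bounded factors, a pair of independent paths of length three with common end points.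
  Hence a block of three steps reduces the characteristic function of the sum by a factor governed by the
  structure constant, and \<open>\<bar>E e\<^sup>i\<^sup>\<xi>\<^sup>S\<bar>\<close> decays exponentially in the sum of the squared structure constants over any
  residue class of positions modulo 5.  Center-tightness keeps this modulus away from zero for small \<open>\<xi>\<close>, so the co-range
  contains an interval and is the whole line.

  Conversely, a nonzero \<open>\<xi>\<close> in the co-range with \<open>6 \<bar>\<xi>\<bar> ess sup \<bar>f\<bar> \<le> \<pi>\<close> makes the expected squared balances
  summable.  Averaging the balance over everything except its lower right edge exhibits \<open>f\<close> as a bounded
  coboundary plus constants plus a square-summable remainder.  By the exponential mixing that ellipticity provides,
  sums of the remainder have bounded variance, so \<open>f\<close> is center-tight.  Otherwise the co-range is therefore a
  discrete subgroup.
\<close>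

section \<open>Auxiliary facts on integrals and kernels\<close>

text \<open>A one-step density may vanish; only the two-step density is bounded below. This shapes
  every estimate. Bridges have normalisers above \<open>eps\<close>, contraction is gained two steps
  at a time, and a three-step block, whose loss depends on its starting state, needs two earlier
  steps after which the law of that state dominates \<open>eps\<close> times the marginal: hence
  blocks of five. The hexagon law is compared with pairs of paths only from above. That is the
  direction needed: structure constants are dominated by the losses of the blocks, so a bounded
  total loss makes them summable. For the converse the sampling order matters: the edges
  \<open>(a, b)\<close> and \<open>(c', d')\<close> are independent, so fixing
  \<open>(c', d')\<close> leaves a function of each of its end points, a constant and
  \<open>f\<close> on that edge. The 6 in the gap counts the terms of the balance: it keeps the
  phase in \<open>[-pi, pi]\<close>, where \<open>2 - 2 * cos t\<close> dominates a multiple of the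
  square of \<open>t\<close>. The functional is bounded only almost surely, while these estimates
  are pointwise. It is therefore truncated, and null sets of edges must be shown to stay null in a
  hexagon, four of whose six edges come from bridges.\<close>

lemma norm_exp_i_minus_1_squared:
  "(norm (exp (\<i> * complex_of_real t) - 1))\<^sup>2 = 2 - 2 * cos t"
proof -
  have "(norm (exp (\<i> * complex_of_real t) - 1))\<^sup>2 = (cos t - 1)\<^sup>2 + (sin t)\<^sup>2"
    by (simp add: cis_conv_exp[symmetric] cmod_power2)
  also have "\<dots> = (cos t)\<^sup>2 + (sin t)\<^sup>2 + 1 - 2 * cos t"
    by (simp add: power2_eq_square algebra_simps)
  finally show ?thesis by (simp add: add.commute)
qed

text \<open>Squaring the triangle inequality for the distance of \<open>exp (\<i> * t)\<close> to 1
  costs a factor 2, which does not affect summability of the structure constants.\<close>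

lemma two_minus_two_cos_add_le:
  fixes s t :: real
  shows "2 - 2 * cos (s + t) \<le> 2 * (2 - 2 * cos s) + 2 * (2 - 2 * cos t)"
proof -
  let ?e = "\<lambda>t. exp (\<i> * complex_of_real t)"
  have *: "?e (s + t) - 1 = ?e s * (?e t - 1) + (?e s - 1)"
    by (simp add: algebra_simps exp_add)
  have "norm (?e (s + t) - 1) \<le> norm (?e t - 1) + norm (?e s - 1)"
    unfolding * by (rule order_trans[OF norm_triangle_ineq]) (simp add: norm_mult)
  then have "(norm (?e (s + t) - 1))\<^sup>2 \<le> (norm (?e t - 1) + norm (?e s - 1))\<^sup>2"
    by (intro power_mono) auto
  also have "\<dots> \<le> 2 * (norm (?e s - 1))\<^sup>2 + 2 * (norm (?e t - 1))\<^sup>2"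
    by (rule order_trans[OF _ sum_squares_bound[THEN add_left_mono, of
      "(norm (?e t - 1))\<^sup>2 + (norm (?e s - 1))\<^sup>2" "norm (?e t - 1)" "norm (?e s - 1)", THEN order_trans]])
      (auto simp: power2_eq_square algebra_simps)
  finally show ?thesis unfolding norm_exp_i_minus_1_squared .
qed

text \<open>With \<open>x = \<bar>t\<bar> / 2\<close> the quantity \<open>2 - 2 * cos t\<close> is
  \<open>4 * (sin x)\<^sup>2\<close>, and the cubic Taylor bound shows that \<open>sin x\<close> is
  at least \<open>x / 2\<close> on the relevant range.\<close>

lemma square_le_two_minus_two_cos:
  fixes t :: real
  assumes "\<bar>t\<bar> \<le> pi"
  shows "t\<^sup>2 \<le> 4 * (2 - 2 * cos t)"
proof -
  define x where "x = \<bar>t\<bar> / 2"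
  \<comment> \<open>The number \<open>8/5\<close> is a rational upper bound for
    \<open>pi / 2\<close> whose square is still below 3; this keeps the cubic Taylor term below half
    of the linear one.\<close>
  have x: "0 \<le> x" "x \<le> 8/5"
    using assms pi_approx by (auto simp: x_def)
  have "\<bar>sin x - (\<Sum>m<3. sin_coeff m * x ^ m)\<bar> \<le> inverse (fact 3) * \<bar>x\<bar> ^ 3"
    by (rule Maclaurin_sin_bound)
  then have "x - x ^ 3 / 6 \<le> sin x"
    using x by (simp add: sin_coeff_def numeral_eq_Suc abs_if split: if_splits)
  moreover have "x ^ 3 \<le> 3 * x"
  proof -
    have "x * x \<le> (8/5) * (8/5)" using x by (intro mult_mono) auto
    then have "x * (x * x) \<le> x * 3" using x by (intro mult_left_mono) auto
    then show ?thesis by (simp add: power3_eq_cube mult.assoc mult.commute)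
  qed
  ultimately have "x / 2 \<le> sin x" by simp
  then have "(x / 2)\<^sup>2 \<le> (sin x)\<^sup>2" using x by (intro power_mono) auto
  moreover have "cos t = 1 - 2 * (sin x)\<^sup>2"
  proof -
    have "cos (2 * x) = cos t" by (simp add: x_def)
    then show ?thesis using cos_double_sin[of x] by simp
  qed
  moreover have "t\<^sup>2 = 4 * x\<^sup>2" by (simp add: x_def power2_eq_square)
  ultimately show ?thesis by (simp add: power2_eq_square)
qed

lemma borel_measurable_cis [measurable]: "cis \<in> borel_measurable borel"
  by (intro borel_measurable_continuous_onI continuous_intros)

lemma (in prob_space) integrable_bounded:
  fixes g :: "'a \<Rightarrow> 'b::{banach, second_countable_topology}"
  assumes "g \<in> borel_measurable M" "\<And>x. x \<in> space M \<Longrightarrow> norm (g x) \<le> B"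
  shows "integrable M g"
  using assms by (intro integrable_const_bound[where B = B]) auto

lemma (in prob_space) norm_integral_le:
  fixes g :: "'a \<Rightarrow> 'b::{banach, second_countable_topology}"
  assumes "\<And>x. x \<in> space M \<Longrightarrow> norm (g x) \<le> B" "0 \<le> B"
  shows "norm (LINT x|M. g x) \<le> B"
proof (cases "integrable M g")
  case True
  have "norm (LINT x|M. g x) \<le> (LINT x|M. norm (g x))" by (rule integral_norm_bound)
  also have "\<dots> \<le> (LINT x|M. B)" using True assms by (intro integral_mono) auto
  finally show ?thesis by (simp add: prob_space)
qed (use assms in \<open>simp add: not_integrable_integral_eq\<close>)

lemma (in prob_space) square_integral_le:
  fixes g :: "'a \<Rightarrow> real"
  assumes [measurable]: "g \<in> borel_measurable M"
  shows "ennreal ((LINT x|M. g x)\<^sup>2) \<le> (\<integral>\<^sup>+x. ennreal ((g x)\<^sup>2) \<partial>M)"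
proof (cases "integrable M (\<lambda>x. (g x)\<^sup>2)")
  case True
  then have g: "integrable M g" by (rule square_integrable_imp_integrable[rotated]) simp
  have "variance g = (LINT x|M. (g x)\<^sup>2) - (LINT x|M. g x)\<^sup>2"
    by (rule variance_eq[OF g True])
  then have "(LINT x|M. g x)\<^sup>2 \<le> (LINT x|M. (g x)\<^sup>2)"
    using variance_positive[of g] by simp
  then show ?thesis using True by (subst nn_integral_eq_integral) (auto intro!: ennreal_leI)
next
  case False
  then have "(\<integral>\<^sup>+x. ennreal ((g x)\<^sup>2) \<partial>M) = \<infinity>"
    by (auto simp: integrable_iff_bounded not_less top_unique)
  then show ?thesis by simp
qed

lemma (in prob_space) square_integral_le_bounded:
  fixes g :: "'a \<Rightarrow> real"
  assumes [measurable]: "g \<in> borel_measurable M"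
    and B: "\<And>x. x \<in> space M \<Longrightarrow> \<bar>g x\<bar> \<le> B"
  shows "(LINT x|M. g x)\<^sup>2 \<le> (LINT x|M. (g x)\<^sup>2)"
proof -
  have sq: "integrable M (\<lambda>x. (g x)\<^sup>2)"
  proof (rule integrable_bounded[where B = "B\<^sup>2"])
    show "norm ((g x)\<^sup>2) \<le> B\<^sup>2" if "x \<in> space M" for x
      using power_mono[OF B[OF that], of 2] by simp
  qed simp
  have "variance g = (LINT x|M. (g x)\<^sup>2) - (LINT x|M. g x)\<^sup>2"
    using B by (intro variance_eq sq integrable_bounded[where B = B]) auto
  then show ?thesis using variance_positive[of g] by simp
qed

text \<open>The left-hand side is the modulus of a characteristic function, so the right-hand side
  compares two independent copies: \<open>2 - 2 cos t = \<bar>e\<^sup>i\<^sup>t - 1\<bar>\<^sup>2\<close>.\<close>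

lemma (in prob_space) norm_integral_cis:
  fixes w \<theta> :: "'a \<Rightarrow> real"
  assumes [measurable]: "w \<in> borel_measurable M" "\<theta> \<in> borel_measurable M"
    and w: "\<And>x. x \<in> space M \<Longrightarrow> 0 \<le> w x \<and> w x \<le> B"
  shows "2 * ((LINT x|M. w x)\<^sup>2 - (norm (LINT x|M. w x *\<^sub>R cis (\<theta> x)))\<^sup>2)
       = (LINT x|M. LINT y|M. w x * w y * (2 - 2 * cos (\<theta> x - \<theta> y)))"
    and "(\<integral>\<^sup>+x. \<integral>\<^sup>+y. ennreal (w x * w y * (2 - 2 * cos (\<theta> x - \<theta> y))) \<partial>M \<partial>M)
      = ennreal (2 * ((LINT x|M. w x)\<^sup>2 - (norm (LINT x|M. w x *\<^sub>R cis (\<theta> x)))\<^sup>2))"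
proof -
  define c s r where "c = (LINT x|M. w x * cos (\<theta> x))" and "s = (LINT x|M. w x * sin (\<theta> x))"
    and "r = (LINT x|M. w x)"
  have le: "\<bar>w x * t\<bar> \<le> B" if "x \<in> space M" "\<bar>t\<bar> \<le> 1" for x t
    using w[OF that(1)] mult_mono[of "\<bar>w x\<bar>" B "\<bar>t\<bar>" 1] that(2) by (auto simp: abs_mult)
  have iw [simp]: "integrable M w"
    using w by (intro integrable_bounded[where B = B]) auto
  have ic [simp]: "integrable M (\<lambda>x. w x * cos (\<theta> x))" "integrable M (\<lambda>x. w x * sin (\<theta> x))"
    using le by (auto intro!: integrable_bounded[where B = B])
  have icis: "integrable M (\<lambda>x. w x *\<^sub>R cis (\<theta> x))"
    using w by (intro integrable_bounded[where B = B]) auto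
  \<comment> \<open>The addition formula separates the two variables, so the double integral
    collapses to products of the single integrals \<open>r\<close>, \<open>c\<close> and
    \<open>s\<close>.\<close>
  have *: "w x * w y * (2 - 2 * cos (\<theta> x - \<theta> y)) =
      (2 * w x) * w y - (2 * (w x * cos (\<theta> x))) * (w y * cos (\<theta> y))
       - (2 * (w x * sin (\<theta> x))) * (w y * sin (\<theta> y))" for x y
    by (simp add: cos_diff algebra_simps)
  have inner: "integrable M (\<lambda>y. w x * w y * (2 - 2 * cos (\<theta> x - \<theta> y)))"
    "(LINT y|M. w x * w y * (2 - 2 * cos (\<theta> x - \<theta> y))) =
      2 * w x * r - 2 * (w x * cos (\<theta> x)) * c - 2 * (w x * sin (\<theta> x)) * s" for x
    unfolding * by (simp_all add: c_def s_def r_def)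
  have outer: "integrable M (\<lambda>x. 2 * w x * r - 2 * (w x * cos (\<theta> x)) * c - 2 * (w x * sin (\<theta> x)) * s)"
    by simp
  have val: "(LINT x|M. 2 * w x * r - 2 * (w x * cos (\<theta> x)) * c - 2 * (w x * sin (\<theta> x)) * s)
      = 2 * (r\<^sup>2 - (c\<^sup>2 + s\<^sup>2))"
  proof -
    have "(LINT x|M. (2 * r) * w x - (2 * c) * (w x * cos (\<theta> x)) - (2 * s) * (w x * sin (\<theta> x)))
      = (2 * r) * r - (2 * c) * c - (2 * s) * s"
      by (simp add: c_def s_def r_def)
    then show ?thesis by (simp add: power2_eq_square ac_simps right_diff_distrib)
  qed
  have "Re (LINT x|M. w x *\<^sub>R cis (\<theta> x)) = c" "Im (LINT x|M. w x *\<^sub>R cis (\<theta> x)) = s"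
    using icis by (simp_all add: integral_Re[symmetric] integral_Im[symmetric] c_def s_def)
  then have n: "(norm (LINT x|M. w x *\<^sub>R cis (\<theta> x)))\<^sup>2 = c\<^sup>2 + s\<^sup>2"
    by (simp add: cmod_power2)
  show 1: "2 * ((LINT x|M. w x)\<^sup>2 - (norm (LINT x|M. w x *\<^sub>R cis (\<theta> x)))\<^sup>2)
       = (LINT x|M. LINT y|M. w x * w y * (2 - 2 * cos (\<theta> x - \<theta> y)))"
    unfolding n inner(2) val by (simp add: r_def)
  have nn: "0 \<le> w x * w y * (2 - 2 * cos (\<theta> x - \<theta> y))" if "x \<in> space M" "y \<in> space M" for x y
    using w[OF that(1)] w[OF that(2)] by (intro mult_nonneg_nonneg) auto
  have "(\<integral>\<^sup>+x. \<integral>\<^sup>+y. ennreal (w x * w y * (2 - 2 * cos (\<theta> x - \<theta> y))) \<partial>M \<partial>M)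
    = (\<integral>\<^sup>+x. ennreal (LINT y|M. w x * w y * (2 - 2 * cos (\<theta> x - \<theta> y))) \<partial>M)"
    using nn inner(1) by (intro nn_integral_cong nn_integral_eq_integral) auto
  also have "\<dots> = ennreal (LINT x|M. LINT y|M. w x * w y * (2 - 2 * cos (\<theta> x - \<theta> y)))"
    using nn outer by (intro nn_integral_eq_integral) (auto simp: inner(2)[symmetric] intro!: integral_nonneg_AE)
  finally show "(\<integral>\<^sup>+x. \<integral>\<^sup>+y. ennreal (w x * w y * (2 - 2 * cos (\<theta> x - \<theta> y))) \<partial>M \<partial>M)
      = ennreal (2 * ((LINT x|M. w x)\<^sup>2 - (norm (LINT x|M. w x *\<^sub>R cis (\<theta> x)))\<^sup>2))"
    unfolding 1 .
qed

section \<open>Kernels given by densities, and integrals against kernels\<close>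

text \<open>Serves both the transition kernels and the bridge distributions.\<close>

lemma measurable_density_kernel:
  assumes "sigma_finite_measure \<nu>"
    and [measurable]: "case_prod w \<in> borel_measurable (N \<Otimes>\<^sub>M \<nu>)"
    and total: "\<And>x. x \<in> space N \<Longrightarrow> (\<integral>\<^sup>+y. w x y \<partial>\<nu>) = 1"
  shows "(\<lambda>x. density \<nu> (w x)) \<in> N \<rightarrow>\<^sub>M prob_algebra \<nu>"
proof (rule measurable_prob_algebraI)
  interpret sigma_finite_measure \<nu> by fact
  have [measurable]: "w x \<in> borel_measurable \<nu>" if "x \<in> space N" for x
    using that measurable_compose_Pair1[of x N "case_prod w" \<nu> borel] by simp
  have *: "prob_space (density \<nu> (w x))" if "x \<in> space N" for x
    using total[OF that] that by (intro prob_spaceI) (simp add: emeasure_density cong: nn_integral_cong)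
  then show "prob_space (density \<nu> (w x))" if "x \<in> space N" for x using that .
  show "(\<lambda>x. density \<nu> (w x)) \<in> N \<rightarrow>\<^sub>M subprob_algebra \<nu>"
  proof (rule measurable_subprob_algebra)
    fix A assume [measurable]: "A \<in> sets \<nu>"
    have "(\<lambda>x. \<integral>\<^sup>+y. w x y * indicator A y \<partial>\<nu>) \<in> borel_measurable N" by measurable
    then show "(\<lambda>x. emeasure (density \<nu> (w x)) A) \<in> borel_measurable N"
      by (rule measurable_cong[THEN iffD1, rotated]) (simp add: emeasure_density)
  qed (use * in \<open>auto simp: prob_space_imp_subprob_space\<close>)
qed

text \<open>Pushing \<open>\<kappa> x\<close> forward along \<open>y\<close> to
  \<open>(x, y)\<close> moves the dependence on \<open>x\<close> from the integrand into the
  measure; integrating a fixed function against a measurable kernel is measurable.\<close>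

lemma borel_measurable_integral_kernel:
  fixes g :: "'a \<Rightarrow> 'b \<Rightarrow> 'c::{banach, second_countable_topology}"
  assumes [measurable]: "case_prod g \<in> borel_measurable (N \<Otimes>\<^sub>M \<nu>)"
    and \<kappa>: "\<kappa> \<in> N \<rightarrow>\<^sub>M prob_algebra \<nu>"
  shows "(\<lambda>x. \<integral>y. g x y \<partial>\<kappa> x) \<in> borel_measurable N"
proof -
  note [measurable] = measurable_prob_algebraD[OF \<kappa>]
  note integral_measurable_subprob_algebra[measurable] measurable_distr2[measurable]
  have "(\<lambda>x. \<integral>z. case_prod g z \<partial>distr (\<kappa> x) (N \<Otimes>\<^sub>M \<nu>) (\<lambda>y. (x, y))) \<in> borel_measurable N"
    by measurable
  moreover have "(LINT z|distr (\<kappa> x) (N \<Otimes>\<^sub>M \<nu>) (\<lambda>y. (x, y)). case_prod g z) = (LINT y|\<kappa> x. g x y)"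
    if x: "x \<in> space N" for x
  proof -
    have [measurable_cong]: "sets (\<kappa> x) = sets \<nu>"
      using measurable_space[OF \<kappa> x] by (simp add: space_prob_algebra)
    show ?thesis using x by (subst integral_distr) auto
  qed
  ultimately show ?thesis by (simp cong: measurable_cong)
qed

text \<open>Distinct elements lie more than \<open>\<delta>\<close> apart, so the infimum
  \<open>t\<close> of the positive ones is attained: otherwise two different positive elements would
  lie within \<open>\<delta>\<close> of it. The remainder of an element modulo \<open>t\<close>
  belongs to \<open>H\<close> and lies in \<open>[0, t)\<close>, hence is zero.\<close>

lemma discrete_subgroup_real:
  fixes H :: "real set"
  assumes zero: "0 \<in> H" and diff: "\<And>x y. x \<in> H \<Longrightarrow> y \<in> H \<Longrightarrow> x - y \<in> H"
    and gap: "\<And>x. x \<in> H \<Longrightarrow> x \<noteq> 0 \<Longrightarrow> \<delta> < \<bar>x\<bar>" and "0 < \<delta>"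
  shows "H = {0} \<or> (\<exists>t>\<delta>. H = range (\<lambda>k::int. t * of_int k))"
proof (cases "H = {0}")
  case False
  have neg: "- x \<in> H" if "x \<in> H" for x using diff[OF zero that] by simp
  have add: "x + y \<in> H" if "x \<in> H" "y \<in> H" for x y using diff[OF that(1) neg[OF that(2)]] by simp
  define P where "P = {x\<in>H. 0 < x}"
  obtain x0 where "x0 \<in> H" "x0 \<noteq> 0" using False zero by auto
  then have ne: "P \<noteq> {}" using neg[of x0] by (cases "0 < x0") (auto simp: P_def)
  have bdd: "bdd_below P" by (auto simp: P_def intro!: bdd_belowI[of _ 0])
  define t where "t = Inf P"
  have "t \<in> P"
  proof (rule ccontr)
    assume nt: "t \<notin> P"
    obtain h1 where h1: "h1 \<in> P" "h1 < t + \<delta>"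
      using cInf_less_iff[OF ne bdd, of "t + \<delta>"] \<open>0 < \<delta>\<close> by (auto simp: t_def)
    have "t \<le> h1" using cInf_lower[OF h1(1) bdd] by (simp add: t_def)
    with nt h1 have "t < h1" by (cases "t = h1") auto
    then obtain h2 where h2: "h2 \<in> P" "h2 < h1"
      using cInf_less_iff[OF ne bdd, of h1] by (auto simp: t_def)
    have "t \<le> h2" using cInf_lower[OF h2(1) bdd] by (simp add: t_def)
    moreover have "\<delta> < \<bar>h1 - h2\<bar>" using h1 h2 by (intro gap diff) (auto simp: P_def)
    ultimately show False using h1 h2 by linarith
  qed
  then have t: "t \<in> H" "0 < t" by (auto simp: P_def)
  have nat: "t * of_nat n \<in> H" for n
    by (induction n) (auto simp: zero algebra_simps intro: add t)
  have int: "t * of_int k \<in> H" for k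
    using nat[of "nat k"] neg[OF nat[of "nat (- k)"]] by (cases "0 \<le> k") auto
  have "h \<in> range (\<lambda>k::int. t * of_int k)" if "h \<in> H" for h
  proof -
    define r where "r = h - t * of_int \<lfloor>h / t\<rfloor>"
    have "r \<in> H" unfolding r_def by (intro diff that int)
    have "of_int \<lfloor>h / t\<rfloor> * t \<le> h" "h < (of_int \<lfloor>h / t\<rfloor> + 1) * t"
      using floor_divide_lower[OF t(2)] floor_divide_upper[OF t(2)] by auto
    then have "0 \<le> r" "r < t" by (auto simp: r_def algebra_simps)
    then have "r = 0" using cInf_lower[OF _ bdd, of r] \<open>r \<in> H\<close> by (force simp: P_def t_def)
    then show ?thesis by (auto simp: r_def)
  qed
  then have "H = range (\<lambda>k::int. t * of_int k)" using int by auto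
  moreover have "\<delta> < t" using gap[of t] t by auto
  ultimately show ?thesis by blast
qed simp

section \<open>Bounded measurable functions\<close>

text \<open>Nearly all Bochner integrals below have bounded measurable integrands. Closure of this
  one predicate under arithmetic, composition and integration against kernels turns integrability
  into a matter of introduction rules, for real and complex values alike.\<close>

definition bdd_meas :: "'a measure \<Rightarrow> ('a \<Rightarrow> 'b::{banach, second_countable_topology}) \<Rightarrow> bool" where
  "bdd_meas N g \<longleftrightarrow> g \<in> borel_measurable N \<and> (\<exists>B\<ge>0. \<forall>x\<in>space N. norm (g x) \<le> B)"

lemma bdd_measI:
  assumes "g \<in> borel_measurable N" "\<And>x. x \<in> space N \<Longrightarrow> norm (g x) \<le> B"
  shows "bdd_meas N g"
  using assms by (auto simp: bdd_meas_def intro!: exI[of _ "\<bar>B\<bar>"] intro: order_trans[OF _ abs_ge_self])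

lemma bdd_measE:
  assumes "bdd_meas N g"
  obtains B where "0 \<le> B" "\<And>x. x \<in> space N \<Longrightarrow> norm (g x) \<le> B"
  using assms by (auto simp: bdd_meas_def)

lemma bdd_meas_measurable:
  "bdd_meas N g \<Longrightarrow> g \<in> borel_measurable N"
  by (simp add: bdd_meas_def)

lemma bdd_meas_const: "bdd_meas N (\<lambda>x. c)"
  by (rule bdd_measI[where B = "norm c"]) auto

lemma bdd_meas_add:
  assumes f: "bdd_meas N f" and g: "bdd_meas N g"
  shows "bdd_meas N (\<lambda>x. f x + g x)"
proof -
  note [measurable] = assms[THEN bdd_meas_measurable]
  obtain A where A: "\<And>x. x \<in> space N \<Longrightarrow> norm (f x) \<le> A" using bdd_measE[OF f] by blast
  obtain B where B: "\<And>x. x \<in> space N \<Longrightarrow> norm (g x) \<le> B" using bdd_measE[OF g] by blast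
  show ?thesis
    using A B by (intro bdd_measI[where B = "A + B"])
      (auto intro!: norm_triangle_mono)
qed

lemma bdd_meas_mult:
  fixes f g :: "'a \<Rightarrow> 'b::{banach, second_countable_topology, real_normed_algebra}"
  assumes f: "bdd_meas N f" and g: "bdd_meas N g"
  shows "bdd_meas N (\<lambda>x. f x * g x)"
proof -
  note [measurable] = assms[THEN bdd_meas_measurable]
  obtain A where A: "0 \<le> A" "\<And>x. x \<in> space N \<Longrightarrow> norm (f x) \<le> A" using bdd_measE[OF f] by blast
  obtain B where B: "0 \<le> B" "\<And>x. x \<in> space N \<Longrightarrow> norm (g x) \<le> B" using bdd_measE[OF g] by blast
  show ?thesis
    using A B by (intro bdd_measI[where B = "A * B"])
      (auto intro!: order_trans[OF norm_mult_ineq] mult_mono)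
qed

lemma bdd_meas_minus:
  assumes "bdd_meas N f"
  shows "bdd_meas N (\<lambda>x. - f x)"
  using assms by (auto simp: bdd_meas_def)

lemma bdd_meas_diff:
  assumes "bdd_meas N f" "bdd_meas N g"
  shows "bdd_meas N (\<lambda>x. f x - g x)"
  using bdd_meas_add[OF assms(1) bdd_meas_minus[OF assms(2)]] by simp

lemma bdd_meas_power2:
  fixes f :: "'a \<Rightarrow> real"
  assumes "bdd_meas N f"
  shows "bdd_meas N (\<lambda>x. (f x)\<^sup>2)"
  unfolding power2_eq_square by (intro bdd_meas_mult assms)

lemma bdd_meas_sum:
  assumes "\<And>i. i \<in> I \<Longrightarrow> bdd_meas N (f i)"
  shows "bdd_meas N (\<lambda>x. \<Sum>i\<in>I. f i x)"
  using assms by (induction I rule: infinite_finite_induct)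
    (auto intro: bdd_meas_add bdd_meas_const)

lemma bdd_meas_compose:
  assumes g: "bdd_meas N g" and h: "h \<in> L \<rightarrow>\<^sub>M N"
  shows "bdd_meas L (\<lambda>x. g (h x))"
proof -
  obtain B where B: "\<And>x. x \<in> space N \<Longrightarrow> norm (g x) \<le> B" using bdd_measE[OF g] by blast
  show ?thesis
    using B measurable_space[OF h] measurable_compose[OF h bdd_meas_measurable[OF g]]
    by (intro bdd_measI[where B = B]) auto
qed

lemma bdd_meas_compose2:
  assumes f: "bdd_meas (N \<Otimes>\<^sub>M L) (case_prod f)"
    and [measurable]: "g \<in> R \<rightarrow>\<^sub>M N" "h \<in> R \<rightarrow>\<^sub>M L"
  shows "bdd_meas R (\<lambda>x. f (g x) (h x))"
  using bdd_meas_compose[OF f, of "\<lambda>x. (g x, h x)" R] by simp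

lemma bdd_meas_integral_kernel:
  fixes g :: "'b \<Rightarrow> 'a \<Rightarrow> 'c::{banach, second_countable_topology}"
  assumes g: "bdd_meas (N \<Otimes>\<^sub>M \<nu>) (\<lambda>z. g (fst z) (snd z))" and \<kappa>: "\<kappa> \<in> N \<rightarrow>\<^sub>M prob_algebra \<nu>"
  shows "bdd_meas N (\<lambda>x. \<integral>y. g x y \<partial>\<kappa> x)"
proof -
  obtain B where B: "0 \<le> B" "\<And>z. z \<in> space (N \<Otimes>\<^sub>M \<nu>) \<Longrightarrow> norm (g (fst z) (snd z)) \<le> B"
    using bdd_measE[OF g] by blast
  show ?thesis
  proof (rule bdd_measI)
    show "(\<lambda>x. \<integral>y. g x y \<partial>\<kappa> x) \<in> borel_measurable N"
      using bdd_meas_measurable[OF g]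
      by (intro borel_measurable_integral_kernel[OF _ \<kappa>]) (simp add: case_prod_beta')
    show "norm (LINT y|\<kappa> x. g x y) \<le> B" if "x \<in> space N" for x
    proof -
      have "prob_space (\<kappa> x)" "sets (\<kappa> x) = sets \<nu>"
        using measurable_space[OF \<kappa> that] by (auto simp: space_prob_algebra)
      then show ?thesis
        using B(2)[of "(x, _)"] that sets_eq_imp_space_eq[of "\<kappa> x" \<nu>]
        by (intro prob_space.norm_integral_le B(1)) (auto simp: space_pair_measure)
    qed
  qed
qed

lemma (in prob_space) integrable_bdd_meas:
  "bdd_meas M g \<Longrightarrow> integrable M g"
  by (auto simp: bdd_meas_def intro: integrable_bounded)

lemmas bdd_meas_intros =
  bdd_meas_const bdd_meas_add bdd_meas_mult bdd_meas_diff
  bdd_meas_power2 bdd_meas_sum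

section \<open>Elliptic chains\<close>

text \<open>Times are counted from 0 here: the chain of the theorem enters as \<open>\<lambda>n. X (Suc n)\<close>, and the
  position \<open>k + 3\<close> hexagon of the theorem starts at time \<open>k\<close>.\<close>

locale elliptic_chain = prob_space M for M :: "'w measure" +
  fixes F :: "nat \<Rightarrow> 'w measure" and X :: "nat \<Rightarrow> 'w \<Rightarrow> 'a"
    and \<mu> :: "nat \<Rightarrow> 'a measure" and p :: "nat \<Rightarrow> 'a \<Rightarrow> 'a \<Rightarrow> real" and eps :: real
  assumes eps: "0 < eps" "eps < 1"
    and subalg: "subalgebra M (F n)"
    and X_adapted: "i \<le> n \<Longrightarrow> X i \<in> F n \<rightarrow>\<^sub>M \<mu> i"
    and law: "distr M (\<mu> n) (X n) = \<mu> n"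
    and p_pair_measurable: "case_prod (p n) \<in> borel_measurable (\<mu> n \<Otimes>\<^sub>M \<mu> (Suc n))"
    and p_nonneg: "x \<in> space (\<mu> n) \<Longrightarrow> y \<in> space (\<mu> (Suc n)) \<Longrightarrow> 0 \<le> p n x y"
    and p_le: "x \<in> space (\<mu> n) \<Longrightarrow> y \<in> space (\<mu> (Suc n)) \<Longrightarrow> p n x y \<le> 1 / eps"
    and p_total: "x \<in> space (\<mu> n) \<Longrightarrow> (\<integral>\<^sup>+y. ennreal (p n x y) \<partial>\<mu> (Suc n)) = 1"
    and two_step: "x \<in> space (\<mu> n) \<Longrightarrow> z \<in> space (\<mu> (Suc (Suc n))) \<Longrightarrow>
          eps < (LINT y|\<mu> (Suc n). p n x y * p (Suc n) y z)"
    and markov: "A \<in> sets (F n) \<Longrightarrow> E \<in> sets (\<mu> (Suc n)) \<Longrightarrow>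
          emeasure M (A \<inter> (X (Suc n) -` E \<inter> space M)) =
            (\<integral>\<^sup>+w. indicator A w * (\<integral>\<^sup>+y. ennreal (p n (X n w) y) * indicator E y \<partial>\<mu> (Suc n)) \<partial>M)"
begin

lemma space_F [simp]: "space (F n) = space M"
  using subalg[of n] by (simp add: subalgebra_def)

text \<open>Encodes the inclusion of sigma-algebras as measurability of the identity, so that
  composition carries measurability from \<open>F n\<close> to \<open>M\<close>.\<close>

lemma id_measurable_F [measurable]: "(\<lambda>w. w) \<in> M \<rightarrow>\<^sub>M F n"
  using subalg[of n] by (auto simp: subalgebra_def measurable_def intro!: sets.Int)

lemma X_measurable [measurable]: "X n \<in> M \<rightarrow>\<^sub>M \<mu> n"
  using measurable_comp[OF id_measurable_F X_adapted[OF order_refl, of n]] by (simp add: comp_def)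

lemma X_space: "w \<in> space M \<Longrightarrow> X n w \<in> space (\<mu> n)"
  by (rule measurable_space[OF X_measurable])

lemma prob_space_mu: "prob_space (\<mu> n)"
  using prob_space_distr[OF X_measurable[of n]] by (simp add: law)

sublocale mu: prob_space "\<mu> n" for n by (rule prob_space_mu)

sublocale mu_pair: pair_prob_space "\<mu> m" "\<mu> n" for m n ..

lemma integral_law:
  fixes g :: "'a \<Rightarrow> 'b::{banach, second_countable_topology}"
  assumes "g \<in> borel_measurable (\<mu> n)"
  shows "(LINT w|M. g (X n w)) = (LINT x|\<mu> n. g x)"
  using integral_distr[OF X_measurable assms] by (simp add: law)

lemma p_measurable [measurable (raw)]:
  assumes [measurable]: "g \<in> N \<rightarrow>\<^sub>M \<mu> n" "h \<in> N \<rightarrow>\<^sub>M \<mu> (Suc n)"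
  shows "(\<lambda>x. p n (g x) (h x)) \<in> borel_measurable N"
proof -
  note p_pair_measurable[measurable]
  have "(\<lambda>x. case_prod (p n) (g x, h x)) \<in> borel_measurable N" by measurable
  then show ?thesis by simp
qed

lemma p_bounds: "x \<in> space (\<mu> n) \<Longrightarrow> y \<in> space (\<mu> (Suc n)) \<Longrightarrow> \<bar>p n x y\<bar> \<le> 1 / eps"
  using p_nonneg p_le by (auto simp: abs_le_iff intro: order_trans[of "- p n x y" 0])

section \<open>Transition kernels and the Markov property\<close>

text \<open>The transition kernel, rebuilt from its density, since the locale carries no separate
  kernel.\<close>

definition K :: "nat \<Rightarrow> 'a \<Rightarrow> 'a measure" where
  "K n x = density (\<mu> (Suc n)) (\<lambda>y. ennreal (p n x y))"

lemma K_measurable: "K n \<in> \<mu> n \<rightarrow>\<^sub>M prob_algebra (\<mu> (Suc n))"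
  unfolding K_def by (rule measurable_density_kernel) (auto simp: p_total mu.sigma_finite_measure_axioms)

lemma sets_K [measurable_cong, simp]: "sets (K n x) = sets (\<mu> (Suc n))"
  by (simp add: K_def)

lemma space_K [simp]: "space (K n x) = space (\<mu> (Suc n))"
  by (simp add: K_def)

lemma prob_space_K: "x \<in> space (\<mu> n) \<Longrightarrow> prob_space (K n x)"
  using measurable_space[OF K_measurable] by (simp add: space_prob_algebra)

lemma integral_K:
  fixes g :: "'a \<Rightarrow> 'b::{banach, second_countable_topology}"
  assumes [measurable]: "x \<in> space (\<mu> n)" "g \<in> borel_measurable (\<mu> (Suc n))"
  shows "(LINT y|K n x. g y) = (LINT y|\<mu> (Suc n). p n x y *\<^sub>R g y)"
  unfolding K_def using assms(1) by (intro integral_density) (auto intro!: AE_I2 p_nonneg)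

lemma integral_K_measurable [measurable (raw)]:
  fixes g :: "'b \<Rightarrow> 'a \<Rightarrow> 'c::{banach, second_countable_topology}"
  assumes "h \<in> N \<rightarrow>\<^sub>M \<mu> n" "case_prod g \<in> borel_measurable (N \<Otimes>\<^sub>M \<mu> (Suc n))"
  shows "(\<lambda>x. \<integral>y. g x y \<partial>K n (h x)) \<in> borel_measurable N"
  by (rule borel_measurable_integral_kernel[OF assms(2) measurable_compose[OF assms(1) K_measurable]])

text \<open>The Markov property as one identity for the joint law of the entire past and the next
  state. Both sides are measures that agree on rectangles, where the identity is the assumption
  \<open>markov\<close>, and the left one is finite.\<close>

lemma markov_law:
  "distr M (F n \<Otimes>\<^sub>M \<mu> (Suc n)) (\<lambda>w. (w, X (Suc n) w)) =
   density (restr_to_subalg M (F n) \<Otimes>\<^sub>M \<mu> (Suc n)) (\<lambda>(w, y). ennreal (p n (X n w) y))"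
  (is "?L = ?R")
proof -
  \<comment> \<open>The past must enter through the sigma-algebra \<open>F n\<close> only, so the
    right-hand side is built over the restriction of \<open>M\<close>.\<close>
  let ?M = "restr_to_subalg M (F n)"
  have [measurable_cong]: "sets ?M = sets (F n)" by (rule sets_restr_to_subalg[OF subalg])
  note X_adapted[OF order_refl, measurable]
  interpret L: prob_space ?L by (rule prob_space_distr) measurable
  let ?E = "{a \<times> b |a b. a \<in> sets (F n) \<and> b \<in> sets (\<mu> (Suc n))}"
  show ?thesis
  proof (rule measure_eqI_generator_eq[OF Int_stable_pair_measure_generator[of "F n" "\<mu> (Suc n)"]])
    show "?E \<subseteq> Pow (space M \<times> space (\<mu> (Suc n)))"
      using sets.space_closed[of "F n"] sets.space_closed[of "\<mu> (Suc n)"] by auto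
    show "sets ?L = sigma_sets (space M \<times> space (\<mu> (Suc n))) ?E"
      by (simp add: sets_pair_measure)
    show "sets ?R = sigma_sets (space M \<times> space (\<mu> (Suc n))) ?E"
      by (simp add: sets_pair_measure sets_restr_to_subalg[OF subalg] space_restr_to_subalg)
    show "range (\<lambda>i. space M \<times> space (\<mu> (Suc n))) \<subseteq> ?E"
      using sets.top[of "F n"] by auto
    show "(\<Union>i::nat. space M \<times> space (\<mu> (Suc n))) = space M \<times> space (\<mu> (Suc n))" by auto
    show "emeasure ?L (space M \<times> space (\<mu> (Suc n))) \<noteq> \<infinity>" for i :: nat
      by simp
  next
    fix Z assume "Z \<in> ?E"
    then obtain A E where Z: "Z = A \<times> E" and [measurable]: "A \<in> sets (F n)" "E \<in> sets (\<mu> (Suc n))"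
      by auto
    have A: "A \<subseteq> space M" using sets.sets_into_space[of A "F n"] by simp
    have "emeasure ?L Z = emeasure M (A \<inter> (X (Suc n) -` E \<inter> space M))"
      unfolding Z using A by (subst emeasure_distr) (auto intro!: arg_cong[where f = "emeasure M"])
    also have "\<dots> = (\<integral>\<^sup>+w. indicator A w * (\<integral>\<^sup>+y. ennreal (p n (X n w) y) * indicator E y \<partial>\<mu> (Suc n)) \<partial>M)"
      by (rule markov) auto
    also have "\<dots> = (\<integral>\<^sup>+w. indicator A w * (\<integral>\<^sup>+y. ennreal (p n (X n w) y) * indicator E y \<partial>\<mu> (Suc n)) \<partial>?M)"
      by (rule nn_integral_subalgebra2[OF subalg, symmetric]) measurable
    also have "\<dots> = (\<integral>\<^sup>+w. \<integral>\<^sup>+y. indicator A w * (ennreal (p n (X n w) y) * indicator E y) \<partial>\<mu> (Suc n) \<partial>?M)"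
      by (intro nn_integral_cong nn_integral_cmult[symmetric])
        (auto simp: space_restr_to_subalg dest: X_space)
    also have "\<dots> = (\<integral>\<^sup>+w. \<integral>\<^sup>+y. (\<lambda>(w, y). ennreal (p n (X n w) y)) (w, y) * indicator Z (w, y) \<partial>\<mu> (Suc n) \<partial>?M)"
      by (intro nn_integral_cong) (auto simp: Z indicator_def)
    also have "\<dots> = (\<integral>\<^sup>+z. (\<lambda>(w, y). ennreal (p n (X n w) y)) z * indicator Z z \<partial>(?M \<Otimes>\<^sub>M \<mu> (Suc n)))"
      by (subst mu.nn_integral_fst) (auto simp: Z)
    also have "\<dots> = emeasure ?R Z"
      by (subst emeasure_density) (auto simp: Z)
    finally show "emeasure ?L Z = emeasure ?R Z" .
  qed
qed

text \<open>Here \<open>\<Phi>\<close> may depend on the whole past and not just on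
  \<open>X n\<close>. Both the martingale comparison and the recursion for characteristic functions
  need this, as they involve the partial sum up to time \<open>n\<close>.\<close>

lemma integral_markov:
  fixes \<Phi> :: "'w \<Rightarrow> 'a \<Rightarrow> 'b::{banach, second_countable_topology}"
  assumes [measurable]: "case_prod \<Phi> \<in> borel_measurable (F n \<Otimes>\<^sub>M \<mu> (Suc n))"
    and B: "\<And>w y. w \<in> space M \<Longrightarrow> y \<in> space (\<mu> (Suc n)) \<Longrightarrow> norm (\<Phi> w y) \<le> B"
  shows "(LINT w|M. \<Phi> w (X (Suc n) w)) = (LINT w|M. (LINT y|K n (X n w). \<Phi> w y))"
proof -
  let ?M = "restr_to_subalg M (F n)"
  have [measurable_cong]: "sets ?M = sets (F n)" by (rule sets_restr_to_subalg[OF subalg])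
  have space: "space ?M = space M" by (simp add: space_restr_to_subalg)
  note X_adapted[OF order_refl, measurable]
  interpret R: prob_space ?M
    using emeasure_restr_to_subalg[OF subalg sets.top, of n] by (intro prob_spaceI) (simp add: space emeasure_space_1)
  interpret RP: pair_prob_space ?M "\<mu> (Suc n)" ..
  let ?G = "\<lambda>z. (\<lambda>(w, y). p n (X n w) y) z *\<^sub>R case_prod \<Phi> z"
  have int: "integrable (?M \<Otimes>\<^sub>M \<mu> (Suc n)) ?G"
  proof (rule RP.P.integrable_bounded)
    fix z assume "z \<in> space (?M \<Otimes>\<^sub>M \<mu> (Suc n))"
    then obtain w y where z: "z = (w, y)" "w \<in> space M" "y \<in> space (\<mu> (Suc n))"
      by (auto simp: space_pair_measure space)
    have "\<bar>p n (X n w) y\<bar> * norm (\<Phi> w y) \<le> 1 / eps * B"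
      using z eps by (intro mult_mono p_bounds X_space B) auto
    then show "norm (?G z) \<le> 1 / eps * B" by (simp add: z(1))
  qed measurable
  have "(LINT w|M. \<Phi> w (X (Suc n) w)) =
    (LINT z|distr M (F n \<Otimes>\<^sub>M \<mu> (Suc n)) (\<lambda>w. (w, X (Suc n) w)). case_prod \<Phi> z)"
    by (subst integral_distr) auto
  also have "\<dots> = (LINT z|density (?M \<Otimes>\<^sub>M \<mu> (Suc n)) (\<lambda>z. ennreal (case z of (w, y) \<Rightarrow> p n (X n w) y)). case_prod \<Phi> z)"
    unfolding markov_law by (simp add: case_prod_beta')
  also have "\<dots> = (LINT z|(?M \<Otimes>\<^sub>M \<mu> (Suc n)). ?G z)"
    by (rule integral_density) (auto simp: space_pair_measure space X_space p_nonneg intro!: AE_I2)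
  also have "\<dots> = (LINT w|?M. (LINT y|\<mu> (Suc n). ?G (w, y)))"
    by (rule RP.integral_fst'[OF int, symmetric])
  also have "\<dots> = (LINT w|M. (LINT y|\<mu> (Suc n). ?G (w, y)))"
    by (rule integral_subalgebra2[OF subalg]) measurable
  also have "\<dots> = (LINT w|M. (LINT y|K n (X n w). \<Phi> w y))"
    by (rule Bochner_Integration.integral_cong) (simp_all add: integral_K X_space)
  finally show ?thesis .
qed

lemma integral_K_bound:
  fixes g :: "'a \<Rightarrow> 'b::{banach, second_countable_topology}"
  assumes "x \<in> space (\<mu> n)" "\<And>y. y \<in> space (\<mu> (Suc n)) \<Longrightarrow> norm (g y) \<le> B" "0 \<le> B"
  shows "norm (LINT y|K n x. g y) \<le> B"
  using prob_space.norm_integral_le[OF prob_space_K[OF assms(1)], of g B] assms by simp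

lemma integral_pair:
  fixes g :: "'a \<Rightarrow> 'a \<Rightarrow> 'b::{banach, second_countable_topology}"
  assumes [measurable]: "case_prod g \<in> borel_measurable (\<mu> n \<Otimes>\<^sub>M \<mu> (Suc n))"
    and B: "\<And>x y. x \<in> space (\<mu> n) \<Longrightarrow> y \<in> space (\<mu> (Suc n)) \<Longrightarrow> norm (g x y) \<le> B"
  shows "(LINT w|M. g (X n w) (X (Suc n) w)) = (LINT x|\<mu> n. LINT y|K n x. g x y)"
proof -
  note X_adapted[OF order_refl, measurable]
  have "(LINT w|M. g (X n w) (X (Suc n) w)) = (LINT w|M. (LINT y|K n (X n w). g (X n w) y))"
    by (rule integral_markov) (auto intro!: B X_space)
  also have "\<dots> = (LINT x|\<mu> n. LINT y|K n x. g x y)"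
    by (rule integral_law[of "\<lambda>x. \<integral>y. g x y \<partial>K n x"]) measurable
  finally show ?thesis .
qed

text \<open>The kernels carry each marginal to the next one; this brings an averaged square back to
  an integral over a single marginal.\<close>

lemma integral_K_law:
  fixes g :: "'a \<Rightarrow> 'b::{banach, second_countable_topology}"
  assumes [measurable]: "g \<in> borel_measurable (\<mu> (Suc n))"
    and B: "\<And>y. y \<in> space (\<mu> (Suc n)) \<Longrightarrow> norm (g y) \<le> B"
  shows "(LINT x|\<mu> n. LINT y|K n x. g y) = (LINT y|\<mu> (Suc n). g y)"
proof -
  have "(LINT x|\<mu> n. LINT y|K n x. g y) = (LINT w|M. g (X (Suc n) w))"
    by (rule integral_pair[symmetric]) (auto intro!: B)
  then show ?thesis by (simp add: integral_law)
qed

text \<open>A Doeblin minorisation. By Fubini the two-step average integrates \<open>g\<close>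
  against the two-step density, which exceeds \<open>eps\<close> at every point. It is the source of
  all mixing below.\<close>

lemma two_step_lower:
  fixes g :: "'a \<Rightarrow> real"
  assumes [measurable]: "g \<in> borel_measurable (\<mu> (Suc (Suc n)))"
    and B: "\<And>z. z \<in> space (\<mu> (Suc (Suc n))) \<Longrightarrow> 0 \<le> g z \<and> g z \<le> B"
    and x [measurable]: "x \<in> space (\<mu> n)"
  shows "eps * (LINT z|\<mu> (Suc (Suc n)). g z) \<le> (LINT y|K n x. LINT z|K (Suc n) y. g z)"
proof -
  let ?q = "\<lambda>z. \<integral>y. p n x y * p (Suc n) y z \<partial>\<mu> (Suc n)"
  have pp: "\<bar>p n x y * p (Suc n) y z\<bar> \<le> 1 / eps * (1 / eps)"
    if "y \<in> space (\<mu> (Suc n))" "z \<in> space (\<mu> (Suc (Suc n)))" for y z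
    unfolding abs_mult using that x eps by (intro mult_mono p_bounds) auto
  have ppg: "\<bar>p n x y * p (Suc n) y z * g z\<bar> \<le> 1 / eps * (1 / eps) * B"
    if "y \<in> space (\<mu> (Suc n))" "z \<in> space (\<mu> (Suc (Suc n)))" for y z
    unfolding abs_mult[of _ "g z"] using pp[OF that] B[OF that(2)] eps
    by (intro mult_mono) auto
  have q: "norm (?q z) \<le> 1 / eps * (1 / eps)" if "z \<in> space (\<mu> (Suc (Suc n)))" for z
    using eps that pp by (intro mu.norm_integral_le) auto
  have "eps * (LINT z|\<mu> (Suc (Suc n)). g z) = (LINT z|\<mu> (Suc (Suc n)). eps * g z)" by simp
  also have "\<dots> \<le> (LINT z|\<mu> (Suc (Suc n)). ?q z * g z)"
  proof (rule integral_mono)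
    show "integrable (\<mu> (Suc (Suc n))) (\<lambda>z. eps * g z)"
      using B eps by (intro mu.integrable_bounded[where B = "eps * B"]) auto
    show "integrable (\<mu> (Suc (Suc n))) (\<lambda>z. ?q z * g z)"
    proof (rule mu.integrable_bounded[where B = "1 / eps * (1 / eps) * B"])
      fix z assume z: "z \<in> space (\<mu> (Suc (Suc n)))"
      show "norm (?q z * g z) \<le> 1 / eps * (1 / eps) * B"
        unfolding norm_mult using q[OF z] B[OF z] eps by (intro mult_mono) auto
    qed measurable
    show "eps * g z \<le> ?q z * g z" if "z \<in> space (\<mu> (Suc (Suc n)))" for z
      using two_step[OF x that] B[OF that] by (intro mult_right_mono) auto
  qed
  also have "\<dots> = (LINT z|\<mu> (Suc (Suc n)). LINT y|\<mu> (Suc n). p n x y * p (Suc n) y z * g z)"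
    by simp
  also have "\<dots> = (LINT y|\<mu> (Suc n). LINT z|\<mu> (Suc (Suc n)). p n x y * p (Suc n) y z * g z)"
  proof (rule mu_pair.Fubini_integral[of "Suc n" "Suc (Suc n)" "\<lambda>y z. p n x y * p (Suc n) y z * g z"])
    show "integrable (\<mu> (Suc n) \<Otimes>\<^sub>M \<mu> (Suc (Suc n))) (\<lambda>(y, z). p n x y * p (Suc n) y z * g z)"
      using ppg by (intro mu_pair.P.integrable_bounded[where B = "1 / eps * (1 / eps) * B"])
        (auto simp: space_pair_measure)
  qed
  also have "\<dots> = (LINT y|\<mu> (Suc n). p n x y *\<^sub>R (LINT z|K (Suc n) y. g z))"
    by (intro Bochner_Integration.integral_cong) (auto simp: integral_K mult.assoc)
  also have "\<dots> = (LINT y|K n x. LINT z|K (Suc n) y. g z)"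
    by (rule integral_K[symmetric]) (use x in auto)
  finally show ?thesis .
qed

section \<open>Variance of sums with vanishing means\<close>

lemma bdd_meas_K_cong: "bdd_meas (K n x) g \<longleftrightarrow> bdd_meas (\<mu> (Suc n)) g"
  by (simp add: bdd_meas_def cong: measurable_cong_sets)

lemma integrable_K_bm:
  "x \<in> space (\<mu> n) \<Longrightarrow> bdd_meas (\<mu> (Suc n)) g \<Longrightarrow> integrable (K n x) g"
  using prob_space.integrable_bdd_meas[OF prob_space_K] by (simp add: bdd_meas_K_cong)

lemma measure_K_space: "x \<in> space (\<mu> n) \<Longrightarrow> measure (K n x) (space (\<mu> (Suc n))) = 1"
  using prob_space.prob_space[OF prob_space_K] by simp

lemma bdd_meas_integral_K:
  fixes g :: "'b \<Rightarrow> 'a \<Rightarrow> 'c::{banach, second_countable_topology}"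
  assumes g: "bdd_meas (N \<Otimes>\<^sub>M \<mu> (Suc n)) (\<lambda>z. g (fst z) (snd z))" and h: "h \<in> N \<rightarrow>\<^sub>M \<mu> n"
  shows "bdd_meas N (\<lambda>x. \<integral>y. g x y \<partial>K n (h x))"
  by (rule bdd_meas_integral_kernel[OF g measurable_compose[OF h K_measurable]])

lemma integral_K_square_add:
  fixes h :: "'a \<Rightarrow> real"
  assumes x: "x \<in> space (\<mu> n)" and h: "bdd_meas (\<mu> (Suc n)) h"
  shows "(LINT y|K n x. (s + h y)\<^sup>2) = s\<^sup>2 + 2 * s * (LINT y|K n x. h y) + (LINT y|K n x. (h y)\<^sup>2)"
    and "(LINT y|K n x. h y)\<^sup>2 \<le> (LINT y|K n x. (h y)\<^sup>2)"
proof -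
  interpret Kx: prob_space "K n x" by (rule prob_space_K[OF x])
  have [simp]: "integrable (K n x) h" "integrable (K n x) (\<lambda>y. (h y)\<^sup>2)"
    by (intro integrable_K_bm[OF x] bdd_meas_intros h)+
  show "(LINT y|K n x. (s + h y)\<^sup>2) = s\<^sup>2 + 2 * s * (LINT y|K n x. h y) + (LINT y|K n x. (h y)\<^sup>2)"
    by (simp add: power2_sum measure_K_space[OF x] algebra_simps)
  obtain B where "\<And>y. y \<in> space (\<mu> (Suc n)) \<Longrightarrow> norm (h y) \<le> B" using bdd_measE[OF h] by blast
  then show "(LINT y|K n x. h y)\<^sup>2 \<le> (LINT y|K n x. (h y)\<^sup>2)"
    using bdd_meas_measurable[OF h]
    by (intro Kx.square_integral_le_bounded[where B = B]) auto
qed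

lemma integral_K_law_bm:
  "bdd_meas (\<mu> (Suc n)) g \<Longrightarrow> (LINT x|\<mu> n. LINT y|K n x. g y) = (LINT y|\<mu> (Suc n). g y)"
  by (auto simp: bdd_meas_def intro: integral_K_law)

lemma integral_pair_bm:
  "bdd_meas (\<mu> n \<Otimes>\<^sub>M \<mu> (Suc n)) (case_prod g) \<Longrightarrow>
    (LINT w|M. g (X n w) (X (Suc n) w)) = (LINT x|\<mu> n. LINT y|K n x. g x y)"
  by (auto simp: bdd_meas_def space_pair_measure intro: integral_pair)

lemma integral_markov_bm:
  "bdd_meas (F n \<Otimes>\<^sub>M \<mu> (Suc n)) (case_prod \<Phi>) \<Longrightarrow>
   (LINT w|M. \<Phi> w (X (Suc n) w)) = (LINT w|M. (LINT y|K n (X n w). \<Phi> w y))"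
  by (auto simp: bdd_meas_def space_pair_measure intro: integral_markov)

text \<open>Apply \<open>two_step_lower\<close> to the squared deviation of \<open>h\<close> from
  its own two-step average \<open>?t\<close> at \<open>x\<close>. The right-hand side becomes a
  conditional variance, and since \<open>h\<close> has mean zero the left integral is that of the
  square of \<open>h\<close> plus the square of \<open>?t\<close>. This bounds the square of
  \<open>?t\<close> by the averaged square minus \<open>eps\<close> times the mean square;
  integrating over \<open>x\<close> finishes the proof.\<close>

lemma contraction:
  fixes h :: "'a \<Rightarrow> real"
  assumes h: "bdd_meas (\<mu> (Suc (Suc n))) h" and mean: "(LINT z|\<mu> (Suc (Suc n)). h z) = 0"
  shows "(LINT x|\<mu> n. (LINT y|K n x. LINT z|K (Suc n) y. h z)\<^sup>2) \<le> (1 - eps) * (LINT z|\<mu> (Suc (Suc n)). (h z)\<^sup>2)"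
proof -
  let ?P = "\<lambda>h x. \<integral>y. \<integral>z. h z \<partial>K (Suc n) y \<partial>K n x"
  have P: "bdd_meas (\<mu> (Suc n)) (\<lambda>y. \<integral>z. g z \<partial>K (Suc n) y)" "bdd_meas (\<mu> n) (?P g)"
    if g: "bdd_meas (\<mu> (Suc (Suc n))) g" for g :: "'a \<Rightarrow> real"
    by (intro bdd_meas_integral_K bdd_meas_compose[OF g], measurable)+
  have h2: "bdd_meas (\<mu> (Suc (Suc n))) (\<lambda>z. (h z)\<^sup>2)"
    by (intro bdd_meas_intros h)
  have pointwise: "(?P h x)\<^sup>2 \<le> ?P (\<lambda>z. (h z)\<^sup>2) x - eps * (LINT z|\<mu> (Suc (Suc n)). (h z)\<^sup>2)"
    if x: "x \<in> space (\<mu> n)" for x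
  proof -
    let ?t = "?P h x"
    have d: "bdd_meas (\<mu> (Suc (Suc n))) (\<lambda>z. (h z - ?t)\<^sup>2)"
      by (intro bdd_meas_intros h)
    obtain B where B: "\<And>z. z \<in> space (\<mu> (Suc (Suc n))) \<Longrightarrow> norm ((h z - ?t)\<^sup>2) \<le> B"
      using bdd_measE[OF d] by blast
    have "eps * (LINT z|\<mu> (Suc (Suc n)). (h z - ?t)\<^sup>2) \<le> ?P (\<lambda>z. (h z - ?t)\<^sup>2) x"
      using B bdd_meas_measurable[OF d] x by (intro two_step_lower[where B = B]) auto
    also have "\<dots> = (LINT y|K n x. ?t\<^sup>2 - 2 * ?t * (LINT z|K (Suc n) y. h z) + (LINT z|K (Suc n) y. (h z)\<^sup>2))"
      using integral_K_square_add(1)[of _ "Suc n" h "- ?t"] h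
      by (intro Bochner_Integration.integral_cong) auto
    also have "\<dots> = ?P (\<lambda>z. (h z)\<^sup>2) x - ?t\<^sup>2"
    proof -
      interpret Kx: prob_space "K n x" by (rule prob_space_K[OF x])
      show ?thesis
        using integrable_K_bm[OF x P(1)[OF h]] integrable_K_bm[OF x P(1)[OF h2]]
        by (simp add: power2_eq_square measure_K_space[OF x])
    qed
    finally have "eps * (LINT z|\<mu> (Suc (Suc n)). (h z - ?t)\<^sup>2) \<le> ?P (\<lambda>z. (h z)\<^sup>2) x - ?t\<^sup>2" .
    moreover have "(LINT z|\<mu> (Suc (Suc n)). (h z - ?t)\<^sup>2) = (LINT z|\<mu> (Suc (Suc n)). (h z)\<^sup>2) + ?t\<^sup>2"
      using mu.integrable_bdd_meas[OF h] mu.integrable_bdd_meas[OF h2]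
      by (simp add: power2_diff mean mu.prob_space)
    moreover have "0 \<le> eps * ?t\<^sup>2" using eps by simp
    ultimately show ?thesis by (simp add: distrib_left)
  qed
  have "(LINT x|\<mu> n. (?P h x)\<^sup>2) \<le> (LINT x|\<mu> n. ?P (\<lambda>z. (h z)\<^sup>2) x - eps * (LINT z|\<mu> (Suc (Suc n)). (h z)\<^sup>2))"
    by (intro integral_mono mu.integrable_bdd_meas bdd_meas_intros P h h2 pointwise)
  also have "\<dots> = (LINT x|\<mu> n. ?P (\<lambda>z. (h z)\<^sup>2) x) - eps * (LINT z|\<mu> (Suc (Suc n)). (h z)\<^sup>2)"
    using mu.integrable_bdd_meas[OF P(2)[OF h2]] by (simp add: mu.prob_space)
  also have "(LINT x|\<mu> n. ?P (\<lambda>z. (h z)\<^sup>2) x) = (LINT z|\<mu> (Suc (Suc n)). (h z)\<^sup>2)"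
    using integral_K_law_bm[OF P(1)[OF h2]] integral_K_law_bm[OF h2] by simp
  finally show ?thesis by (simp add: algebra_simps)
qed

section \<open>Tail means of a centred functional and the variance of its sums\<close>

text \<open>The conditional expectation of the \<open>j\<close> summands at times \<open>n\<close>
  to \<open>n + j - 1\<close>, given state \<open>x\<close> at time \<open>n\<close>, computed by
  backward recursion.\<close>

primrec tail_mean :: "(nat \<Rightarrow> 'a \<Rightarrow> 'a \<Rightarrow> real) \<Rightarrow> nat \<Rightarrow> nat \<Rightarrow> 'a \<Rightarrow> real" where
  "tail_mean \<phi> 0 = (\<lambda>n x. 0)"
| "tail_mean \<phi> (Suc j) = (\<lambda>n x. \<integral>y. \<phi> n x y + tail_mean \<phi> j (Suc n) y \<partial>K n x)"

definition energy :: "(nat \<Rightarrow> 'a \<Rightarrow> 'a \<Rightarrow> real) \<Rightarrow> nat \<Rightarrow> real" where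
  "energy \<phi> n = (LINT x|\<mu> n. LINT y|K n x. (\<phi> n x y)\<^sup>2)"

lemma energy_nonneg: "0 \<le> energy \<phi> n"
  by (simp add: energy_def)

context
  fixes \<phi> :: "nat \<Rightarrow> 'a \<Rightarrow> 'a \<Rightarrow> real"
  assumes phi: "\<And>n. bdd_meas (\<mu> n \<Otimes>\<^sub>M \<mu> (Suc n)) (case_prod (\<phi> n))"
    and mean_zero: "\<And>n. (LINT x|\<mu> n. LINT y|K n x. \<phi> n x y) = 0"
begin

lemma tail_mean_bm: "bdd_meas (\<mu> n) (tail_mean \<phi> j n)"
proof (induction j arbitrary: n)
  case (Suc j)
  show ?case
    unfolding tail_mean.simps
    by (intro bdd_meas_integral_K bdd_meas_intros bdd_meas_compose2[OF phi]
        bdd_meas_compose[OF Suc]) measurable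
qed (simp add: bdd_meas_const)

lemmas phi_intros = bdd_meas_integral_K bdd_meas_intros bdd_meas_compose2[OF phi]
  bdd_meas_compose[OF tail_mean_bm]

text \<open>The centring that \<open>contraction\<close> requires.\<close>

lemma tail_mean_zero: "(LINT x|\<mu> n. tail_mean \<phi> j n x) = 0"
proof (induction j arbitrary: n)
  case (Suc j)
  have "(LINT x|\<mu> n. tail_mean \<phi> (Suc j) n x) =
    (LINT x|\<mu> n. (LINT y|K n x. \<phi> n x y) + (LINT y|K n x. tail_mean \<phi> j (Suc n) y))"
    unfolding tail_mean.simps
    by (intro Bochner_Integration.integral_cong refl Bochner_Integration.integral_add integrable_K_bm phi_intros)
      measurable
  also have "\<dots> = (LINT x|\<mu> n. LINT y|K n x. \<phi> n x y) + (LINT x|\<mu> n. LINT y|K n x. tail_mean \<phi> j (Suc n) y)"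
    by (intro Bochner_Integration.integral_add mu.integrable_bdd_meas phi_intros) measurable
  also have "\<dots> = 0"
    by (simp add: mean_zero integral_K_law_bm[OF tail_mean_bm] Suc)
  finally show ?case .
qed simp

lemma integral_square_add_le:
  fixes g :: "'a \<Rightarrow> real"
  assumes g: "bdd_meas (\<mu> (Suc n)) g"
  shows "(LINT x|\<mu> n. LINT y|K n x. (\<phi> n x y + g y)\<^sup>2) \<le> 2 * energy \<phi> n + 2 * (LINT y|\<mu> (Suc n). (g y)\<^sup>2)"
proof -
  note gi = phi_intros bdd_meas_compose[OF g]
  have *: "(s + t)\<^sup>2 \<le> 2 * s\<^sup>2 + 2 * t\<^sup>2" for s t :: real
    using sum_squares_bound[of s t] by (simp add: power2_sum)
  have "(LINT x|\<mu> n. LINT y|K n x. (\<phi> n x y + g y)\<^sup>2) \<le> (LINT x|\<mu> n. LINT y|K n x. 2 * (\<phi> n x y)\<^sup>2 + 2 * (g y)\<^sup>2)"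
    by (intro integral_mono mu.integrable_bdd_meas integrable_K_bm gi *) measurable
  also have "\<dots> = (LINT x|\<mu> n. 2 * (LINT y|K n x. (\<phi> n x y)\<^sup>2) + 2 * (LINT y|K n x. (g y)\<^sup>2))"
  proof (rule Bochner_Integration.integral_cong[OF refl])
    fix x assume x: "x \<in> space (\<mu> n)"
    have "integrable (K n x) (\<lambda>y. (\<phi> n x y)\<^sup>2)" "integrable (K n x) (\<lambda>y. (g y)\<^sup>2)"
      using x by (intro integrable_K_bm gi; measurable)+
    then show "(LINT y|K n x. 2 * (\<phi> n x y)\<^sup>2 + 2 * (g y)\<^sup>2) = 2 * (LINT y|K n x. (\<phi> n x y)\<^sup>2) + 2 * (LINT y|K n x. (g y)\<^sup>2)"
      by simp
  qed
  also have "\<dots> = 2 * energy \<phi> n + 2 * (LINT x|\<mu> n. LINT y|K n x. (g y)\<^sup>2)"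
  proof -
    have "integrable (\<mu> n) (\<lambda>x. \<integral>y. (\<phi> n x y)\<^sup>2 \<partial>K n x)" "integrable (\<mu> n) (\<lambda>x. \<integral>y. (g y)\<^sup>2 \<partial>K n x)"
      by (intro mu.integrable_bdd_meas gi; measurable)+
    then show ?thesis by (simp add: energy_def)
  qed
  also have "(LINT x|\<mu> n. LINT y|K n x. (g y)\<^sup>2) = (LINT y|\<mu> (Suc n). (g y)\<^sup>2)"
    by (intro integral_K_law_bm bdd_meas_intros g)
  finally show ?thesis by simp
qed

definition tail_variance :: "nat \<Rightarrow> nat \<Rightarrow> real" where
  "tail_variance j n = (LINT x|\<mu> n. (tail_mean \<phi> j n x)\<^sup>2)"

lemma tail_variance_nonneg: "0 \<le> tail_variance j n"
  by (simp add: tail_variance_def)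

lemma square_mean_le_energy: "(LINT x|\<mu> n. (LINT y|K n x. \<phi> n x y)\<^sup>2) \<le> energy \<phi> n"
  unfolding energy_def
  by (intro integral_mono mu.integrable_bdd_meas phi_intros integral_K_square_add(2)) measurable

lemma tail_variance_1: "tail_variance (Suc 0) n \<le> energy \<phi> n"
  using square_mean_le_energy[of n] by (simp add: tail_variance_def)

text \<open>Split off the first two summands: \<open>a\<close> is their conditional mean, and
  \<open>c\<close> is the two-step average of the remaining tail mean, to which
  \<open>contraction\<close> applies.\<close>

lemma tail_variance_step:
  "tail_variance (Suc (Suc j)) n \<le>
     (1 + 1 / eps) * (2 * energy \<phi> n + 2 * energy \<phi> (Suc n)) + (1 - eps\<^sup>2) * tail_variance j (Suc (Suc n))"
proof -
  define h where "h y = (LINT z|K (Suc n) y. \<phi> (Suc n) y z)" for y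
  define a where "a x = (LINT y|K n x. \<phi> n x y + h y)" for x
  define c where "c x = (LINT y|K n x. LINT z|K (Suc n) y. tail_mean \<phi> j (Suc (Suc n)) z)" for x
  have h: "bdd_meas (\<mu> (Suc n)) h"
    unfolding h_def by (intro phi_intros) measurable
  have a: "bdd_meas (\<mu> n) a"
    unfolding a_def by (intro phi_intros bdd_meas_compose[OF h]) measurable
  have c: "bdd_meas (\<mu> n) c"
    unfolding c_def by (intro phi_intros) measurable
  have split: "tail_mean \<phi> (Suc (Suc j)) n x = a x + c x" if x: "x \<in> space (\<mu> n)" for x
  proof -
    have "tail_mean \<phi> (Suc (Suc j)) n x =
      (LINT y|K n x. (\<phi> n x y + h y) + (LINT z|K (Suc n) y. tail_mean \<phi> j (Suc (Suc n)) z))"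
      unfolding tail_mean.simps h_def add.assoc using x
      by (intro Bochner_Integration.integral_cong refl arg_cong[where f = "(+) _"]
          Bochner_Integration.integral_add integrable_K_bm phi_intros; measurable)
    also have "\<dots> = a x + c x"
      unfolding a_def c_def using x
      by (intro Bochner_Integration.integral_add integrable_K_bm phi_intros bdd_meas_compose[OF h]; measurable)
    finally show ?thesis .
  qed
  \<comment> \<open>Young's inequality with weight \<open>eps\<close>: the factor
    \<open>1 + eps\<close> in front of \<open>c\<close> times the contraction factor
    \<open>1 - eps\<close> is \<open>1 - eps\<^sup>2\<close>, still below 1. The plain factor 2
    would destroy the contraction.\<close>
  have weighted: "(s + t)\<^sup>2 \<le> (1 + 1 / eps) * s\<^sup>2 + (1 + eps) * t\<^sup>2" for s t :: real
  proof -
    have "0 \<le> (s - eps * t)\<^sup>2 / eps" using eps by simp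
    then show ?thesis using eps by (simp add: power2_eq_square field_simps)
  qed
  have "tail_variance (Suc (Suc j)) n = (LINT x|\<mu> n. (a x + c x)\<^sup>2)"
    unfolding tail_variance_def by (intro Bochner_Integration.integral_cong refl arg_cong[where f = "\<lambda>x. x\<^sup>2"] split)
  also have "\<dots> \<le> (LINT x|\<mu> n. (1 + 1 / eps) * (a x)\<^sup>2 + (1 + eps) * (c x)\<^sup>2)"
    by (intro integral_mono mu.integrable_bdd_meas bdd_meas_intros a c weighted)
  also have "\<dots> = (1 + 1 / eps) * (LINT x|\<mu> n. (a x)\<^sup>2) + (1 + eps) * (LINT x|\<mu> n. (c x)\<^sup>2)"
    using mu.integrable_bdd_meas[OF bdd_meas_power2[OF a]]
      mu.integrable_bdd_meas[OF bdd_meas_power2[OF c]] by simp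
  also have "\<dots> \<le> (1 + 1 / eps) * (2 * energy \<phi> n + 2 * energy \<phi> (Suc n))
      + (1 + eps) * ((1 - eps) * tail_variance j (Suc (Suc n)))"
  proof (intro add_mono mult_left_mono)
    have "(LINT x|\<mu> n. (a x)\<^sup>2) \<le> (LINT x|\<mu> n. LINT y|K n x. (\<phi> n x y + h y)\<^sup>2)"
      unfolding a_def
      by (intro integral_mono mu.integrable_bdd_meas phi_intros integral_K_square_add(2)
          bdd_meas_compose[OF h]) measurable
    also have "\<dots> \<le> 2 * energy \<phi> n + 2 * (LINT y|\<mu> (Suc n). (h y)\<^sup>2)"
      by (rule integral_square_add_le[OF h])
    also have "\<dots> \<le> 2 * energy \<phi> n + 2 * energy \<phi> (Suc n)"
      using square_mean_le_energy[of "Suc n"] by (simp add: h_def)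
    finally show "(LINT x|\<mu> n. (a x)\<^sup>2) \<le> 2 * energy \<phi> n + 2 * energy \<phi> (Suc n)" .
    show "(LINT x|\<mu> n. (c x)\<^sup>2) \<le> (1 - eps) * tail_variance j (Suc (Suc n))"
      unfolding c_def tail_variance_def by (rule contraction[OF tail_mean_bm tail_mean_zero])
  qed (use eps in auto)
  also have "(1 + eps) * ((1 - eps) * tail_variance j (Suc (Suc n))) = (1 - eps\<^sup>2) * tail_variance j (Suc (Suc n))"
    by (simp add: power2_eq_square algebra_simps)
  finally show ?thesis .
qed

text \<open>Summing the recursion over \<open>n\<close> reproduces the same sum, shifted by two and
  multiplied by \<open>1 - eps\<^sup>2\<close>, so it can be absorbed on the left. This replaces an
  explicit geometric decay of correlations.\<close>

lemma sum_tail_variance: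
  assumes E: "\<And>N. (\<Sum>n<N. energy \<phi> n) \<le> E"
  shows "(\<Sum>n<N. tail_variance (N - n) n) \<le> (1 + 1 / eps) * (4 * E) / eps\<^sup>2"
proof -
  let ?s = "\<lambda>n. tail_variance (N - n) n" and ?c = "1 + 1 / eps"
  have eps2: "0 < eps\<^sup>2" "eps\<^sup>2 < 1" using eps by (auto simp: power_less_one_iff)
  have c: "1 \<le> ?c" using eps by simp
  \<comment> \<open>Truncated subtraction makes the tail empty from \<open>N\<close> on, which
    closes the recursion at the end of the range.\<close>
  have zero: "?s n = 0" if "N \<le> n" for n using that by (simp add: tail_variance_def)
  have step: "?s n \<le> ?c * (2 * energy \<phi> n + 2 * energy \<phi> (Suc n)) + (1 - eps\<^sup>2) * ?s (n + 2)" if "n < N" for n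
  \<comment> \<open>With a single summand left the two-step recursion does not apply; the one-step
    bound suffices, and the shifted term is zero.\<close>
  proof (cases "N - n = 1")
    case True
    have "?s n \<le> energy \<phi> n" using tail_variance_1[of n] True by simp
    also have "\<dots> \<le> 1 * (2 * energy \<phi> n + 2 * energy \<phi> (Suc n))"
      using energy_nonneg[of \<phi> n] energy_nonneg[of \<phi> "Suc n"] by simp
    also have "\<dots> \<le> ?c * (2 * energy \<phi> n + 2 * energy \<phi> (Suc n))"
      using energy_nonneg[of \<phi> n] energy_nonneg[of \<phi> "Suc n"] by (intro mult_right_mono c) auto
    finally show ?thesis using True zero[of "n + 2"] by simp
  next
    case False
    then have "N - n = Suc (Suc (N - (n + 2)))" using that by simp
    then show ?thesis using tail_variance_step[of "N - (n + 2)" n] by simp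
  qed
  have shift: "(\<Sum>n<N. ?s (n + 2)) \<le> (\<Sum>n<N. ?s n)"
  proof -
    have "(\<Sum>n<N. ?s (n + 2)) = (\<Sum>n\<in>{2..<N+2}. ?s n)"
      by (rule sum.reindex_bij_witness[of _ "\<lambda>n. n - 2" "\<lambda>n. n + 2"]) auto
    also have "\<dots> = (\<Sum>n\<in>{2..<N}. ?s n)"
      by (rule sum.mono_neutral_right) (auto simp: tail_variance_def)
    also have "\<dots> \<le> (\<Sum>n<N. ?s n)"
      by (rule sum_mono2) (auto simp: tail_variance_nonneg)
    finally show ?thesis .
  qed
  have "(\<Sum>n<N. ?s n) \<le> (\<Sum>n<N. ?c * (2 * energy \<phi> n + 2 * energy \<phi> (Suc n)) + (1 - eps\<^sup>2) * ?s (n + 2))"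
    by (intro sum_mono step) simp
  also have "\<dots> = ?c * (2 * (\<Sum>n<N. energy \<phi> n) + 2 * (\<Sum>n<N. energy \<phi> (Suc n))) + (1 - eps\<^sup>2) * (\<Sum>n<N. ?s (n + 2))"
    by (simp only: sum.distrib sum_distrib_left distrib_left)
  also have "\<dots> \<le> ?c * (2 * E + 2 * E) + (1 - eps\<^sup>2) * (\<Sum>n<N. ?s n)"
  proof (intro add_mono mult_left_mono shift E)
    have "(\<Sum>n<N. energy \<phi> (Suc n)) \<le> (\<Sum>n<Suc N. energy \<phi> n)"
      unfolding sum.lessThan_Suc_shift using energy_nonneg[of \<phi> 0] by simp
    then show "(\<Sum>n<N. energy \<phi> (Suc n)) \<le> E" using E[of "Suc N"] by simp
  qed (use c eps2 in auto)
  finally have "eps\<^sup>2 * (\<Sum>n<N. ?s n) \<le> ?c * (4 * E)" by (simp add: algebra_simps)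
  then show ?thesis using eps2 by (simp add: pos_le_divide_eq mult.commute)
qed

text \<open>The sums \<open>S\<^sub>n + E(S\<^sub>N - S\<^sub>n | X\<^sub>n)\<close>, \<open>n \<le> N\<close>, form a martingale; their second moments are compared
  step by step.\<close>

lemma second_moment_step:
  assumes "n < N"
  shows "(LINT w|M. ((\<Sum>k<Suc n. \<phi> k (X k w) (X (Suc k) w)) + tail_mean \<phi> (N - Suc n) (Suc n) (X (Suc n) w))\<^sup>2)
    \<le> (LINT w|M. ((\<Sum>k<n. \<phi> k (X k w) (X (Suc k) w)) + tail_mean \<phi> (N - n) n (X n w))\<^sup>2)
      + (2 * energy \<phi> n + 2 * tail_variance (N - Suc n) (Suc n))"
proof -
  define s where "s w = (\<Sum>k<n. \<phi> k (X k w) (X (Suc k) w))" for w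
  define j where "j = N - Suc n"
  have Nn: "N - n = Suc j" using assms by (simp add: j_def)
  let ?g = "tail_mean \<phi> j (Suc n)"
  let ?q = "\<lambda>w. LINT y|K n (X n w). (\<phi> n (X n w) y + ?g y)\<^sup>2" and ?r = "\<lambda>w. LINT y|K n (X n w). (s w + (\<phi> n (X n w) y + ?g y))\<^sup>2"
  note [measurable] = X_adapted[OF order_refl, of n]
  have s: "bdd_meas (F n) s"
    unfolding s_def using X_adapted[of _ n] by (intro phi_intros) auto
  have sM: "bdd_meas M s" by (rule bdd_meas_compose[OF s]) measurable
  have adapted: "bdd_meas (F n \<Otimes>\<^sub>M \<mu> (Suc n)) (\<lambda>(w, y). (s w + (\<phi> n (X n w) y + ?g y))\<^sup>2)"
    unfolding case_prod_beta' by (intro phi_intros bdd_meas_compose[OF s]; measurable)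
  have section_bm: "bdd_meas (\<mu> (Suc n)) (\<lambda>y. \<phi> n x y + ?g y)" if "x \<in> space (\<mu> n)" for x
    using that by (intro phi_intros; measurable)
  have "(LINT w|M. ((\<Sum>k<Suc n. \<phi> k (X k w) (X (Suc k) w)) + ?g (X (Suc n) w))\<^sup>2) =
    (LINT w|M. (s w + (\<phi> n (X n w) (X (Suc n) w) + ?g (X (Suc n) w)))\<^sup>2)"
    by (simp add: s_def add.assoc)
  also have "\<dots> = (LINT w|M. LINT y|K n (X n w). (s w + (\<phi> n (X n w) y + ?g y))\<^sup>2)"
    by (rule integral_markov_bm[OF adapted])
  also have "\<dots> \<le> (LINT w|M. (s w + tail_mean \<phi> (Suc j) n (X n w))\<^sup>2
      + ?q w)"
  proof (rule integral_mono)
    show "integrable M (\<lambda>w. \<integral>y. (s w + (\<phi> n (X n w) y + ?g y))\<^sup>2 \<partial>K n (X n w))"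
      by (intro integrable_bdd_meas phi_intros bdd_meas_compose[OF sM]; measurable)
    show "integrable M (\<lambda>w. (s w + tail_mean \<phi> (Suc j) n (X n w))\<^sup>2
      + ?q w)"
      by (intro integrable_bdd_meas phi_intros sM; measurable)
    \<comment> \<open>With \<open>m\<close> for the tail mean at \<open>X n w\<close>, the left side
      is exactly \<open>s\<^sup>2 + 2 * s * m\<close> plus \<open>?q w\<close>; completing the
      square only adds \<open>m\<^sup>2\<close>.\<close>
    show "?r w \<le>
      (s w + tail_mean \<phi> (Suc j) n (X n w))\<^sup>2 + ?q w"
      if "w \<in> space M" for w
      unfolding integral_K_square_add(1)[OF X_space[OF that] section_bm[OF X_space[OF that]]]
      by (simp add: power2_sum)
  qed
  also have "\<dots> = (LINT w|M. (s w + tail_mean \<phi> (Suc j) n (X n w))\<^sup>2)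
      + (LINT w|M. LINT y|K n (X n w). (\<phi> n (X n w) y + ?g y)\<^sup>2)"
    by (intro Bochner_Integration.integral_add integrable_bdd_meas phi_intros sM; measurable)
  also have "(LINT w|M. LINT y|K n (X n w). (\<phi> n (X n w) y + ?g y)\<^sup>2)
      = (LINT x|\<mu> n. LINT y|K n x. (\<phi> n x y + ?g y)\<^sup>2)"
    by (rule integral_law[of "\<lambda>x. \<integral>y. (\<phi> n x y + ?g y)\<^sup>2 \<partial>K n x"])
      (intro bdd_meas_measurable phi_intros; measurable)
  also have "\<dots> \<le> 2 * energy \<phi> n + 2 * tail_variance j (Suc n)"
    unfolding tail_variance_def by (rule integral_square_add_le[OF tail_mean_bm])
  finally show ?thesis by (simp add: Nn s_def j_def)
qed

text \<open>Iterating \<open>second_moment_step\<close> from 0 to \<open>N\<close> accumulates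
  energies and tail variances only, and both totals are bounded independently of
  \<open>N\<close>.\<close>

lemma second_moment_bound:
  assumes E: "\<And>N. (\<Sum>n<N. energy \<phi> n) \<le> E"
  shows "\<exists>C. \<forall>N. (LINT w|M. (\<Sum>k<N. \<phi> k (X k w) (X (Suc k) w))\<^sup>2) \<le> C"
proof (intro exI allI)
  fix N
  let ?m = "\<lambda>n. \<integral>w. ((\<Sum>k<n. \<phi> k (X k w) (X (Suc k) w)) + tail_mean \<phi> (N - n) n (X n w))\<^sup>2 \<partial>M"
  let ?s = "\<lambda>n. tail_variance (N - n) n" and ?T = "(1 + 1 / eps) * (4 * E) / eps\<^sup>2"
  have "?m n \<le> ?s 0 + (\<Sum>k<n. 2 * energy \<phi> k + 2 * ?s (Suc k))" if "n \<le> N" for n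
    using that
  proof (induction n)
    case 0
    have "?m 0 = ?s 0"
      unfolding tail_variance_def using bdd_meas_measurable[OF tail_mean_bm]
      by (simp add: integral_law[of "\<lambda>x. (tail_mean \<phi> N 0 x)\<^sup>2"])
    then show ?case by simp
  next
    case (Suc n)
    then show ?case using second_moment_step[of n N] by simp
  qed
  \<comment> \<open>At \<open>n = N\<close> the tail is empty, so \<open>?m N\<close> is the second
    moment of the sum itself.\<close>
  from this[of N] have "?m N \<le> ?s 0 + (2 * (\<Sum>k<N. energy \<phi> k) + 2 * (\<Sum>k<N. ?s (Suc k)))"
    by (simp add: sum.distrib sum_distrib_left)
  moreover have sum: "(\<Sum>k<Suc N. ?s k) \<le> ?T"
    using sum_tail_variance[OF E, of N] by (simp add: tail_variance_def)
  moreover have "(\<Sum>k<Suc N. ?s k) = ?s 0 + (\<Sum>k<N. ?s (Suc k))"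
    by (rule sum.lessThan_Suc_shift)
  moreover have "0 \<le> ?s 0" by (rule tail_variance_nonneg)
  moreover have "(\<Sum>k<N. energy \<phi> k) \<le> E" by (rule E)
  moreover have "0 \<le> (\<Sum>k<N. ?s (Suc k))" by (intro sum_nonneg tail_variance_nonneg)
  ultimately have "?m N \<le> 2 * E + 2 * ?T" by linarith
  then show "(LINT w|M. (\<Sum>k<N. \<phi> k (X k w) (X (Suc k) w))\<^sup>2) \<le> 2 * E + 2 * ?T"
    by simp
qed

end

section \<open>Random hexagons\<close>

text \<open>The transition density from time \<open>k\<close> to time \<open>k + 2\<close>, and at
  the same time the normaliser of the bridge.\<close>

definition two_step_density :: "nat \<Rightarrow> 'a \<Rightarrow> 'a \<Rightarrow> real" where
  "two_step_density k x z = (LINT u|\<mu> (Suc k). p k x u * p (Suc k) u z)"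

lemma two_step_density_measurable [measurable (raw)]:
  assumes [measurable]: "g \<in> N \<rightarrow>\<^sub>M \<mu> k" "h \<in> N \<rightarrow>\<^sub>M \<mu> (Suc (Suc k))"
  shows "(\<lambda>x. two_step_density k (g x) (h x)) \<in> borel_measurable N"
  unfolding two_step_density_def by measurable

lemma two_step_density_gt: "x \<in> space (\<mu> k) \<Longrightarrow> z \<in> space (\<mu> (Suc (Suc k))) \<Longrightarrow> eps < two_step_density k x z"
  unfolding two_step_density_def by (rule two_step)

lemma two_step_product_le:
  assumes "x \<in> space (\<mu> k)" "y \<in> space (\<mu> (Suc k))" "z \<in> space (\<mu> (Suc (Suc k)))"
  shows "0 \<le> p k x y * p (Suc k) y z" "p k x y * p (Suc k) y z \<le> 1 / eps * (1 / eps)"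
  using assms eps by (intro mult_nonneg_nonneg mult_mono p_nonneg p_le; simp)+

abbreviation br :: "nat \<Rightarrow> 'a \<Rightarrow> 'a \<Rightarrow> 'a measure" where
  "br \<equiv> bridge \<mu> p"

lemma br_eq: "br k x z = density (\<mu> (Suc k)) (\<lambda>y. ennreal (p k x y * p (Suc k) y z / two_step_density k x z))"
  by (simp add: bridge_def two_step_density_def)

lemma sets_br [simp, measurable_cong]: "sets (br k x z) = sets (\<mu> (Suc k))"
  by (simp add: br_eq)

lemma space_br [simp]: "space (br k x z) = space (\<mu> (Suc k))"
  by (simp add: br_eq)

lemma br_measurable0:
  "(\<lambda>v. br k (fst v) (snd v)) \<in> \<mu> k \<Otimes>\<^sub>M \<mu> (Suc (Suc k)) \<rightarrow>\<^sub>M prob_algebra (\<mu> (Suc k))"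
  unfolding br_eq
proof (rule measurable_density_kernel[OF mu.sigma_finite_measure_axioms])
  show "(\<lambda>(v, y). ennreal (p k (fst v) y * p (Suc k) y (snd v) / two_step_density k (fst v) (snd v)))
    \<in> borel_measurable ((\<mu> k \<Otimes>\<^sub>M \<mu> (Suc (Suc k))) \<Otimes>\<^sub>M \<mu> (Suc k))"
    unfolding case_prod_beta' by measurable
next
  fix v assume v: "v \<in> space (\<mu> k \<Otimes>\<^sub>M \<mu> (Suc (Suc k)))"
  define x z where "x = fst v" and "z = snd v"
  have [measurable]: "x \<in> space (\<mu> k)" "z \<in> space (\<mu> (Suc (Suc k)))"
    using v by (auto simp: x_def z_def space_pair_measure)
  note * = two_step_product_le[OF \<open>x \<in> space (\<mu> k)\<close> _ \<open>z \<in> space (\<mu> (Suc (Suc k)))\<close>]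
  have q: "0 < two_step_density k x z"
    using two_step_density_gt[of x k z] eps \<open>x \<in> space (\<mu> k)\<close> \<open>z \<in> space (\<mu> (Suc (Suc k)))\<close> by linarith
  have "integrable (\<mu> (Suc k)) (\<lambda>y. p k x y * p (Suc k) y z)"
    using * by (intro mu.integrable_bounded[where B = "1 / eps * (1 / eps)"]) auto
  then have "(\<integral>\<^sup>+y. ennreal (p k x y * p (Suc k) y z / two_step_density k x z) \<partial>\<mu> (Suc k))
    = ennreal (LINT y|\<mu> (Suc k). p k x y * p (Suc k) y z / two_step_density k x z)"
    using * q by (intro nn_integral_eq_integral) auto
  also have "(LINT y|\<mu> (Suc k). p k x y * p (Suc k) y z / two_step_density k x z) = 1"
    using q by (simp add: two_step_density_def)
  finally show "(\<integral>\<^sup>+y. ennreal (p k (fst v) y * p (Suc k) y (snd v) / two_step_density k (fst v) (snd v)) \<partial>\<mu> (Suc k)) = 1"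
    by (simp add: x_def z_def)
qed

lemma br_measurable [measurable (raw)]:
  assumes [measurable]: "g \<in> N \<rightarrow>\<^sub>M \<mu> k" "h \<in> N \<rightarrow>\<^sub>M \<mu> (Suc (Suc k))"
  shows "(\<lambda>x. br k (g x) (h x)) \<in> N \<rightarrow>\<^sub>M prob_algebra (\<mu> (Suc k))"
  using measurable_compose[OF _ br_measurable0, of "\<lambda>x. (g x, h x)" N k] by simp

lemma prob_space_br: "x \<in> space (\<mu> k) \<Longrightarrow> z \<in> space (\<mu> (Suc (Suc k))) \<Longrightarrow> prob_space (br k x z)"
  using measurable_space[OF br_measurable0, of "(x, z)"] by (simp add: space_prob_algebra space_pair_measure)

definition J :: "nat \<Rightarrow> ('a \<times> 'a) measure" where
  "J k = distr M (\<mu> k \<Otimes>\<^sub>M \<mu> (Suc k)) (\<lambda>w. (X k w, X (Suc k) w))"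

lemma sets_J [simp, measurable_cong]: "sets (J k) = sets (\<mu> k \<Otimes>\<^sub>M \<mu> (Suc k))"
  by (simp add: J_def)

lemma space_J [simp]: "space (J k) = space (\<mu> k) \<times> space (\<mu> (Suc k))"
  by (simp add: J_def space_pair_measure)

sublocale J: prob_space "J k" for k
  unfolding J_def by (rule prob_space_distr) measurable

lemma J_in_prob_algebra [measurable]: "J k \<in> space (prob_algebra (\<mu> k \<Otimes>\<^sub>M \<mu> (Suc k)))"
  by (simp add: space_prob_algebra J.prob_space_axioms)

lemma nn_integral_J:
  assumes [measurable]: "g \<in> borel_measurable (\<mu> k \<Otimes>\<^sub>M \<mu> (Suc k))"
  shows "(\<integral>\<^sup>+v. g v \<partial>J k) = (\<integral>\<^sup>+x. \<integral>\<^sup>+y. ennreal (p k x y) * g (x, y) \<partial>\<mu> (Suc k) \<partial>\<mu> k)"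
proof -
  let ?M = "restr_to_subalg M (F k)"
  have [measurable_cong]: "sets ?M = sets (F k)" by (rule sets_restr_to_subalg[OF subalg])
  note X_adapted[OF order_refl, measurable]
  have "(\<integral>\<^sup>+v. g v \<partial>J k) = (\<integral>\<^sup>+z. g (X k (fst z), snd z) \<partial>distr M (F k \<Otimes>\<^sub>M \<mu> (Suc k)) (\<lambda>w. (w, X (Suc k) w)))"
    unfolding J_def by (simp add: nn_integral_distr)
  also have "\<dots> = (\<integral>\<^sup>+z. ennreal (p k (X k (fst z)) (snd z)) * g (X k (fst z), snd z) \<partial>(?M \<Otimes>\<^sub>M \<mu> (Suc k)))"
    unfolding markov_law case_prod_beta' by (rule nn_integral_density) measurable
  also have "\<dots> = (\<integral>\<^sup>+w. \<integral>\<^sup>+y. ennreal (p k (X k w) y) * g (X k w, y) \<partial>\<mu> (Suc k) \<partial>?M)"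
    by (subst mu.nn_integral_fst[symmetric]) auto
  also have "\<dots> = (\<integral>\<^sup>+w. \<integral>\<^sup>+y. ennreal (p k (X k w) y) * g (X k w, y) \<partial>\<mu> (Suc k) \<partial>M)"
    by (rule nn_integral_subalgebra2[OF subalg]) measurable
  also have "\<dots> = (\<integral>\<^sup>+x. \<integral>\<^sup>+y. ennreal (p k x y) * g (x, y) \<partial>\<mu> (Suc k) \<partial>distr M (\<mu> k) (X k))"
    by (subst nn_integral_distr) auto
  finally show ?thesis by (simp add: law)
qed

abbreviation hexspace :: "nat \<Rightarrow> 'a hexagon measure" where
  "hexspace k \<equiv> \<mu> k \<Otimes>\<^sub>M (\<mu> (Suc k) \<Otimes>\<^sub>M \<mu> (Suc k)) \<Otimes>\<^sub>M (\<mu> (Suc (Suc k)) \<Otimes>\<^sub>M \<mu> (Suc (Suc k))) \<Otimes>\<^sub>M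
     \<mu> (Suc (Suc (Suc k)))"

definition hex :: "nat \<Rightarrow> 'a hexagon measure" where
  "hex k = do {
     (a, b) \<leftarrow> J k;
     (c', d') \<leftarrow> J (Suc (Suc k));
     c \<leftarrow> br (Suc k) b d';
     b' \<leftarrow> br k a c';
     return (hexspace k) (a, (b, b'), (c, c'), d')
   }"

lemma hex_in_prob_algebra: "hex k \<in> space (prob_algebra (hexspace k))" (is ?prob)
  and nn_integral_hex: "G \<in> borel_measurable (hexspace k) \<Longrightarrow> (\<integral>\<^sup>+P. G P \<partial>hex k) =
    (\<integral>\<^sup>+v. \<integral>\<^sup>+w. \<integral>\<^sup>+c. \<integral>\<^sup>+b'. G (fst v, (snd v, b'), (c, fst w), snd w)
      \<partial>br k (fst v) (fst w) \<partial>br (Suc k) (snd v) (snd w) \<partial>J (Suc (Suc k)) \<partial>J k)"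
      (is "_ \<Longrightarrow> ?int")
proof -
  \<comment> \<open>Each bind needs its continuation to be measurable jointly in everything sampled
    before. Naming the successive continuations allows this to be proved from the innermost one
    outwards.\<close>
  define R where "R v w c b' = return (hexspace k) (fst v, (snd v, b'), (c, fst w), snd w)"
    for v w :: "'a \<times> 'a" and c b' :: 'a
  define R1 where "R1 v w c = br k (fst v) (fst w) \<bind> R v w c" for v w :: "'a \<times> 'a" and c :: 'a
  define R2 where "R2 v w = br (Suc k) (snd v) (snd w) \<bind> R1 v w" for v w :: "'a \<times> 'a"
  let ?V = "\<mu> k \<Otimes>\<^sub>M \<mu> (Suc k)" and ?W = "\<mu> (Suc (Suc k)) \<Otimes>\<^sub>M \<mu> (Suc (Suc (Suc k)))"
  have hex: "hex k = J k \<bind> (\<lambda>v. J (Suc (Suc k)) \<bind> R2 v)"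
    by (simp add: hex_def R_def[abs_def] R1_def[abs_def] R2_def[abs_def] case_prod_beta')
  have R: "(\<lambda>z. R (fst (fst (fst z))) (snd (fst (fst z))) (snd (fst z)) (snd z)) \<in>
      ((?V \<Otimes>\<^sub>M ?W) \<Otimes>\<^sub>M \<mu> (Suc (Suc k))) \<Otimes>\<^sub>M \<mu> (Suc k) \<rightarrow>\<^sub>M prob_algebra (hexspace k)"
    unfolding R_def by measurable
  have [measurable (raw)]: "(\<lambda>x. R (v x) (w x) (c x) (b' x)) \<in> N \<rightarrow>\<^sub>M prob_algebra (hexspace k)"
    if [measurable]: "v \<in> N \<rightarrow>\<^sub>M ?V" "w \<in> N \<rightarrow>\<^sub>M ?W" "c \<in> N \<rightarrow>\<^sub>M \<mu> (Suc (Suc k))" "b' \<in> N \<rightarrow>\<^sub>M \<mu> (Suc k)"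
    for v w c b' and N :: "'z measure"
    using measurable_compose[OF _ R, of "\<lambda>x. (((v x, w x), c x), b' x)" N] by simp
  have R1: "(\<lambda>z. R1 (fst (fst z)) (snd (fst z)) (snd z)) \<in>
      (?V \<Otimes>\<^sub>M ?W) \<Otimes>\<^sub>M \<mu> (Suc (Suc k)) \<rightarrow>\<^sub>M prob_algebra (hexspace k)"
    unfolding R1_def by measurable
  have R2: "(\<lambda>z. R2 (fst z) (snd z)) \<in> ?V \<Otimes>\<^sub>M ?W \<rightarrow>\<^sub>M prob_algebra (hexspace k)"
    unfolding R2_def
    by (rule measurable_bind_prob_space2[where N = "\<mu> (Suc (Suc k))"])
      (use R1 in \<open>simp_all add: case_prod_beta'\<close>)
  have R3: "(\<lambda>v. J (Suc (Suc k)) \<bind> R2 v) \<in> ?V \<rightarrow>\<^sub>M prob_algebra (hexspace k)"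
    by (rule measurable_bind_prob_space2[where N = ?W]) (use R2 in \<open>simp_all add: case_prod_beta'\<close>)
  show ?prob
    using prob_space_bind'[OF J_in_prob_algebra R3] sets_bind'[OF J_in_prob_algebra R3]
    by (simp add: hex space_prob_algebra)
  assume [measurable]: "G \<in> borel_measurable (hexspace k)"
  note assms = this
  have "(\<integral>\<^sup>+P. G P \<partial>hex k) = (\<integral>\<^sup>+v. \<integral>\<^sup>+P. G P \<partial>(J (Suc (Suc k)) \<bind> R2 v) \<partial>J k)"
    unfolding hex using measurable_prob_algebraD[OF R3]
    by (intro nn_integral_bind[OF assms]) simp
  also have "\<dots> = (\<integral>\<^sup>+v. \<integral>\<^sup>+w. \<integral>\<^sup>+P. G P \<partial>R2 v w \<partial>J (Suc (Suc k)) \<partial>J k)"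
  proof (intro nn_integral_cong nn_integral_bind[OF assms])
    fix v assume "v \<in> space (J k)"
    then show "R2 v \<in> J (Suc (Suc k)) \<rightarrow>\<^sub>M subprob_algebra (hexspace k)"
      using measurable_compose[OF measurable_Pair1' R2, of v]
      by (intro measurable_prob_algebraD) (simp add: space_pair_measure)
  qed
  also have "\<dots> = (\<integral>\<^sup>+v. \<integral>\<^sup>+w. \<integral>\<^sup>+c. \<integral>\<^sup>+P. G P \<partial>R1 v w c \<partial>br (Suc k) (snd v) (snd w) \<partial>J (Suc (Suc k)) \<partial>J k)"
    unfolding R2_def
  proof (intro nn_integral_cong nn_integral_bind[OF assms])
    fix v w assume "v \<in> space (J k)" "w \<in> space (J (Suc (Suc k)))"
    then show "R1 v w \<in> br (Suc k) (snd v) (snd w) \<rightarrow>\<^sub>M subprob_algebra (hexspace k)"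
      using measurable_compose[OF measurable_Pair1' R1, of "(v, w)"]
      by (intro measurable_prob_algebraD) (simp add: space_pair_measure)
  qed
  also have "\<dots> = (\<integral>\<^sup>+v. \<integral>\<^sup>+w. \<integral>\<^sup>+c. \<integral>\<^sup>+b'. \<integral>\<^sup>+P. G P \<partial>R v w c b'
      \<partial>br k (fst v) (fst w) \<partial>br (Suc k) (snd v) (snd w) \<partial>J (Suc (Suc k)) \<partial>J k)"
    unfolding R1_def
  proof (intro nn_integral_cong nn_integral_bind[OF assms])
    fix v w c assume "v \<in> space (J k)" "w \<in> space (J (Suc (Suc k)))" "c \<in> space (br (Suc k) (snd v) (snd w))"
    then show "R v w c \<in> br k (fst v) (fst w) \<rightarrow>\<^sub>M subprob_algebra (hexspace k)"
      using measurable_compose[OF measurable_Pair1' R, of "((v, w), c)"]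
      by (intro measurable_prob_algebraD) (simp add: space_pair_measure)
  qed
  also have "\<dots> = (\<integral>\<^sup>+v. \<integral>\<^sup>+w. \<integral>\<^sup>+c. \<integral>\<^sup>+b'. G (fst v, (snd v, b'), (c, fst w), snd w)
      \<partial>br k (fst v) (fst w) \<partial>br (Suc k) (snd v) (snd w) \<partial>J (Suc (Suc k)) \<partial>J k)"
    unfolding R_def
    by (intro nn_integral_cong nn_integral_return assms) (auto simp: space_pair_measure)
  finally show ?int .
qed

sublocale hex: prob_space "hex k" for k
  using hex_in_prob_algebra by (simp add: space_prob_algebra)

lemma sets_hex [simp, measurable_cong]: "sets (hex k) = sets (hexspace k)"
  using hex_in_prob_algebra by (simp add: space_prob_algebra)

lemma space_hex: "space (hex k) = space (hexspace k)"
  by (rule sets_eq_imp_space_eq[OF sets_hex])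

lemma nn_integral_swap:
  "(\<lambda>v. g (fst v) (snd v)) \<in> borel_measurable (\<mu> i \<Otimes>\<^sub>M \<mu> j) \<Longrightarrow>
    (\<integral>\<^sup>+x. \<integral>\<^sup>+y. g x y \<partial>\<mu> j \<partial>\<mu> i) = (\<integral>\<^sup>+y. \<integral>\<^sup>+x. g x y \<partial>\<mu> i \<partial>\<mu> j)"
  using mu_pair.Fubini'[of g i j] by (simp add: case_prod_beta')

lemma nn_integral_fst_snd:
  "(\<lambda>v. g (fst v) (snd v)) \<in> borel_measurable (\<mu> i \<Otimes>\<^sub>M \<mu> j) \<Longrightarrow>
    (\<integral>\<^sup>+x. \<integral>\<^sup>+y. g x y \<partial>\<mu> j \<partial>\<mu> i) = (\<integral>\<^sup>+v. g (fst v) (snd v) \<partial>(\<mu> i \<Otimes>\<^sub>M \<mu> j))"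
  using mu.nn_integral_fst[of "\<lambda>v. g (fst v) (snd v)" "\<mu> i" j] by simp

text \<open>Up to the factors \<open>1 / two_step_density \<le> 1 / eps\<close> a random hexagon consists of two independent
  paths with common end points.\<close>

definition path_density :: "nat \<Rightarrow> 'a \<Rightarrow> 'a \<Rightarrow> 'a \<times> 'a \<Rightarrow> real" where
  "path_density k a d u = p k a (fst u) * p (Suc k) (fst u) (snd u) * p (Suc (Suc k)) (snd u) d"

abbreviation middle :: "nat \<Rightarrow> ('a \<times> 'a) measure" where
  "middle k \<equiv> \<mu> (Suc k) \<Otimes>\<^sub>M \<mu> (Suc (Suc k))"

lemma path_density_measurable [measurable (raw)]:
  assumes [measurable]: "g \<in> N \<rightarrow>\<^sub>M \<mu> k" "h \<in> N \<rightarrow>\<^sub>M \<mu> (Suc (Suc (Suc k)))" "u \<in> N \<rightarrow>\<^sub>M middle k"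
  shows "(\<lambda>x. path_density k (g x) (h x) (u x)) \<in> borel_measurable N"
  unfolding path_density_def by measurable

text \<open>Dropping the normaliser, which exceeds \<open>eps\<close>, costs the factor
  \<open>1 / eps\<close> and leaves a weight that is a product over edges.\<close>

lemma nn_integral_br_le:
  assumes x: "x \<in> space (\<mu> k)" and z: "z \<in> space (\<mu> (Suc (Suc k)))"
    and [measurable]: "g \<in> borel_measurable (\<mu> (Suc k))"
  shows "(\<integral>\<^sup>+y. g y \<partial>br k x z) \<le> (\<integral>\<^sup>+y. ennreal (1 / eps * (p k x y * p (Suc k) y z)) * g y \<partial>\<mu> (Suc k))"
proof -
  note [measurable] = x z
  have "(\<integral>\<^sup>+y. g y \<partial>br k x z) =
    (\<integral>\<^sup>+y. ennreal (p k x y * p (Suc k) y z / two_step_density k x z) * g y \<partial>\<mu> (Suc k))"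
    unfolding br_eq by (rule nn_integral_density) measurable
  also have "\<dots> \<le> (\<integral>\<^sup>+y. ennreal (1 / eps * (p k x y * p (Suc k) y z)) * g y \<partial>\<mu> (Suc k))"
  proof (intro nn_integral_mono mult_right_mono ennreal_leI)
    fix y assume "y \<in> space (\<mu> (Suc k))"
    then have "0 \<le> p k x y * p (Suc k) y z" using two_step_product_le(1) x z by blast
    moreover have "eps < two_step_density k x z" by (rule two_step_density_gt[OF x z])
    ultimately have "p k x y * p (Suc k) y z / two_step_density k x z \<le> p k x y * p (Suc k) y z / eps"
      using eps by (intro divide_left_mono mult_pos_pos) auto
    then show "p k x y * p (Suc k) y z / two_step_density k x z \<le> 1 / eps * (p k x y * p (Suc k) y z)"
      by simp
  qed simp
  finally show ?thesis .
qed

text \<open>The two sampled edges contribute \<open>p k a b\<close> and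
  \<open>p (Suc (Suc k)) c' d\<close>, and the two bridges, after \<open>nn_integral_br_le\<close>,
  contribute the other four edge densities. Regrouped, the six factors are the densities of the
  upper and the lower path from \<open>a\<close> to \<open>d\<close>; the two lost normalisers give
  \<open>1 / eps\<^sup>2\<close>.\<close>

lemma nn_integral_hex_le:
  assumes [measurable]: "G \<in> borel_measurable (hexspace k)"
  shows "(\<integral>\<^sup>+P. G P \<partial>hex k) \<le>
    (\<integral>\<^sup>+a. \<integral>\<^sup>+d. \<integral>\<^sup>+u. \<integral>\<^sup>+u'. ennreal (1 / eps\<^sup>2 * (path_density k a d u * path_density k a d u')) *
        G (a, (fst u, fst u'), (snd u, snd u'), d)
      \<partial>middle k \<partial>middle k \<partial>\<mu> (Suc (Suc (Suc k))) \<partial>\<mu> k)"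
proof -
  let ?A = "\<mu> k" and ?B = "\<mu> (Suc k)" and ?C = "\<mu> (Suc (Suc k))" and ?D = "\<mu> (Suc (Suc (Suc k)))"
  let ?U = "\<lambda>v w c. ennreal (1 / eps * (p (Suc k) (snd v) c * p (Suc (Suc k)) c (snd w)))"
  let ?V = "\<lambda>v w c. \<integral>\<^sup>+b'. ennreal (1 / eps * (p k (fst v) b' * p (Suc k) b' (fst w))) * G (fst v, (snd v, b'), (c, fst w), snd w) \<partial>?B"
  let ?W = "\<lambda>v w. \<integral>\<^sup>+c. \<integral>\<^sup>+b'. G (fst v, (snd v, b'), (c, fst w), snd w) \<partial>br k (fst v) (fst w) \<partial>br (Suc k) (snd v) (snd w)"
  define H where "H a b b' c c' d = ennreal (1 / eps\<^sup>2 * (path_density k a d (b, c) * path_density k a d (b', c'))) *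
        G (a, (b, b'), (c, c'), d)" for a b b' c c' d
  have H [measurable (raw)]: "(\<lambda>x. H (a x) (b x) (b' x) (c x) (c' x) (d x)) \<in> borel_measurable N"
    if [measurable]: "a \<in> N \<rightarrow>\<^sub>M ?A" "b \<in> N \<rightarrow>\<^sub>M ?B" "b' \<in> N \<rightarrow>\<^sub>M ?B" "c \<in> N \<rightarrow>\<^sub>M ?C" "c' \<in> N \<rightarrow>\<^sub>M ?C" "d \<in> N \<rightarrow>\<^sub>M ?D"
    for a b b' c c' d and N :: "'z measure"
    unfolding H_def by measurable
  have "(\<integral>\<^sup>+P. G P \<partial>hex k) \<le> (\<integral>\<^sup>+v. \<integral>\<^sup>+w. \<integral>\<^sup>+c. ?U v w c *
        ?V v w c
      \<partial>?C \<partial>J (Suc (Suc k)) \<partial>J k)"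
    unfolding nn_integral_hex[OF assms]
  proof (rule nn_integral_mono, rule nn_integral_mono)
    fix v w assume "v \<in> space (J k)" "w \<in> space (J (Suc (Suc k)))"
    then have v [measurable]: "fst v \<in> space ?A" "snd v \<in> space ?B" and w [measurable]: "fst w \<in> space ?C" "snd w \<in> space ?D"
      by auto
    have "?W v w
      \<le> (\<integral>\<^sup>+c. ?U v w c *
        (\<integral>\<^sup>+b'. G (fst v, (snd v, b'), (c, fst w), snd w) \<partial>br k (fst v) (fst w)) \<partial>?C)"
      by (intro nn_integral_br_le v w nn_integral_measurable_subprob_algebra2[where N = ?B] measurable_prob_algebraD) measurable
    also have "\<dots> \<le> (\<integral>\<^sup>+c. ?U v w c *
        ?V v w c
      \<partial>?C)"
      by (intro nn_integral_mono mult_left_mono nn_integral_br_le v w) auto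
    finally show "?W v w
      \<le> \<dots>" .
  qed
  also have "\<dots> = (\<integral>\<^sup>+a. \<integral>\<^sup>+b. ennreal (p k a b) * (\<integral>\<^sup>+c'. \<integral>\<^sup>+d. ennreal (p (Suc (Suc k)) c' d) *
      (\<integral>\<^sup>+c. ennreal (1 / eps * (p (Suc k) b c * p (Suc (Suc k)) c d)) *
        (\<integral>\<^sup>+b'. ennreal (1 / eps * (p k a b' * p (Suc k) b' c')) * G (a, (b, b'), (c, c'), d) \<partial>?B)
      \<partial>?C) \<partial>?D \<partial>?C) \<partial>?B \<partial>?A)"
    by (simp add: nn_integral_J cong: nn_integral_cong)
  \<comment> \<open>All weights are moved to the innermost integral, one level at a time, so that
    the order of integration can be changed freely afterwards.\<close>
  also have "\<dots> = (\<integral>\<^sup>+a. \<integral>\<^sup>+b. \<integral>\<^sup>+c'. \<integral>\<^sup>+d. \<integral>\<^sup>+c. \<integral>\<^sup>+b'. H a b b' c c' d \<partial>?B \<partial>?C \<partial>?D \<partial>?C \<partial>?B \<partial>?A)"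
  proof (intro nn_integral_cong)
    fix a b assume ab [measurable]: "a \<in> space ?A" "b \<in> space ?B"
    let ?X = "\<lambda>c d. ennreal (1 / eps * (p (Suc k) b c * p (Suc (Suc k)) c d))"
    let ?Y = "\<lambda>b' c'. ennreal (1 / eps * (p k a b' * p (Suc k) b' c'))"
    let ?Z1 = "\<lambda>c c' d. \<integral>\<^sup>+b'. ?Y b' c' * G (a, (b, b'), (c, c'), d) \<partial>?B"
    let ?Z2 = "\<lambda>c' d. \<integral>\<^sup>+c. ?X c d * ?Z1 c c' d \<partial>?C"
    have H_eq: "H a b b' c c' d = ennreal (p k a b) * (ennreal (p (Suc (Suc k)) c' d) *
        (?X c d * (?Y b' c' * G (a, (b, b'), (c, c'), d))))"
      if "b' \<in> space ?B" "c \<in> space ?C" "c' \<in> space ?C" "d \<in> space ?D" for b' c c' d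
    proof -
      have nn: "0 \<le> p k a b" "0 \<le> p (Suc (Suc k)) c' d" "0 \<le> 1 / eps * (p (Suc k) b c * p (Suc (Suc k)) c d)"
        using that ab eps by (auto intro!: p_nonneg mult_nonneg_nonneg divide_nonneg_nonneg)
      have "1 / eps\<^sup>2 * (path_density k a d (b, c) * path_density k a d (b', c')) =
        p k a b * (p (Suc (Suc k)) c' d * ((1 / eps * (p (Suc k) b c * p (Suc (Suc k)) c d)) *
          (1 / eps * (p k a b' * p (Suc k) b' c'))))" (is "_ = ?r")
        by (simp add: path_density_def power2_eq_square)
      then have "H a b b' c c' d = ennreal ?r * G (a, (b, b'), (c, c'), d)" by (simp only: H_def)
      also have "ennreal (s * (t * (x * y))) * g = ennreal s * (ennreal t * (ennreal x * (ennreal y * g)))"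
        if "0 \<le> s" "0 \<le> t" "0 \<le> x" for s t x y g
        using that by (simp add: ennreal_mult' mult.assoc)
      note this[OF nn]
      finally show ?thesis .
    qed
    have 1: "(\<integral>\<^sup>+b'. H a b b' c c' d \<partial>?B) = ennreal (p k a b) * (ennreal (p (Suc (Suc k)) c' d) *
        (?X c d * ?Z1 c c' d))"
      if [measurable]: "c \<in> space ?C" "c' \<in> space ?C" "d \<in> space ?D" for c c' d
      using that by (simp add: H_eq nn_integral_cmult cong: nn_integral_cong)
    have 2: "(\<integral>\<^sup>+c. \<integral>\<^sup>+b'. H a b b' c c' d \<partial>?B \<partial>?C) = ennreal (p k a b) * (ennreal (p (Suc (Suc k)) c' d) *
        ?Z2 c' d)"
      if [measurable]: "c' \<in> space ?C" "d \<in> space ?D" for c' d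
      using that by (simp add: 1 nn_integral_cmult cong: nn_integral_cong)
    have 3: "(\<integral>\<^sup>+d. \<integral>\<^sup>+c. \<integral>\<^sup>+b'. H a b b' c c' d \<partial>?B \<partial>?C \<partial>?D) = ennreal (p k a b) *
        (\<integral>\<^sup>+d. ennreal (p (Suc (Suc k)) c' d) *
          ?Z2 c' d \<partial>?D)"
      if [measurable]: "c' \<in> space ?C" for c'
      using that by (simp add: 2 nn_integral_cmult cong: nn_integral_cong)
    show "ennreal (p k a b) * (\<integral>\<^sup>+c'. \<integral>\<^sup>+d. ennreal (p (Suc (Suc k)) c' d) *
          ?Z2 c' d \<partial>?D \<partial>?C)
      = (\<integral>\<^sup>+c'. \<integral>\<^sup>+d. \<integral>\<^sup>+c. \<integral>\<^sup>+b'. H a b b' c c' d \<partial>?B \<partial>?C \<partial>?D \<partial>?C)"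
      by (simp add: 3 nn_integral_cmult cong: nn_integral_cong)
  qed
  \<comment> \<open>Four transpositions move \<open>d\<close> next to \<open>a\<close> and group
    \<open>b\<close> with \<open>c\<close> and \<open>b'\<close> with \<open>c'\<close>; each group
    then becomes one integral over \<open>middle k\<close>.\<close>
  also have "\<dots> = (\<integral>\<^sup>+a. \<integral>\<^sup>+b. \<integral>\<^sup>+d. \<integral>\<^sup>+c'. \<integral>\<^sup>+c. \<integral>\<^sup>+b'. H a b b' c c' d \<partial>?B \<partial>?C \<partial>?C \<partial>?D \<partial>?B \<partial>?A)"
    by (intro nn_integral_cong nn_integral_swap) measurable
  also have "\<dots> = (\<integral>\<^sup>+a. \<integral>\<^sup>+d. \<integral>\<^sup>+b. \<integral>\<^sup>+c'. \<integral>\<^sup>+c. \<integral>\<^sup>+b'. H a b b' c c' d \<partial>?B \<partial>?C \<partial>?C \<partial>?B \<partial>?D \<partial>?A)"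
    by (intro nn_integral_cong nn_integral_swap) measurable
  also have "\<dots> = (\<integral>\<^sup>+a. \<integral>\<^sup>+d. \<integral>\<^sup>+b. \<integral>\<^sup>+c. \<integral>\<^sup>+c'. \<integral>\<^sup>+b'. H a b b' c c' d \<partial>?B \<partial>?C \<partial>?C \<partial>?B \<partial>?D \<partial>?A)"
    by (intro nn_integral_cong nn_integral_swap) measurable
  also have "\<dots> = (\<integral>\<^sup>+a. \<integral>\<^sup>+d. \<integral>\<^sup>+b. \<integral>\<^sup>+c. \<integral>\<^sup>+b'. \<integral>\<^sup>+c'. H a b b' c c' d \<partial>?C \<partial>?B \<partial>?C \<partial>?B \<partial>?D \<partial>?A)"
    by (intro nn_integral_cong nn_integral_swap) measurable
  also have "\<dots> = (\<integral>\<^sup>+a. \<integral>\<^sup>+d. \<integral>\<^sup>+b. \<integral>\<^sup>+c. \<integral>\<^sup>+u'. H a b (fst u') c (snd u') d \<partial>middle k \<partial>?C \<partial>?B \<partial>?D \<partial>?A)"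
    by (intro nn_integral_cong nn_integral_fst_snd) measurable
  also have "\<dots> = (\<integral>\<^sup>+a. \<integral>\<^sup>+d. \<integral>\<^sup>+u. \<integral>\<^sup>+u'. H a (fst u) (fst u') (snd u) (snd u') d \<partial>middle k \<partial>middle k \<partial>?D \<partial>?A)"
    by (intro nn_integral_cong nn_integral_fst_snd) measurable
  finally show ?thesis by (simp add: H_def)
qed

definition hex_balance :: "(nat \<Rightarrow> 'a \<Rightarrow> 'a \<Rightarrow> real) \<Rightarrow> nat \<Rightarrow> 'a hexagon \<Rightarrow> real" where
  "hex_balance f k P = (case P of (a, (b, b'), (c, c'), d) \<Rightarrow>
     f k a b + f (Suc k) b c + f (Suc (Suc k)) c d - f k a b' - f (Suc k) b' c' - f (Suc (Suc k)) c' d)"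

lemma bdd_meas_integral_br:
  fixes g :: "'b \<Rightarrow> 'a \<Rightarrow> 'c::{banach, second_countable_topology}"
  assumes "bdd_meas (N \<Otimes>\<^sub>M \<mu> (Suc k)) (\<lambda>z. g (fst z) (snd z))"
    and [measurable]: "h \<in> N \<rightarrow>\<^sub>M \<mu> k" "h' \<in> N \<rightarrow>\<^sub>M \<mu> (Suc (Suc k))"
  shows "bdd_meas N (\<lambda>x. \<integral>y. g x y \<partial>br k (h x) (h' x))"
  by (rule bdd_meas_integral_kernel[OF assms(1)]) measurable

lemma bdd_meas_integral_mu:
  fixes g :: "'b \<Rightarrow> 'a \<Rightarrow> 'c::{banach, second_countable_topology}"
  assumes "bdd_meas (N \<Otimes>\<^sub>M \<mu> k) (\<lambda>z. g (fst z) (snd z))"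
  shows "bdd_meas N (\<lambda>x. \<integral>y. g x y \<partial>\<mu> k)"
  by (rule bdd_meas_integral_kernel[OF assms])
    (simp add: space_prob_algebra mu.prob_space_axioms)

lemma bdd_meas_J_cong: "bdd_meas (J k) g \<longleftrightarrow> bdd_meas (\<mu> k \<Otimes>\<^sub>M \<mu> (Suc k)) g"
  by (simp add: bdd_meas_def space_pair_measure cong: measurable_cong_sets)

lemma bdd_meas_br_cong: "bdd_meas (br k x z) g \<longleftrightarrow> bdd_meas (\<mu> (Suc k)) g"
  by (simp add: bdd_meas_def cong: measurable_cong_sets)

lemma integrable_br:
  "x \<in> space (\<mu> k) \<Longrightarrow> z \<in> space (\<mu> (Suc (Suc k))) \<Longrightarrow> bdd_meas (\<mu> (Suc k)) g \<Longrightarrow> integrable (br k x z) g"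
  using prob_space.integrable_bdd_meas[OF prob_space_br] by (simp add: bdd_meas_br_cong)

lemma measure_br_space:
  "x \<in> space (\<mu> k) \<Longrightarrow> z \<in> space (\<mu> (Suc (Suc k))) \<Longrightarrow> measure (br k x z) (space (\<mu> (Suc k))) = 1"
  using prob_space.prob_space[OF prob_space_br] by simp

lemma integral_br_add_const:
  fixes c :: real
  assumes "x \<in> space (\<mu> k)" "z \<in> space (\<mu> (Suc (Suc k)))" and g: "bdd_meas (\<mu> (Suc k)) g"
  shows "(LINT y|br k x z. c + g y) = c + (LINT y|br k x z. g y)"
    and "(LINT y|br k x z. c - g y) = c - (LINT y|br k x z. g y)"
proof -
  interpret brx: prob_space "br k x z" using assms by (intro prob_space_br)
  show "(LINT y|br k x z. c + g y) = c + (LINT y|br k x z. g y)"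
    "(LINT y|br k x z. c - g y) = c - (LINT y|br k x z. g y)"
    using integrable_br[OF assms] by (simp_all add: measure_br_space[OF assms(1,2)])
qed

lemma integral_J_fst:
  fixes g :: "'a \<Rightarrow> real"
  assumes [measurable]: "g \<in> borel_measurable (\<mu> k)"
  shows "(LINT v|J k. g (fst v)) = (LINT x|\<mu> k. g x)"
  unfolding J_def by (subst integral_distr) (auto simp: integral_law)

lemma integral_J_snd:
  fixes g :: "'a \<Rightarrow> real"
  assumes [measurable]: "g \<in> borel_measurable (\<mu> (Suc k))"
  shows "(LINT v|J k. g (snd v)) = (LINT x|\<mu> (Suc k). g x)"
  unfolding J_def by (subst integral_distr) (auto simp: integral_law)

lemma integral_J_K:
  fixes g :: "'a \<Rightarrow> 'a \<Rightarrow> real"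
  assumes g: "bdd_meas (\<mu> k \<Otimes>\<^sub>M \<mu> (Suc k)) (case_prod g)"
  shows "(LINT x|\<mu> k. LINT y|K k x. g x y) = (LINT v|J k. g (fst v) (snd v))"
proof -
  note [measurable] = bdd_meas_measurable[OF g]
  have "(LINT v|J k. case_prod g v) = (LINT w|M. g (X k w) (X (Suc k) w))"
    unfolding J_def by (subst integral_distr) auto
  then show ?thesis by (simp add: integral_pair_bm[OF g] case_prod_beta')
qed

lemma path_density_bounds:
  assumes "a \<in> space (\<mu> k)" "d \<in> space (\<mu> (Suc (Suc (Suc k))))" "u \<in> space (middle k)"
  shows "0 \<le> path_density k a d u" "path_density k a d u \<le> 1 / eps ^ 3"
proof -
  obtain b c where u: "u = (b, c)" and bc: "b \<in> space (\<mu> (Suc k))" "c \<in> space (\<mu> (Suc (Suc k)))"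
    using assms(3) by (auto simp: space_pair_measure)
  have "path_density k a d u \<le> 1 / eps * (1 / eps) * (1 / eps)"
    unfolding path_density_def u fst_conv snd_conv using assms bc eps
    by (intro mult_mono p_le p_nonneg mult_nonneg_nonneg) auto
  then show "path_density k a d u \<le> 1 / eps ^ 3" by (simp add: power3_eq_cube)
  show "0 \<le> path_density k a d u"
    unfolding path_density_def u fst_conv snd_conv using assms bc by (intro mult_nonneg_nonneg p_nonneg) auto
qed

lemma p_bm: "bdd_meas (\<mu> n \<Otimes>\<^sub>M \<mu> (Suc n)) (case_prod (p n))"
  by (rule bdd_measI[where B = "1 / eps"]) (auto simp: p_pair_measurable p_bounds space_pair_measure)

text \<open>Used twice: with constant functions over the reals for the total mass of the three-step
  density, and with complex phases for three twisted transitions. The end point \<open>d\<close> is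
  integrated last because the paths to be compared share it.\<close>

lemma three_step_integral:
  fixes g1 g2 g3 :: "'a \<Rightarrow> 'a \<Rightarrow> 'c::{banach, second_countable_topology, real_normed_field}"
  assumes a: "a \<in> space (\<mu> k)"
    and g1: "bdd_meas (\<mu> k \<Otimes>\<^sub>M \<mu> (Suc k)) (case_prod g1)"
    and g2: "bdd_meas (\<mu> (Suc k) \<Otimes>\<^sub>M \<mu> (Suc (Suc k))) (case_prod g2)"
    and g3: "bdd_meas (\<mu> (Suc (Suc k)) \<Otimes>\<^sub>M \<mu> (Suc (Suc (Suc k)))) (case_prod g3)"
  shows "(LINT b|K k a. g1 a b * (LINT c|K (Suc k) b. g2 b c * (LINT d|K (Suc (Suc k)) c. g3 c d))) =
    (LINT d|\<mu> (Suc (Suc (Suc k))). LINT u|middle k. path_density k a d u *\<^sub>R (g1 a (fst u) * g2 (fst u) (snd u) * g3 (snd u) d))"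
proof -
  let ?B = "\<mu> (Suc k)" and ?C = "\<mu> (Suc (Suc k))" and ?D = "\<mu> (Suc (Suc (Suc k)))"
  let ?H3 = "\<lambda>c. LINT d|K (Suc (Suc k)) c. g3 c d" and ?I3 = "\<lambda>c. LINT d|?D. p (Suc (Suc k)) c d *\<^sub>R g3 c d"
  let ?H2 = "\<lambda>b. LINT c|K (Suc k) b. g2 b c * ?H3 c" and ?I2 = "\<lambda>b. LINT c|?C. p (Suc k) b c *\<^sub>R (g2 b c * ?I3 c)"
  note gi = bdd_meas_intros bdd_meas_integral_K bdd_meas_integral_mu
    bdd_meas_compose2[OF g1] bdd_meas_compose2[OF g2] bdd_meas_compose2[OF g3]
    bdd_meas_compose2[OF p_bm]
  note [measurable] = a
  note gm = bdd_meas_measurable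
  have scale: "bdd_meas N (\<lambda>x. r x *\<^sub>R g x)" if "bdd_meas N r" "bdd_meas N g"
    for N :: "'z measure" and r and g :: "'z \<Rightarrow> 'c"
  proof -
    have "bdd_meas N (\<lambda>x. of_real (r x) :: 'c)"
      using that(1) by (auto simp: bdd_meas_def)
    from bdd_meas_mult[OF this that(2)] show ?thesis by (simp add: scaleR_conv_of_real)
  qed
  define h where "h u d = path_density k a d u *\<^sub>R (g1 a (fst u) * g2 (fst u) (snd u) * g3 (snd u) d)" for u d
  have h: "bdd_meas (middle k \<Otimes>\<^sub>M ?D) (\<lambda>z. h (fst z) (snd z))"
    unfolding h_def path_density_def by (intro scale gi; measurable)
  interpret MD: pair_prob_space "middle k" ?D ..
  have 3: "?H3 c = ?I3 c" if "c \<in> space ?C" for c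
    using that by (intro integral_K gm gi; measurable)
  have 2: "?H2 b =
      ?I2 b" if [measurable]: "b \<in> space ?B" for b
  proof -
    have "?H2 b =
      (LINT c|?C. p (Suc k) b c *\<^sub>R (g2 b c * ?H3 c))"
      using that by (intro integral_K gm gi; measurable)
    also have "\<dots> = ?I2 b"
      by (intro Bochner_Integration.integral_cong refl) (simp add: 3)
    finally show ?thesis .
  qed
  have "(LINT b|K k a. g1 a b * ?H2 b) =
    (LINT b|?B. p k a b *\<^sub>R (g1 a b * ?H2 b))"
    by (intro integral_K a gm gi; measurable)
  also have "\<dots> = (LINT b|?B. LINT c|?C. LINT d|?D. h (b, c) d)"
  proof (rule Bochner_Integration.integral_cong[OF refl])
    fix b assume b [measurable]: "b \<in> space ?B"
    have i3: "integrable ?D (\<lambda>d. p (Suc (Suc k)) c d *\<^sub>R g3 c d)" if [measurable]: "c \<in> space ?C" for c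
      using that by (intro mu.integrable_bdd_meas scale gi; measurable)
    have i2: "integrable ?C (\<lambda>c. p (Suc k) b c *\<^sub>R (g2 b c * ?I3 c))"
      by (intro mu.integrable_bdd_meas scale gi; measurable)
    have "p k a b *\<^sub>R (g1 a b * ?H2 b) =
      (p k a b *\<^sub>R g1 a b) * ?I2 b"
      unfolding 2[OF b] by simp
    also have "\<dots> = (LINT c|?C. (p k a b *\<^sub>R g1 a b) * (p (Suc k) b c *\<^sub>R (g2 b c * ?I3 c)))"
      by (rule Bochner_Integration.integral_mult_right[OF i2, symmetric])
    also have "\<dots> = (LINT c|?C. LINT d|?D. h (b, c) d)"
    proof (rule Bochner_Integration.integral_cong[OF refl])
      fix c assume c: "c \<in> space ?C"
      have "(p k a b *\<^sub>R g1 a b) * (p (Suc k) b c *\<^sub>R (g2 b c * ?I3 c)) =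
        ((p k a b *\<^sub>R g1 a b) * (p (Suc k) b c *\<^sub>R g2 b c)) * ?I3 c"
        by simp
      also have "\<dots> = (LINT d|?D. ((p k a b *\<^sub>R g1 a b) * (p (Suc k) b c *\<^sub>R g2 b c)) * (p (Suc (Suc k)) c d *\<^sub>R g3 c d))"
        by (rule Bochner_Integration.integral_mult_right[OF i3[OF c], symmetric])
      also have "\<dots> = (LINT d|?D. h (b, c) d)"
        by (simp add: h_def path_density_def ac_simps)
      finally show "(p k a b *\<^sub>R g1 a b) * (p (Suc k) b c *\<^sub>R (g2 b c * ?I3 c))
        = (LINT d|?D. h (b, c) d)" .
    qed
    finally show "p k a b *\<^sub>R (g1 a b * ?H2 b) =
      (LINT c|?C. LINT d|?D. h (b, c) d)" .
  qed
  also have "\<dots> = (LINT u|middle k. LINT d|?D. h u d)"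
  proof (rule mu_pair.integral_fst'[of "Suc k" "Suc (Suc k)" "\<lambda>u. \<integral>d. h u d \<partial>?D"])
    show "integrable (middle k) (\<lambda>u. \<integral>d. h u d \<partial>?D)"
      by (intro mu_pair.P.integrable_bdd_meas bdd_meas_integral_mu h)
  qed
  also have "\<dots> = (LINT d|?D. LINT u|middle k. h u d)"
    using MD.P.integrable_bdd_meas[OF h]
    by (intro MD.Fubini_integral[symmetric]) (simp add: case_prod_beta')
  finally show ?thesis by (simp add: h_def)
qed

section \<open>Null sets of edges stay null in hexagons\<close>

text \<open>For each edge of the path keep the factor of \<open>path_density\<close> that belongs to
  it and bound the other two by \<open>1 / eps\<close>. What remains integrates to the null edge
  integral, as the other variables run over probability measures.\<close>

lemma path_null:
  assumes \<beta> [measurable]: "\<And>n. (\<lambda>v. \<beta> n (fst v) (snd v)) \<in> borel_measurable (\<mu> n \<Otimes>\<^sub>M \<mu> (Suc n))"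
    and null: "\<And>n. (\<integral>\<^sup>+x. \<integral>\<^sup>+y. ennreal (p n x y) * \<beta> n x y \<partial>\<mu> (Suc n) \<partial>\<mu> n) = (0 :: ennreal)"
  shows "(\<integral>\<^sup>+a. \<integral>\<^sup>+d. \<integral>\<^sup>+u. ennreal (path_density k a d u) * (\<beta> k a (fst u) + \<beta> (Suc k) (fst u) (snd u) + \<beta> (Suc (Suc k)) (snd u) d)
      \<partial>middle k \<partial>\<mu> (Suc (Suc (Suc k))) \<partial>\<mu> k) = 0"
proof -
  let ?A = "\<mu> k" and ?B = "\<mu> (Suc k)" and ?C = "\<mu> (Suc (Suc k))" and ?D = "\<mu> (Suc (Suc (Suc k)))"
  define g where "g n x y = ennreal (p n x y) * \<beta> n x y" for n x y
  have g [measurable (raw)]: "(\<lambda>z. g n (x z) (y z)) \<in> borel_measurable N"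
    if [measurable]: "x \<in> N \<rightarrow>\<^sub>M \<mu> n" "y \<in> N \<rightarrow>\<^sub>M \<mu> (Suc n)" for n x y and N :: "'z measure"
    unfolding g_def using measurable_compose[OF _ \<beta>, of "\<lambda>z. (x z, y z)" N n] by simp
  have null: "(\<integral>\<^sup>+x. \<integral>\<^sup>+y. g n x y \<partial>\<mu> (Suc n) \<partial>\<mu> n) = 0" for n
    unfolding g_def by (rule null)
  let ?J1 = "\<integral>\<^sup>+a. \<integral>\<^sup>+d. \<integral>\<^sup>+u. g k a (fst u) \<partial>middle k \<partial>?D \<partial>?A"
  let ?J2 = "\<integral>\<^sup>+a. \<integral>\<^sup>+d. \<integral>\<^sup>+u. g (Suc k) (fst u) (snd u) \<partial>middle k \<partial>?D \<partial>?A"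
  let ?J3 = "\<integral>\<^sup>+a. \<integral>\<^sup>+d. \<integral>\<^sup>+u. g (Suc (Suc k)) (snd u) d \<partial>middle k \<partial>?D \<partial>?A"
  let ?c = "ennreal (1 / eps * (1 / eps))"
  let ?L = "\<lambda>a d u. ennreal (path_density k a d u) * (\<beta> k a (fst u) + \<beta> (Suc k) (fst u) (snd u) + \<beta> (Suc (Suc k)) (snd u) d)"
  let ?R = "\<lambda>a d u. ?c * (g k a (fst u) + g (Suc k) (fst u) (snd u) + g (Suc (Suc k)) (snd u) d)"
  have "(\<integral>\<^sup>+a. \<integral>\<^sup>+d. \<integral>\<^sup>+u. ?L a d u
      \<partial>middle k \<partial>?D \<partial>?A) \<le>
    (\<integral>\<^sup>+a. \<integral>\<^sup>+d. \<integral>\<^sup>+u. ?R a d u \<partial>middle k \<partial>?D \<partial>?A)"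
  proof (intro nn_integral_mono)
    fix a d u assume a: "a \<in> space ?A" and d: "d \<in> space ?D" and u: "u \<in> space (middle k)"
    define s t r where "s = p k a (fst u)" and "t = p (Suc k) (fst u) (snd u)" and "r = p (Suc (Suc k)) (snd u) d"
    have b: "0 \<le> s" "s \<le> 1 / eps" "0 \<le> t" "t \<le> 1 / eps" "0 \<le> r" "r \<le> 1 / eps"
      using a d u by (auto simp: s_def t_def r_def space_pair_measure intro!: p_nonneg p_le)
    have "t * r \<le> 1 / eps * (1 / eps)" "s * r \<le> 1 / eps * (1 / eps)" "s * t \<le> 1 / eps * (1 / eps)"
      using b eps by (intro mult_mono; simp)+
    then have "s * (t * r) \<le> s * (1 / eps * (1 / eps))" "t * (s * r) \<le> t * (1 / eps * (1 / eps))" "r * (s * t) \<le> r * (1 / eps * (1 / eps))"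
      using b by (auto intro: mult_left_mono simp del: times_divide_eq_left times_divide_eq_right)
    then have strs: "s * t * r \<le> 1 / eps * (1 / eps) * s" "s * t * r \<le> 1 / eps * (1 / eps) * t" "s * t * r \<le> 1 / eps * (1 / eps) * r"
      by (simp_all only: ac_simps)
    have "ennreal x \<le> ?c * ennreal y" if "x \<le> 1 / eps * (1 / eps) * y" "0 \<le> y" for x y
    proof -
      have "ennreal x \<le> ennreal (1 / eps * (1 / eps) * y)" by (rule ennreal_leI) fact
      also have "\<dots> = ?c * ennreal y" using eps that by (intro ennreal_mult) auto
      finally show ?thesis .
    qed
    note this[OF strs(1) b(1)] this[OF strs(2) b(3)] this[OF strs(3) b(5)]
    then have *: "ennreal (s * t * r) * x \<le> ?c * (ennreal s * x)" "ennreal (s * t * r) * x \<le> ?c * (ennreal t * x)"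
       "ennreal (s * t * r) * x \<le> ?c * (ennreal r * x)" for x
      by (simp_all add: mult.assoc[symmetric] mult_right_mono)
    show "?L a d u
      \<le> ?R a d u"
      unfolding distrib_left path_density_def g_def s_def[symmetric] t_def[symmetric] r_def[symmetric]
      by (intro add_mono *)
  qed
  also have "\<dots> = ?c * (?J1
      + ?J2
      + ?J3)"
    by (simp add: nn_integral_cmult nn_integral_add mu.emeasure_space_1 cong: nn_integral_cong)
  also have "\<dots> = 0"
  proof -
    have "?J1 = (\<integral>\<^sup>+a. \<integral>\<^sup>+d. \<integral>\<^sup>+b. \<integral>\<^sup>+c. g k a b \<partial>?C \<partial>?B \<partial>?D \<partial>?A)"
      by (intro nn_integral_cong nn_integral_fst_snd[symmetric]) measurable
    also have "\<dots> = 0" by (simp add: mu.emeasure_space_1 null)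
    finally have 1: "?J1 = 0" .
    have "(\<integral>\<^sup>+u. g (Suc k) (fst u) (snd u) \<partial>middle k) = 0"
      using nn_integral_fst_snd[of "g (Suc k)" "Suc k" "Suc (Suc k)"] null[of "Suc k"] by simp
    then have 2: "?J2 = 0" by simp
    have "?J3 =
      (\<integral>\<^sup>+a. \<integral>\<^sup>+d. \<integral>\<^sup>+b. \<integral>\<^sup>+c. g (Suc (Suc k)) c d \<partial>?C \<partial>?B \<partial>?D \<partial>?A)"
      by (intro nn_integral_cong nn_integral_fst_snd[symmetric]) measurable
    also have "\<dots> = (\<integral>\<^sup>+d. \<integral>\<^sup>+c. g (Suc (Suc k)) c d \<partial>?C \<partial>?D)" by (simp add: mu.emeasure_space_1)
    also have "\<dots> = (\<integral>\<^sup>+c. \<integral>\<^sup>+d. g (Suc (Suc k)) c d \<partial>?D \<partial>?C)"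
      by (rule nn_integral_swap[symmetric]) measurable
    finally have 3: "?J3 = 0"
      by (simp add: null)
    show ?thesis unfolding 1 2 3 by simp
  qed
  finally show ?thesis by simp
qed

text \<open>Only two of the six edges are sampled from the law of the chain; the others come from
  bridges. Domination by a pair of paths reduces all six to \<open>path_null\<close>. It allows the
  functional to be modified on null sets without changing the structure constants.\<close>

lemma AE_hex_edges:
  assumes Q [measurable]: "\<And>n. Measurable.pred (\<mu> n \<Otimes>\<^sub>M \<mu> (Suc n)) (\<lambda>v. Q n (fst v) (snd v))"
    and AE: "\<And>n. AE v in J n. Q n (fst v) (snd v)"
  shows "AE P in hex k. case P of (a, (b, b'), (c, c'), d) \<Rightarrow>
    Q k a b \<and> Q (Suc k) b c \<and> Q (Suc (Suc k)) c d \<and> Q k a b' \<and> Q (Suc k) b' c' \<and> Q (Suc (Suc k)) c' d"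
proof -
  define \<beta> where "\<beta> n x y = (if Q n x y then 0 else 1 :: ennreal)" for n x y
  have \<beta>0: "(\<lambda>v. \<beta> n (fst v) (snd v)) \<in> borel_measurable (\<mu> n \<Otimes>\<^sub>M \<mu> (Suc n))" for n
    unfolding \<beta>_def by measurable
  have \<beta> [measurable (raw)]: "(\<lambda>z. \<beta> n (x z) (y z)) \<in> borel_measurable N"
    if [measurable]: "x \<in> N \<rightarrow>\<^sub>M \<mu> n" "y \<in> N \<rightarrow>\<^sub>M \<mu> (Suc n)" for n x y and N :: "'z measure"
    using measurable_compose[OF _ \<beta>0, of "\<lambda>z. (x z, y z)" N n] by simp
  have null: "(\<integral>\<^sup>+x. \<integral>\<^sup>+y. ennreal (p n x y) * \<beta> n x y \<partial>\<mu> (Suc n) \<partial>\<mu> n) = 0" for n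
  proof -
    have "(\<integral>\<^sup>+v. \<beta> n (fst v) (snd v) \<partial>J n) = (\<integral>\<^sup>+v. 0 \<partial>J n)"
      by (rule nn_integral_cong_AE) (use AE[of n] in \<open>auto simp: \<beta>_def\<close>)
    then show ?thesis by (simp add: nn_integral_J)
  qed
  define h where "h a d u = \<beta> k a (fst u) + \<beta> (Suc k) (fst u) (snd u) + \<beta> (Suc (Suc k)) (snd u) d" for a d u
  have h [measurable (raw)]: "(\<lambda>z. h (a z) (d z) (u z)) \<in> borel_measurable N"
    if [measurable]: "a \<in> N \<rightarrow>\<^sub>M \<mu> k" "d \<in> N \<rightarrow>\<^sub>M \<mu> (Suc (Suc (Suc k)))" "u \<in> N \<rightarrow>\<^sub>M middle k" for a d u and N :: "'z measure"
    unfolding h_def by measurable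
  \<comment> \<open>Counts the bad edges along the upper path and along the lower path.\<close>
  define G where "G P = h (fst P) (snd (snd (snd P))) (fst (fst (snd P)), fst (fst (snd (snd P))))
      + h (fst P) (snd (snd (snd P))) (snd (fst (snd P)), snd (fst (snd (snd P))))" for P :: "'a hexagon"
  have G [measurable]: "G \<in> borel_measurable (hexspace k)" unfolding G_def by measurable
  let ?D = "\<mu> (Suc (Suc (Suc k)))" and ?w = "path_density k"
  let ?c = "ennreal (1 / eps\<^sup>2) * ennreal (1 / eps ^ 3)"
  have "(\<integral>\<^sup>+P. G P \<partial>hex k) \<le> (\<integral>\<^sup>+a. \<integral>\<^sup>+d. \<integral>\<^sup>+u. \<integral>\<^sup>+u'. ennreal (1 / eps\<^sup>2 * (?w a d u * ?w a d u')) *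
        G (a, (fst u, fst u'), (snd u, snd u'), d) \<partial>middle k \<partial>middle k \<partial>?D \<partial>\<mu> k)"
    by (rule nn_integral_hex_le[OF G])
  also have "\<dots> \<le> (\<integral>\<^sup>+a. \<integral>\<^sup>+d. \<integral>\<^sup>+u. \<integral>\<^sup>+u'. ?c * (ennreal (?w a d u) * h a d u + ennreal (?w a d u') * h a d u')
      \<partial>middle k \<partial>middle k \<partial>?D \<partial>\<mu> k)"
  proof (intro nn_integral_mono)
    fix a d u u' assume a: "a \<in> space (\<mu> k)" and d: "d \<in> space ?D" and u: "u \<in> space (middle k)" "u' \<in> space (middle k)"
    note w = path_density_bounds[OF a d u(1)] path_density_bounds[OF a d u(2)]
    \<comment> \<open>A term of \<open>G\<close> concerns only one of the two paths, so the density
      of the other path is replaced by its upper bound.\<close>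
    have "?w a d u * ?w a d u' \<le> 1 / eps ^ 3 * ?w a d u" "?w a d u * ?w a d u' \<le> 1 / eps ^ 3 * ?w a d u'"
      using mult_left_mono[OF w(4) w(1)] mult_right_mono[OF w(2) w(3)] by (simp_all only: ac_simps)
    then have "1 / eps\<^sup>2 * (?w a d u * ?w a d u') \<le> 1 / eps\<^sup>2 * (1 / eps ^ 3 * ?w a d u)"
      "1 / eps\<^sup>2 * (?w a d u * ?w a d u') \<le> 1 / eps\<^sup>2 * (1 / eps ^ 3 * ?w a d u')"
      by (intro mult_left_mono; simp)+
    note this[THEN ennreal_leI]
    moreover have split: "ennreal (1 / eps\<^sup>2 * (1 / eps ^ 3 * x)) = ?c * ennreal x" if "0 \<le> x" for x
    proof -
      have "ennreal (1 / eps\<^sup>2 * (1 / eps ^ 3 * x)) = ennreal (1 / eps\<^sup>2) * ennreal (1 / eps ^ 3 * x)"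
        using eps that by (intro ennreal_mult) auto
      also have "ennreal (1 / eps ^ 3 * x) = ennreal (1 / eps ^ 3) * ennreal x"
        using eps that by (intro ennreal_mult) auto
      finally show ?thesis by (simp only: mult.assoc)
    qed
    ultimately have le: "ennreal (1 / eps\<^sup>2 * (?w a d u * ?w a d u')) \<le> ?c * ennreal (?w a d u)"
      "ennreal (1 / eps\<^sup>2 * (?w a d u * ?w a d u')) \<le> ?c * ennreal (?w a d u')"
      by (simp_all only: split[OF w(1)] split[OF w(3)])
    show "ennreal (1 / eps\<^sup>2 * (?w a d u * ?w a d u')) * G (a, (fst u, fst u'), (snd u, snd u'), d) \<le>
      ?c * (ennreal (?w a d u) * h a d u + ennreal (?w a d u') * h a d u')"
      unfolding distrib_left mult.assoc[symmetric] G_def fst_conv snd_conv prod.collapse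
      by (intro add_mono mult_right_mono le[unfolded mult.assoc[symmetric]]) auto
  qed
  also have "\<dots> = ?c * ((\<integral>\<^sup>+a. \<integral>\<^sup>+d. \<integral>\<^sup>+u. ennreal (?w a d u) * h a d u \<partial>middle k \<partial>?D \<partial>\<mu> k)
      + (\<integral>\<^sup>+a. \<integral>\<^sup>+d. \<integral>\<^sup>+u'. ennreal (?w a d u') * h a d u' \<partial>middle k \<partial>?D \<partial>\<mu> k))"
    by (simp add: nn_integral_cmult nn_integral_add mu_pair.P.emeasure_space_1 mu_pair.P.emeasure_space_1[unfolded space_pair_measure] cong: nn_integral_cong)
  also have "\<dots> = 0"
    unfolding h_def path_null[OF \<beta>0 null] by simp
  finally have "(\<integral>\<^sup>+P. G P \<partial>hex k) = 0" by simp
  then have "AE P in hex k. G P = 0"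
    by (subst (asm) nn_integral_0_iff_AE) auto
  then show ?thesis
    by (rule AE_mp) (auto simp: G_def h_def \<beta>_def split: if_splits)
qed

end

section \<open>Bounded functionals: summable balances\<close>

text \<open>The bound on \<open>f\<close> is required at every pair of states; an almost surely
  bounded functional reaches this form by truncation.\<close>

locale elliptic_functional = elliptic_chain M F X \<mu> p eps
  for M :: "'w measure" and F and X :: "nat \<Rightarrow> 'w \<Rightarrow> 'a" and \<mu> p eps +
  fixes f :: "nat \<Rightarrow> 'a \<Rightarrow> 'a \<Rightarrow> real" and B :: real
  assumes f_measurable: "case_prod (f n) \<in> borel_measurable (\<mu> n \<Otimes>\<^sub>M \<mu> (Suc n))"
    and f_bound: "x \<in> space (\<mu> n) \<Longrightarrow> y \<in> space (\<mu> (Suc n)) \<Longrightarrow> \<bar>f n x y\<bar> \<le> B"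
begin

lemma B_nonneg: "0 \<le> B"
proof -
  obtain x y where "x \<in> space (\<mu> 0)" "y \<in> space (\<mu> (Suc 0))" using mu.not_empty by blast
  then show ?thesis using f_bound[of x 0 y] by simp
qed

lemma f_measurable_compose [measurable (raw)]:
  assumes [measurable]: "g \<in> N \<rightarrow>\<^sub>M \<mu> n" "h \<in> N \<rightarrow>\<^sub>M \<mu> (Suc n)"
  shows "(\<lambda>x. f n (g x) (h x)) \<in> borel_measurable N"
proof -
  note f_measurable[measurable]
  have "(\<lambda>x. case_prod (f n) (g x, h x)) \<in> borel_measurable N" by measurable
  then show ?thesis by simp
qed

lemma f_bm: "bdd_meas (\<mu> n \<Otimes>\<^sub>M \<mu> (Suc n)) (case_prod (f n))"
  by (rule bdd_measI[where B = B]) (auto simp: f_measurable f_bound space_pair_measure)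

section \<open>The potential and the conditional balance\<close>

definition bridge_mean :: "nat \<Rightarrow> 'a \<Rightarrow> 'a \<Rightarrow> real" where
  "bridge_mean k x z = (LINT y|br k x z. f k x y + f (Suc k) y z)"

text \<open>The transfer function of the coboundary. Note the shift of time:
  \<open>potential k\<close> acts on states at time \<open>k + 2\<close>.\<close>

definition potential :: "nat \<Rightarrow> 'a \<Rightarrow> real" where
  "potential k z = (LINT x|\<mu> k. bridge_mean k x z)"

lemma bridge_mean_bm: "bdd_meas (\<mu> k \<Otimes>\<^sub>M \<mu> (Suc (Suc k))) (case_prod (bridge_mean k))"
  unfolding bridge_mean_def case_prod_beta'
  by (intro bdd_meas_integral_br bdd_meas_intros bdd_meas_compose2[OF f_bm]; measurable)

lemma bridge_mean_bound: "x \<in> space (\<mu> k) \<Longrightarrow> z \<in> space (\<mu> (Suc (Suc k))) \<Longrightarrow> \<bar>bridge_mean k x z\<bar> \<le> 2 * B"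
  unfolding bridge_mean_def real_norm_def[symmetric]
  using f_bound[of x k] f_bound[of _ "Suc k" z] B_nonneg
  by (intro prob_space.norm_integral_le prob_space_br) (auto intro!: abs_triangle_ineq[THEN order_trans] add_mono[of _ B _ B, simplified])

lemma potential_bm: "bdd_meas (\<mu> (Suc (Suc k))) (potential k)"
  unfolding potential_def by (intro bdd_meas_integral_mu bdd_meas_compose2[OF bridge_mean_bm]; measurable)

lemma potential_bound: "z \<in> space (\<mu> (Suc (Suc k))) \<Longrightarrow> \<bar>potential k z\<bar> \<le> 2 * B"
  unfolding potential_def real_norm_def[symmetric] using bridge_mean_bound B_nonneg by (intro mu.norm_integral_le) auto

definition mean_edge :: "nat \<Rightarrow> real" where
  "mean_edge k = (LINT v|J k. f k (fst v) (snd v))"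

text \<open>The mean of the balance when the lower states at times \<open>k + 2\<close> and
  \<open>k + 3\<close> are \<open>c\<close> and \<open>d\<close>, in closed form. The edge
  \<open>(a, b)\<close> keeps its law under this conditioning, so averaging the two bridge means
  over it produces the two potentials.\<close>

definition cond_balance :: "nat \<Rightarrow> 'a \<Rightarrow> 'a \<Rightarrow> real" where
  "cond_balance k c d = mean_edge k + potential (Suc k) d - potential k c - f (Suc (Suc k)) c d"

lemmas f_intros = bdd_meas_integral_br bdd_meas_integral_mu bdd_meas_intros
  bdd_meas_compose2[OF f_bm] bdd_meas_compose2[OF bridge_mean_bm] bdd_meas_compose[OF potential_bm]

lemma cond_balance_bm: "bdd_meas (\<mu> (Suc (Suc k)) \<Otimes>\<^sub>M \<mu> (Suc (Suc (Suc k)))) (case_prod (cond_balance k))"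
  unfolding cond_balance_def case_prod_beta' by (intro f_intros; measurable)

lemma hex_balance_measurable [measurable]: "hex_balance f k \<in> borel_measurable (hexspace k)"
  unfolding hex_balance_def[abs_def] case_prod_beta' by measurable

text \<open>Conditioning the balance on the lower edge at the right end leaves that edge, up to a
  coboundary and a constant.\<close>

lemma cond_balance_le:
  assumes c [measurable]: "c \<in> space (\<mu> (Suc (Suc k)))" and d [measurable]: "d \<in> space (\<mu> (Suc (Suc (Suc k))))"
  shows "ennreal ((cond_balance k c d)\<^sup>2) \<le> (\<integral>\<^sup>+v. \<integral>\<^sup>+e. \<integral>\<^sup>+b'. ennreal ((hex_balance f k (fst v, (snd v, b'), (e, c), d))\<^sup>2)
      \<partial>br k (fst v) c \<partial>br (Suc k) (snd v) d \<partial>J k)"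
proof -
  \<comment> \<open>\<open>G2\<close> is the balance after averaging over \<open>b'\<close>, and
    \<open>G1\<close> after averaging also over the upper state \<open>e\<close>. Jensen's
    inequality is applied one integral at a time, since the inner laws depend on the outer
    variables.\<close>
  define G1 where "G1 v = f k (fst v) (snd v) + bridge_mean (Suc k) (snd v) d - f (Suc (Suc k)) c d - bridge_mean k (fst v) c" for v
  define G2 where "G2 v e = f k (fst v) (snd v) + f (Suc k) (snd v) e + f (Suc (Suc k)) e d
      - f (Suc (Suc k)) c d - bridge_mean k (fst v) c" for v e
  have G2: "(LINT b'|br k (fst v) c. hex_balance f k (fst v, (snd v, b'), (e, c), d)) = G2 v e"
    if v [measurable]: "fst v \<in> space (\<mu> k)" "snd v \<in> space (\<mu> (Suc k))" and [measurable]: "e \<in> space (\<mu> (Suc (Suc k)))" for v e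
  proof -
    have "(LINT b'|br k (fst v) c. hex_balance f k (fst v, (snd v, b'), (e, c), d)) =
      (LINT b'|br k (fst v) c. (f k (fst v) (snd v) + f (Suc k) (snd v) e + f (Suc (Suc k)) e d - f (Suc (Suc k)) c d)
        - (f k (fst v) b' + f (Suc k) b' c))"
      by (simp add: hex_balance_def algebra_simps)
    also have "\<dots> = G2 v e"
      unfolding G2_def bridge_mean_def using v c by (intro integral_br_add_const f_intros; measurable)
    finally show ?thesis .
  qed
  have G1: "(LINT e|br (Suc k) (snd v) d. G2 v e) = G1 v"
    if v [measurable]: "fst v \<in> space (\<mu> k)" "snd v \<in> space (\<mu> (Suc k))" for v
  proof -
    have "(LINT e|br (Suc k) (snd v) d. G2 v e) =
      (LINT e|br (Suc k) (snd v) d. (f k (fst v) (snd v) - f (Suc (Suc k)) c d - bridge_mean k (fst v) c)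
        + (f (Suc k) (snd v) e + f (Suc (Suc k)) e d))"
      by (simp add: G2_def algebra_simps)
    also have "\<dots> = (f k (fst v) (snd v) - f (Suc (Suc k)) c d - bridge_mean k (fst v) c) + bridge_mean (Suc k) (snd v) d"
      unfolding bridge_mean_def using v d by (intro integral_br_add_const f_intros; measurable)
    finally show ?thesis by (simp add: G1_def)
  qed
  have G0: "(LINT v|J k. G1 v) = cond_balance k c d"
  proof -
    have 1: "integrable (J k) (\<lambda>v. f k (fst v) (snd v))" "integrable (J k) (\<lambda>v. bridge_mean (Suc k) (snd v) d)"
       "integrable (J k) (\<lambda>v. bridge_mean k (fst v) c)"
      by (intro J.integrable_bdd_meas; unfold bdd_meas_J_cong; intro f_intros; measurable)+
    have 2: "(LINT v|J k. bridge_mean (Suc k) (snd v) d) = potential (Suc k) d" "(LINT v|J k. bridge_mean k (fst v) c) = potential k c"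
      unfolding potential_def
      by (intro integral_J_snd[of "\<lambda>x. bridge_mean (Suc k) x d"] integral_J_fst[of "\<lambda>x. bridge_mean k x c"]
          bdd_meas_measurable f_intros; measurable)+
    show ?thesis
      unfolding G1_def using 1 by (simp add: 2 cond_balance_def mean_edge_def J.prob_space[unfolded space_J])
  qed
  have "ennreal ((cond_balance k c d)\<^sup>2) \<le> (\<integral>\<^sup>+v. ennreal ((G1 v)\<^sup>2) \<partial>J k)"
    unfolding G0[symmetric]
  proof (rule J.square_integral_le)
    have "bdd_meas (J k) G1"
      unfolding G1_def bdd_meas_J_cong by (intro f_intros; measurable)
    then show "G1 \<in> borel_measurable (J k)" by (rule bdd_meas_measurable)
  qed
  also have "\<dots> \<le> (\<integral>\<^sup>+v. \<integral>\<^sup>+e. ennreal ((G2 v e)\<^sup>2) \<partial>br (Suc k) (snd v) d \<partial>J k)"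
  proof (rule nn_integral_mono)
    fix v assume "v \<in> space (J k)"
    then have v [measurable]: "fst v \<in> space (\<mu> k)" "snd v \<in> space (\<mu> (Suc k))" by auto
    show "ennreal ((G1 v)\<^sup>2) \<le> (\<integral>\<^sup>+e. ennreal ((G2 v e)\<^sup>2) \<partial>br (Suc k) (snd v) d)"
      unfolding G1[OF v, symmetric]
    proof (rule prob_space.square_integral_le[OF prob_space_br[OF v(2) d]])
      have "bdd_meas (br (Suc k) (snd v) d) (G2 v)"
        unfolding G2_def bdd_meas_br_cong by (intro f_intros; measurable)
      then show "G2 v \<in> borel_measurable (br (Suc k) (snd v) d)" by (rule bdd_meas_measurable)
    qed
  qed
  also have "\<dots> \<le> (\<integral>\<^sup>+v. \<integral>\<^sup>+e. \<integral>\<^sup>+b'. ennreal ((hex_balance f k (fst v, (snd v, b'), (e, c), d))\<^sup>2)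
      \<partial>br k (fst v) c \<partial>br (Suc k) (snd v) d \<partial>J k)"
  proof (rule nn_integral_mono, rule nn_integral_mono)
    fix v e assume "v \<in> space (J k)" and "e \<in> space (br (Suc k) (snd v) d)"
    then have v [measurable]: "fst v \<in> space (\<mu> k)" "snd v \<in> space (\<mu> (Suc k))"
      and e [measurable]: "e \<in> space (\<mu> (Suc (Suc k)))" by auto
    show "ennreal ((G2 v e)\<^sup>2) \<le> (\<integral>\<^sup>+b'. ennreal ((hex_balance f k (fst v, (snd v, b'), (e, c), d))\<^sup>2) \<partial>br k (fst v) c)"
      unfolding G2[OF v e, symmetric]
      by (rule prob_space.square_integral_le[OF prob_space_br[OF v(1) c]]) measurable
  qed
  finally show ?thesis .
qed

lemma integral_cond_balance_le:
  "ennreal (LINT w|J (Suc (Suc k)). (cond_balance k (fst w) (snd w))\<^sup>2) \<le> (\<integral>\<^sup>+P. ennreal ((hex_balance f k P)\<^sup>2) \<partial>hex k)"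
proof -
  let ?g = "\<lambda>v w. \<integral>\<^sup>+c. \<integral>\<^sup>+b'. ennreal ((hex_balance f k (fst v, (snd v, b'), (c, fst w), snd w))\<^sup>2)
      \<partial>br k (fst v) (fst w) \<partial>br (Suc k) (snd v) (snd w)"
  have ft: "bdd_meas (J (Suc (Suc k))) (\<lambda>w. (cond_balance k (fst w) (snd w))\<^sup>2)"
    unfolding bdd_meas_J_cong
    by (intro bdd_meas_intros bdd_meas_compose2[OF cond_balance_bm]; measurable)
  have "ennreal (LINT w|J (Suc (Suc k)). (cond_balance k (fst w) (snd w))\<^sup>2)
    = (\<integral>\<^sup>+w. ennreal ((cond_balance k (fst w) (snd w))\<^sup>2) \<partial>J (Suc (Suc k)))"
    using J.integrable_bdd_meas[OF ft] by (intro nn_integral_eq_integral[symmetric]) auto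
  also have "\<dots> \<le> (\<integral>\<^sup>+w. \<integral>\<^sup>+v. ?g v w \<partial>J k \<partial>J (Suc (Suc k)))"
    by (intro nn_integral_mono cond_balance_le) auto
  \<comment> \<open>The hexagon law samples \<open>(a, b)\<close> first, whereas the conditioning
    fixes the lower right edge first; independence of the two edges permits the exchange.\<close>
  also have "\<dots> = (\<integral>\<^sup>+v. \<integral>\<^sup>+w. ?g v w \<partial>J (Suc (Suc k)) \<partial>J k)"
  proof -
    interpret JJ: pair_prob_space "J k" "J (Suc (Suc k))" ..
    note [measurable (raw)] = nn_integral_measurable_subprob_algebra2 measurable_prob_algebraD
    have "(\<lambda>z. ?g (fst z) (snd z)) \<in> borel_measurable (J k \<Otimes>\<^sub>M J (Suc (Suc k)))"
      by (rule nn_integral_measurable_subprob_algebra2[where N = "\<mu> (Suc (Suc k))"]; (unfold case_prod_beta')?;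
          (rule nn_integral_measurable_subprob_algebra2[where N = "\<mu> (Suc k)"])?; measurable)
    then show ?thesis using JJ.Fubini'[of ?g] by (simp add: case_prod_beta')
  qed
  also have "\<dots> = (\<integral>\<^sup>+P. ennreal ((hex_balance f k P)\<^sup>2) \<partial>hex k)"
    by (rule nn_integral_hex[symmetric]) measurable
  finally show ?thesis .
qed

text \<open>This 6 is the one in the gap \<open>pi / (6 * B)\<close>.\<close>

lemma hex_balance_bound: "P \<in> space (hex k) \<Longrightarrow> \<bar>hex_balance f k P\<bar> \<le> 6 * B"
proof -
  assume "P \<in> space (hex k)"
  then obtain a b b' c c' d where P: "P = (a, (b, b'), (c, c'), d)"
    and "a \<in> space (\<mu> k)" "b \<in> space (\<mu> (Suc k))" "b' \<in> space (\<mu> (Suc k))"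
      "c \<in> space (\<mu> (Suc (Suc k)))" "c' \<in> space (\<mu> (Suc (Suc k)))" "d \<in> space (\<mu> (Suc (Suc (Suc k))))"
    by (auto simp: space_hex space_pair_measure)
  then have "\<bar>f k a b\<bar> \<le> B" "\<bar>f (Suc k) b c\<bar> \<le> B" "\<bar>f (Suc (Suc k)) c d\<bar> \<le> B"
    "\<bar>f k a b'\<bar> \<le> B" "\<bar>f (Suc k) b' c'\<bar> \<le> B" "\<bar>f (Suc (Suc k)) c' d\<bar> \<le> B"
    by (auto intro: f_bound)
  then show ?thesis unfolding P hex_balance_def by (auto simp: abs_le_iff)
qed

lemma hex_balance_square_integrable: "integrable (hex k) (\<lambda>P. (hex_balance f k P)\<^sup>2)"
proof (rule hex.integrable_bounded)
  show "norm ((hex_balance f k P)\<^sup>2) \<le> (6 * B)\<^sup>2" if "P \<in> space (hex k)" for P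
    using power_mono[OF hex_balance_bound[OF that], of 2] by simp
qed measurable

section \<open>Coboundary decomposition and center-tightness\<close>

definition mean_cond_balance :: "nat \<Rightarrow> real" where
  "mean_cond_balance k = (LINT w|J (Suc (Suc k)). cond_balance k (fst w) (snd w))"

text \<open>No hexagon has its right end edge at time 0 or 1, so these two entries are set to zero.
  Centring makes the variance bound applicable.\<close>

definition residual :: "nat \<Rightarrow> 'a \<Rightarrow> 'a \<Rightarrow> real" where
  "residual n x y = (if n < 2 then 0 else cond_balance (n - 2) x y - mean_cond_balance (n - 2))"

lemma residual_simps [simp]:
  "residual 0 x y = 0" "residual (Suc 0) x y = 0" "residual (Suc (Suc k)) x y = cond_balance k x y - mean_cond_balance k"
  by (simp_all add: residual_def)

lemma index_cases: obtains "n = 0" | "n = Suc 0" | k where "n = Suc (Suc k)"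
  by (metis not0_implies_Suc)

lemma residual_bm: "bdd_meas (\<mu> n \<Otimes>\<^sub>M \<mu> (Suc n)) (case_prod (residual n))"
proof (cases n rule: index_cases)
  case (3 k)
  show ?thesis unfolding 3 residual_simps case_prod_beta'
    by (intro bdd_meas_intros bdd_meas_compose2[OF cond_balance_bm]; measurable)
qed (simp_all add: bdd_meas_const case_prod_beta')

lemma cond_balance_integrable:
  "integrable (J (Suc (Suc k))) (\<lambda>w. cond_balance k (fst w) (snd w))"
  "integrable (J (Suc (Suc k))) (\<lambda>w. (cond_balance k (fst w) (snd w))\<^sup>2)"
  by (intro J.integrable_bdd_meas; unfold bdd_meas_J_cong;
      intro bdd_meas_intros bdd_meas_compose2[OF cond_balance_bm]; measurable)+

lemma residual_mean: "(LINT x|\<mu> n. LINT y|K n x. residual n x y) = 0"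
proof (cases n rule: index_cases)
  case (3 k)
  have "(LINT x|\<mu> n. LINT y|K n x. residual n x y) = (LINT w|J (Suc (Suc k)). cond_balance k (fst w) (snd w) - mean_cond_balance k)"
    using integral_J_K[OF residual_bm, of n] by (simp add: 3)
  also have "\<dots> = 0"
    using cond_balance_integrable(1)[of k] J.prob_space[of "Suc (Suc k)"] by (simp add: mean_cond_balance_def)
  finally show ?thesis .
qed simp_all

text \<open>Centring only decreases the second moment of the conditional balance, and Jensen's
  inequality bounds that by the second moment of the balance.\<close>

lemma energy_residual: "energy residual (Suc (Suc k)) \<le> (LINT P|hex k. (hex_balance f k P)\<^sup>2)"
proof -
  have bm: "bdd_meas (\<mu> n \<Otimes>\<^sub>M \<mu> (Suc n)) (case_prod (\<lambda>x y. (residual n x y)\<^sup>2))" for n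
    unfolding case_prod_beta' by (intro bdd_meas_intros bdd_meas_compose2[OF residual_bm]; measurable)
  have "energy residual (Suc (Suc k)) = J.variance (Suc (Suc k)) (\<lambda>w. cond_balance k (fst w) (snd w))"
    unfolding energy_def integral_J_K[OF bm] by (simp add: mean_cond_balance_def)
  also have "\<dots> = (LINT w|J (Suc (Suc k)). (cond_balance k (fst w) (snd w))\<^sup>2) - (mean_cond_balance k)\<^sup>2"
    unfolding mean_cond_balance_def by (rule J.variance_eq[OF cond_balance_integrable])
  also have "\<dots> \<le> (LINT w|J (Suc (Suc k)). (cond_balance k (fst w) (snd w))\<^sup>2)" by simp
  also have "\<dots> \<le> (LINT P|hex k. (hex_balance f k P)\<^sup>2)"
    using integral_cond_balance_le[of k] hex_balance_square_integrable[of k]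
    by (simp add: nn_integral_eq_integral)
  finally show ?thesis .
qed

text \<open>Solving the definition of \<open>cond_balance\<close> for \<open>f\<close> expresses it
  through constants, the residual and a difference of potentials, which telescopes along the chain.
  The summands at times 0 and 1 remain.\<close>

lemma sum_decomposition:
  assumes "w \<in> space M"
  shows "(\<Sum>n<Suc (Suc k). f n (X n w) (X (Suc n) w)) =
    f 0 (X 0 w) (X 1 w) + f 1 (X 1 w) (X 2 w) + (\<Sum>i<k. mean_edge i - mean_cond_balance i)
    + potential k (X (Suc (Suc k)) w) - potential 0 (X 2 w) - (\<Sum>n<Suc (Suc k). residual n (X n w) (X (Suc n) w))"
proof (induction k)
  case 0
  show ?case by (simp add: numeral_2_eq_2)
next
  case (Suc k)
  show ?case
    unfolding sum.lessThan_Suc[of _ "Suc (Suc k)"] Suc.IH by (simp add: cond_balance_def)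
qed

theorem summable_balance_imp_tight:
  assumes "summable (\<lambda>k. \<integral>P. (hex_balance f k P)\<^sup>2 \<partial>hex k)"
  shows "\<exists>m. \<forall>\<eta>>0. \<exists>R. \<forall>N. measure M {w \<in> space M. \<bar>(\<Sum>n<N. f n (X n w) (X (Suc n) w)) - m N\<bar> > R} < \<eta>"
proof -
  let ?E = "\<Sum>k. \<integral>P. (hex_balance f k P)\<^sup>2 \<partial>hex k"
  let ?S = "\<lambda>N w. \<Sum>n<N. f n (X n w) (X (Suc n) w)"
  let ?Y = "\<lambda>N w. \<Sum>n<N. residual n (X n w) (X (Suc n) w)"
  have "(\<Sum>n<N. energy residual n) \<le> ?E" for N
  proof -
    have "(\<Sum>n<N. energy residual n) \<le> (\<Sum>n<Suc (Suc N). energy residual n)"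
      by (rule sum_mono2) (auto simp: energy_nonneg)
    also have "\<dots> = (\<Sum>n<N. energy residual (Suc (Suc n)))"
      unfolding sum.lessThan_Suc_shift by (simp add: energy_def)
    also have "\<dots> \<le> (\<Sum>n<N. \<integral>P. (hex_balance f n P)\<^sup>2 \<partial>hex n)"
      by (intro sum_mono energy_residual)
    also have "\<dots> \<le> ?E" using assms by (intro sum_le_suminf) auto
    finally show ?thesis .
  qed
  from second_moment_bound[OF residual_bm residual_mean this]
  obtain C where C: "\<And>N. (LINT w|M. (?Y N w)\<^sup>2) \<le> C" by blast
  have "0 \<le> C" using order_trans[OF _ C[of 0]] by simp
  have Y: "bdd_meas M (?Y N)" for N
    by (intro bdd_meas_intros bdd_meas_compose2[OF residual_bm]; measurable)
  define m where "m N = (if N < 2 then 0 else \<Sum>i<N - 2. mean_edge i - mean_cond_balance i)" for N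
  \<comment> \<open>Two initial summands contribute \<open>B\<close> each and two potentials
    \<open>2 * B\<close> each, which gives \<open>6 * B\<close>.\<close>
  have le: "\<bar>?S N w - m N\<bar> \<le> 6 * B + \<bar>?Y N w\<bar>" if w: "w \<in> space M" for N w
  proof -
    have f: "\<bar>f n (X n w) (X (Suc n) w)\<bar> \<le> B" for n by (intro f_bound X_space w)
    have potential: "\<bar>potential k (X (Suc (Suc k)) w)\<bar> \<le> 2 * B" for k by (intro potential_bound X_space w)
    show ?thesis
    proof (cases N rule: index_cases)
      case 1
      then show ?thesis using B_nonneg by (simp add: m_def)
    next
      case 2
      then show ?thesis using f[of 0] B_nonneg by (simp add: m_def)
    next
      case (3 k)
      have "m (Suc (Suc k)) = (\<Sum>i<k. mean_edge i - mean_cond_balance i)" by (simp add: m_def)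
      then show ?thesis
        unfolding 3 sum_decomposition[OF w] One_nat_def numeral_2_eq_2
        using f[of 0] f[of "Suc 0"] potential[of 0] potential[of k] by linarith
    qed
  qed
  have "\<exists>R. \<forall>N. measure M {w \<in> space M. \<bar>?S N w - m N\<bar> > R} < \<eta>" if "0 < \<eta>" for \<eta> :: real
  proof (intro exI allI)
    fix N
    \<comment> \<open>Chebyshev's bound is \<open>C / t\<^sup>2\<close>. Adding 1 makes
      \<open>t\<close> at least 1, so this is at most \<open>C / t\<close>, which is below
      \<open>\<eta>\<close>.\<close>
    define t where "t = C / \<eta> + 1"
    have t: "1 \<le> t" "C / \<eta> < t" using \<open>0 \<le> C\<close> \<open>0 < \<eta>\<close> by (auto simp: t_def)
    note [measurable] = bdd_meas_measurable[OF Y]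
    have "measure M {w \<in> space M. \<bar>?S N w - m N\<bar> > 6 * B + t} \<le> measure M {w \<in> space M. t \<le> \<bar>?Y N w\<bar>}"
    proof (rule finite_measure_mono)
      show "{w \<in> space M. \<bar>?S N w - m N\<bar> > 6 * B + t} \<subseteq> {w \<in> space M. t \<le> \<bar>?Y N w\<bar>}"
        using le[of _ N] by fastforce
    qed measurable
    also have "\<dots> \<le> (LINT w|M. (?Y N w)\<^sup>2) / t\<^sup>2"
      using t by (intro second_moment_method integrable_bdd_meas[OF bdd_meas_power2[OF Y]]) auto
    also have "\<dots> \<le> C / t\<^sup>2" using C[of N] by (intro divide_right_mono) auto
    also have "\<dots> \<le> C / t"
      using t \<open>0 \<le> C\<close> by (intro divide_left_mono) (auto simp: power2_eq_square)
    also have "\<dots> < \<eta>" using t \<open>0 < \<eta>\<close> by (simp add: field_simps)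
    finally show "measure M {w \<in> space M. \<bar>?S N w - m N\<bar> > 6 * B + t} < \<eta>" .
  qed
  then show ?thesis by blast
qed

section \<open>Bounded functionals: characteristic functions\<close>

text \<open>The squared structure constant at position \<open>k + 3\<close>, in cosine form.\<close>

definition hex_dist :: "real \<Rightarrow> nat \<Rightarrow> real" where
  "hex_dist \<xi> k = (LINT P|hex k. 2 - 2 * cos (\<xi> * hex_balance f k P))"

lemma hex_dist_integrable: "integrable (hex k) (\<lambda>P. 2 - 2 * cos (\<xi> * hex_balance f k P))"
  by (rule hex.integrable_bounded[where B = 4]) (auto intro!: abs_leI simp: minus_le_iff intro: order_trans[OF _ cos_ge_minus_one])

lemma hex_dist_nonneg: "0 \<le> hex_dist \<xi> k"
  unfolding hex_dist_def by (intro integral_nonneg_AE) auto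

definition phase :: "real \<Rightarrow> nat \<Rightarrow> 'a \<Rightarrow> 'a \<Rightarrow> complex" where
  "phase \<xi> n x y = cis (\<xi> * f n x y)"

lemma phase_bm: "bdd_meas (\<mu> n \<Otimes>\<^sub>M \<mu> (Suc n)) (case_prod (phase \<xi> n))"
  unfolding phase_def case_prod_beta' by (intro bdd_measI[where B = 1]) auto

text \<open>The transition operator perturbed by the phase, as in the Fourier method for Markov
  chains: its iterates applied to 1 give characteristic functions of the sums.\<close>

definition twist :: "real \<Rightarrow> nat \<Rightarrow> ('a \<Rightarrow> complex) \<Rightarrow> 'a \<Rightarrow> complex" where
  "twist \<xi> n v x = (LINT y|K n x. phase \<xi> n x y * v y)"

lemma twist_bm:
  assumes "bdd_meas (\<mu> (Suc n)) v"
  shows "bdd_meas (\<mu> n) (twist \<xi> n v)"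
  unfolding twist_def
  by (intro bdd_meas_integral_K bdd_meas_intros bdd_meas_compose2[OF phase_bm]
      bdd_meas_compose[OF assms]; measurable)

lemma norm_twist_le:
  assumes x: "x \<in> space (\<mu> n)" and v: "bdd_meas (\<mu> (Suc n)) v"
  shows "norm (twist \<xi> n v x) \<le> (LINT y|K n x. norm (v y))"
  using integral_norm_bound[of "K n x" "\<lambda>y. phase \<xi> n x y * v y"]
  by (simp add: twist_def phase_def norm_mult)

lemma twist_bound:
  assumes x: "x \<in> space (\<mu> n)" and "\<And>y. y \<in> space (\<mu> (Suc n)) \<Longrightarrow> norm (v y) \<le> b" "0 \<le> b"
  shows "norm (twist \<xi> n v x) \<le> b"
  unfolding twist_def by (rule integral_K_bound) (use assms in \<open>auto simp: phase_def norm_mult\<close>)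

section \<open>The loss of modulus in a block of three steps\<close>

definition path_phase :: "real \<Rightarrow> nat \<Rightarrow> 'a \<Rightarrow> 'a \<Rightarrow> 'a \<times> 'a \<Rightarrow> real" where
  "path_phase \<xi> k a d u = \<xi> * (f k a (fst u) + f (Suc k) (fst u) (snd u) + f (Suc (Suc k)) (snd u) d)"

lemma path_phase_measurable [measurable (raw)]:
  assumes [measurable]: "g \<in> N \<rightarrow>\<^sub>M \<mu> k" "h \<in> N \<rightarrow>\<^sub>M \<mu> (Suc (Suc (Suc k)))" "u \<in> N \<rightarrow>\<^sub>M middle k"
  shows "(\<lambda>x. path_phase \<xi> k (g x) (h x) (u x)) \<in> borel_measurable N"
  unfolding path_phase_def by measurable

text \<open>The kernel of three successive twists with respect to the marginal at time
  \<open>k + 3\<close>; \<open>path_mass\<close> is the same kernel without phases, the three-step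
  transition density.\<close>

definition path_char :: "real \<Rightarrow> nat \<Rightarrow> 'a \<Rightarrow> 'a \<Rightarrow> complex" where
  "path_char \<xi> k a d = (LINT u|middle k. path_density k a d u *\<^sub>R cis (path_phase \<xi> k a d u))"

definition path_mass :: "nat \<Rightarrow> 'a \<Rightarrow> 'a \<Rightarrow> real" where
  "path_mass k a d = (LINT u|middle k. path_density k a d u)"

text \<open>By \<open>norm_integral_cis\<close> this is the integral of \<open>2 - 2 * cos\<close>
  of the phase difference of two paths from \<open>a\<close> to \<open>d\<close>, weighted by both
  path densities. It links the loss of modulus to the hexagons.\<close>

definition path_gap :: "real \<Rightarrow> nat \<Rightarrow> 'a \<Rightarrow> 'a \<Rightarrow> real" where
  "path_gap \<xi> k a d = 2 * ((path_mass k a d)\<^sup>2 - (norm (path_char \<xi> k a d))\<^sup>2)"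

lemma path_density_bm:
  "bdd_meas ((\<mu> k \<Otimes>\<^sub>M \<mu> (Suc (Suc (Suc k)))) \<Otimes>\<^sub>M middle k) (\<lambda>z. path_density k (fst (fst z)) (snd (fst z)) (snd z))"
proof (rule bdd_measI[where B = "1 / eps ^ 3"])
  show "norm (path_density k (fst (fst z)) (snd (fst z)) (snd z)) \<le> 1 / eps ^ 3"
    if "z \<in> space ((\<mu> k \<Otimes>\<^sub>M \<mu> (Suc (Suc (Suc k)))) \<Otimes>\<^sub>M middle k)" for z
    using path_density_bounds[of "fst (fst z)" k "snd (fst z)" "snd z"] that by (auto simp: space_pair_measure)
qed measurable

lemma bdd_meas_integral_middle:
  fixes g :: "'b \<Rightarrow> 'a \<times> 'a \<Rightarrow> 'c::{banach, second_countable_topology}"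
  assumes "bdd_meas (N \<Otimes>\<^sub>M middle k) (\<lambda>z. g (fst z) (snd z))"
  shows "bdd_meas N (\<lambda>x. \<integral>y. g x y \<partial>middle k)"
  by (rule bdd_meas_integral_kernel[OF assms])
    (simp add: space_prob_algebra mu_pair.P.prob_space_axioms)

lemma path_bm:
  "bdd_meas (\<mu> k \<Otimes>\<^sub>M \<mu> (Suc (Suc (Suc k)))) (\<lambda>z. path_mass k (fst z) (snd z))"
  "bdd_meas (\<mu> k \<Otimes>\<^sub>M \<mu> (Suc (Suc (Suc k)))) (\<lambda>z. norm (path_char \<xi> k (fst z) (snd z)))"
  "bdd_meas (\<mu> k \<Otimes>\<^sub>M \<mu> (Suc (Suc (Suc k)))) (\<lambda>z. path_gap \<xi> k (fst z) (snd z))"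
proof -
  show 1: "bdd_meas (\<mu> k \<Otimes>\<^sub>M \<mu> (Suc (Suc (Suc k)))) (\<lambda>z. path_mass k (fst z) (snd z))"
    unfolding path_mass_def by (intro bdd_meas_integral_middle path_density_bm)
  have "bdd_meas ((\<mu> k \<Otimes>\<^sub>M \<mu> (Suc (Suc (Suc k)))) \<Otimes>\<^sub>M middle k)
    (\<lambda>z. path_density k (fst (fst z)) (snd (fst z)) (snd z) *\<^sub>R cis (path_phase \<xi> k (fst (fst z)) (snd (fst z)) (snd z)))"
  proof -
    obtain b where "\<And>z. z \<in> space ((\<mu> k \<Otimes>\<^sub>M \<mu> (Suc (Suc (Suc k)))) \<Otimes>\<^sub>M middle k) \<Longrightarrow>
        norm (path_density k (fst (fst z)) (snd (fst z)) (snd z)) \<le> b"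
      using bdd_measE[OF path_density_bm[of k]] by blast
    then show ?thesis by (intro bdd_measI[where B = b]; (measurable | simp))
  qed
  then have "bdd_meas (\<mu> k \<Otimes>\<^sub>M \<mu> (Suc (Suc (Suc k)))) (\<lambda>z. path_char \<xi> k (fst z) (snd z))"
    unfolding path_char_def by (rule bdd_meas_integral_middle)
  then show 2: "bdd_meas (\<mu> k \<Otimes>\<^sub>M \<mu> (Suc (Suc (Suc k)))) (\<lambda>z. norm (path_char \<xi> k (fst z) (snd z)))"
    by (auto simp: bdd_meas_def)
  show "bdd_meas (\<mu> k \<Otimes>\<^sub>M \<mu> (Suc (Suc (Suc k)))) (\<lambda>z. path_gap \<xi> k (fst z) (snd z))"
    unfolding path_gap_def by (intro bdd_meas_intros 1 2)
qed

lemma path_section_bm: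
  assumes [measurable]: "g \<in> N \<rightarrow>\<^sub>M \<mu> k" "h \<in> N \<rightarrow>\<^sub>M \<mu> (Suc (Suc (Suc k)))"
  shows "bdd_meas N (\<lambda>x. path_mass k (g x) (h x))"
    "bdd_meas N (\<lambda>x. norm (path_char \<xi> k (g x) (h x)))"
    "bdd_meas N (\<lambda>x. path_gap \<xi> k (g x) (h x))"
  using path_bm[THEN bdd_meas_compose, of "\<lambda>x. (g x, h x)" N] by simp_all

text \<open>Factor the difference of squares: the sum of \<open>path_mass\<close> and the modulus of
  \<open>path_char\<close> is at most \<open>2 / eps ^ 3\<close>.\<close>

lemma path_gap_le:
  assumes a [measurable]: "a \<in> space (\<mu> k)" and d [measurable]: "d \<in> space (\<mu> (Suc (Suc (Suc k))))"
  shows "0 \<le> path_gap \<xi> k a d" "path_gap \<xi> k a d \<le> 4 / eps ^ 3 * (path_mass k a d - norm (path_char \<xi> k a d))"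
proof -
  have le: "norm (path_char \<xi> k a d) \<le> path_mass k a d"
  proof -
    have "norm (path_char \<xi> k a d) \<le> (LINT u|middle k. norm (path_density k a d u *\<^sub>R cis (path_phase \<xi> k a d u)))"
      unfolding path_char_def by (rule integral_norm_bound)
    also have "\<dots> = path_mass k a d"
      unfolding path_mass_def using path_density_bounds[OF a d]
      by (intro Bochner_Integration.integral_cong refl) auto
    finally show ?thesis .
  qed
  then have "(norm (path_char \<xi> k a d))\<^sup>2 \<le> (path_mass k a d)\<^sup>2" by (intro power_mono) auto
  then show "0 \<le> path_gap \<xi> k a d" by (simp add: path_gap_def)
  have "norm (path_mass k a d) \<le> 1 / eps ^ 3"
    unfolding path_mass_def using path_density_bounds[OF a d] eps
    by (intro mu_pair.P.norm_integral_le) auto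
  then have "path_mass k a d + norm (path_char \<xi> k a d) \<le> 2 / eps ^ 3" using le by simp
  then have "(path_mass k a d + norm (path_char \<xi> k a d)) * (path_mass k a d - norm (path_char \<xi> k a d))
    \<le> 2 / eps ^ 3 * (path_mass k a d - norm (path_char \<xi> k a d))"
    using le by (intro mult_right_mono) auto
  then show "path_gap \<xi> k a d \<le> 4 / eps ^ 3 * (path_mass k a d - norm (path_char \<xi> k a d))"
    by (simp add: path_gap_def power2_eq_square algebra_simps)
qed

lemma integral_path_mass:
  assumes "a \<in> space (\<mu> k)"
  shows "(LINT d|\<mu> (Suc (Suc (Suc k))). path_mass k a d) = 1"
proof -
  have one: "bdd_meas N (case_prod (\<lambda>x y. 1 :: real))" for N :: "('a \<times> 'a) measure"
    by (simp add: case_prod_beta' bdd_meas_const)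
  have "(LINT y|K k a. (LINT z|K (Suc k) y. (LINT w|K (Suc (Suc k)) z. 1))) = (1::real)"
  proof -
    have "(LINT y|K k a. (LINT z|K (Suc k) y. (LINT w|K (Suc (Suc k)) z. (1::real)))) = (LINT y|K k a. (LINT z|K (Suc k) y. 1))"
      by (intro Bochner_Integration.integral_cong refl) (simp add: measure_K_space)
    also have "\<dots> = (LINT y|K k a. 1)"
      by (intro Bochner_Integration.integral_cong refl) (simp add: measure_K_space)
    finally show ?thesis using assms by (simp add: measure_K_space)
  qed
  then show ?thesis
    using three_step_integral[OF assms one one one] by (simp add: path_mass_def)
qed

text \<open>Three twists act through the kernel \<open>path_char\<close>. Its modulus falls short of
  \<open>path_mass\<close>, which has total integral 1, by at least the fraction
  \<open>eps ^ 3 / 4\<close> of the gap.\<close>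

lemma twist3_le:
  assumes a [measurable]: "a \<in> space (\<mu> k)" and v: "bdd_meas (\<mu> (Suc (Suc (Suc k)))) v"
    and b: "\<And>y. y \<in> space (\<mu> (Suc (Suc (Suc k)))) \<Longrightarrow> norm (v y) \<le> b" "0 \<le> b"
  shows "norm (twist \<xi> k (twist \<xi> (Suc k) (twist \<xi> (Suc (Suc k)) v)) a)
    \<le> b * (1 - eps ^ 3 / 4 * (LINT d|\<mu> (Suc (Suc (Suc k))). path_gap \<xi> k a d))"
proof -
  let ?D = "\<mu> (Suc (Suc (Suc k)))"
  let ?t = "\<lambda>u d. path_density k a d u *\<^sub>R (phase \<xi> k a (fst u) * phase \<xi> (Suc k) (fst u) (snd u) * (phase \<xi> (Suc (Suc k)) (snd u) d * v d))"
  have vb: "bdd_meas (\<mu> (Suc (Suc k)) \<Otimes>\<^sub>M ?D) (case_prod (\<lambda>x y. phase \<xi> (Suc (Suc k)) x y * v y))"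
    unfolding case_prod_beta'
    by (intro bdd_meas_intros bdd_meas_compose2[OF phase_bm] bdd_meas_compose[OF v]; measurable)
  have int: "integrable ?D (\<lambda>d. path_mass k a d)" "integrable ?D (\<lambda>d. norm (path_char \<xi> k a d))" "integrable ?D (\<lambda>d. path_gap \<xi> k a d)"
    by (intro mu.integrable_bdd_meas path_section_bm; measurable)+
  have "twist \<xi> k (twist \<xi> (Suc k) (twist \<xi> (Suc (Suc k)) v)) a =
    (LINT d|?D. LINT u|middle k. ?t u d)"
    unfolding twist_def by (rule three_step_integral[OF a phase_bm phase_bm vb])
  also have "\<dots> = (LINT d|?D. path_char \<xi> k a d * v d)"
  proof (rule Bochner_Integration.integral_cong[OF refl])
    fix d assume [measurable]: "d \<in> space ?D"
    have "(LINT u|middle k. ?t u d)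
      = (LINT u|middle k. (path_density k a d u *\<^sub>R cis (path_phase \<xi> k a d u)) * v d)"
      by (simp add: phase_def path_phase_def cis_mult[symmetric] distrib_left mult.assoc)
    also have "\<dots> = path_char \<xi> k a d * v d"
      unfolding path_char_def by (rule integral_mult_left_zero)
    finally show "(LINT u|middle k. ?t u d)
      = path_char \<xi> k a d * v d" .
  qed
  also have "norm \<dots> \<le> (LINT d|?D. norm (path_char \<xi> k a d * v d))" by (rule integral_norm_bound)
  also have "\<dots> \<le> (LINT d|?D. b * norm (path_char \<xi> k a d))"
  proof (rule integral_mono)
    have "bdd_meas ?D (\<lambda>d. norm (v d))" using v by (auto simp: bdd_meas_def)
    then have "integrable ?D (\<lambda>d. norm (path_char \<xi> k a d) * norm (v d))"
      by (intro mu.integrable_bdd_meas bdd_meas_intros path_section_bm; measurable)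
    then show "integrable ?D (\<lambda>d. norm (path_char \<xi> k a d * v d))" by (simp add: norm_mult)
    show "integrable ?D (\<lambda>d. b * norm (path_char \<xi> k a d))" using int(2) by simp
    show "norm (path_char \<xi> k a d * v d) \<le> b * norm (path_char \<xi> k a d)" if "d \<in> space ?D" for d
      using mult_left_mono[OF b(1)[OF that], of "norm (path_char \<xi> k a d)"] by (simp add: norm_mult mult.commute)
  qed
  also have "\<dots> = b * (LINT d|?D. norm (path_char \<xi> k a d))" by simp
  also have "\<dots> \<le> b * (1 - eps ^ 3 / 4 * (LINT d|?D. path_gap \<xi> k a d))"
  proof (rule mult_left_mono[OF _ b(2)])
    have "(LINT d|?D. path_gap \<xi> k a d) \<le> (LINT d|?D. 4 / eps ^ 3 * (path_mass k a d - norm (path_char \<xi> k a d)))"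
      by (intro integral_mono int path_gap_le a integrable_mult_right Bochner_Integration.integrable_diff)
    also have "\<dots> = 4 / eps ^ 3 * (1 - (LINT d|?D. norm (path_char \<xi> k a d)))"
      using int integral_path_mass[OF a] by simp
    finally show "(LINT d|?D. norm (path_char \<xi> k a d)) \<le> 1 - eps ^ 3 / 4 * (LINT d|?D. path_gap \<xi> k a d)"
      using eps by (simp add: field_simps)
  qed
  finally show ?thesis .
qed

text \<open>After the comparison of hexagons with pairs of paths, \<open>norm_integral_cis\<close>
  evaluates the inner double integral exactly as \<open>path_gap\<close>.\<close>

lemma hex_dist_le_gap:
  "hex_dist \<xi> k \<le> 1 / eps\<^sup>2 * (LINT a|\<mu> k. LINT d|\<mu> (Suc (Suc (Suc k))). path_gap \<xi> k a d)"
proof -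
  let ?D = "\<mu> (Suc (Suc (Suc k)))"
  let ?w = "path_density k" and ?th = "path_phase \<xi> k"
  let ?F = "\<lambda>a d u u'. ennreal (1 / eps\<^sup>2 * (?w a d u * ?w a d u')) * ennreal (2 - 2 * cos (\<xi> * hex_balance f k (a, (fst u, fst u'), (snd u, snd u'), d)))"
  let ?G = "\<lambda>a d u u'. ennreal (?w a d u * ?w a d u' * (2 - 2 * cos (?th a d u - ?th a d u')))"
  let ?I = "\<lambda>a d. \<integral>\<^sup>+u. \<integral>\<^sup>+u'. ?F a d u u' \<partial>middle k \<partial>middle k"
  have nn: "0 \<le> 1 / eps\<^sup>2" by simp
  have "ennreal (hex_dist \<xi> k) = (\<integral>\<^sup>+P. ennreal (2 - 2 * cos (\<xi> * hex_balance f k P)) \<partial>hex k)"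
    unfolding hex_dist_def by (rule nn_integral_eq_integral[OF hex_dist_integrable, symmetric]) auto
  also have "\<dots> \<le> (\<integral>\<^sup>+a. \<integral>\<^sup>+d. ?I a d \<partial>?D \<partial>\<mu> k)"
    by (rule nn_integral_hex_le) measurable
  also have "\<dots> = (\<integral>\<^sup>+a. \<integral>\<^sup>+d. ennreal (1 / eps\<^sup>2 * path_gap \<xi> k a d) \<partial>?D \<partial>\<mu> k)"
  proof (intro nn_integral_cong)
    fix a d assume a [measurable]: "a \<in> space (\<mu> k)" and d [measurable]: "d \<in> space ?D"
    have "?I a d
      = (\<integral>\<^sup>+u. \<integral>\<^sup>+u'. ennreal (1 / eps\<^sup>2) * ?G a d u u'
         \<partial>middle k \<partial>middle k)"
    proof (intro nn_integral_cong)
      fix u u' assume u: "u \<in> space (middle k)" "u' \<in> space (middle k)"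
      \<comment> \<open>The balance compares the two paths around the hexagon, so its phase is the
        difference of theirs.\<close>
      have "\<xi> * hex_balance f k (a, (fst u, fst u'), (snd u, snd u'), d) = ?th a d u - ?th a d u'"
        by (simp add: hex_balance_def path_phase_def algebra_simps)
      moreover have "0 \<le> ?w a d u * ?w a d u'"
        using path_density_bounds(1)[OF a d] u by simp
      moreover have "ennreal (x * y) * ennreal z = ennreal x * ennreal (y * z)" if "0 \<le> x" "0 \<le> y" for x y z
        using that by (simp add: ennreal_mult' mult.assoc)
      ultimately show "?F a d u u'
        = ennreal (1 / eps\<^sup>2) * ?G a d u u'"
        using nn by (simp only:)
    qed
    also have "\<dots> = ennreal (1 / eps\<^sup>2) * (\<integral>\<^sup>+u. \<integral>\<^sup>+u'. ?G a d u u'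
         \<partial>middle k \<partial>middle k)"
      by (simp add: nn_integral_cmult cong: nn_integral_cong)
    also have "\<dots> = ennreal (1 / eps\<^sup>2) * ennreal (path_gap \<xi> k a d)"
      unfolding path_gap_def path_mass_def path_char_def using path_density_bounds[OF a d]
      by (subst mu_pair.P.norm_integral_cis(2)[where B = "1 / eps ^ 3"]) auto
    also have "\<dots> = ennreal (1 / eps\<^sup>2 * path_gap \<xi> k a d)" using nn by (simp only: ennreal_mult')
    finally show "?I a d
      = ennreal (1 / eps\<^sup>2 * path_gap \<xi> k a d)" .
  qed
  also have "\<dots> = (\<integral>\<^sup>+a. ennreal (LINT d|?D. 1 / eps\<^sup>2 * path_gap \<xi> k a d) \<partial>\<mu> k)"
    using path_gap_le(1) nn
    by (intro nn_integral_cong nn_integral_eq_integral mu.integrable_bdd_meas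
        bdd_meas_intros path_section_bm AE_I2 mult_nonneg_nonneg; measurable)
  also have "\<dots> = ennreal (LINT a|\<mu> k. LINT d|?D. 1 / eps\<^sup>2 * path_gap \<xi> k a d)"
    using path_gap_le(1) nn
    by (intro nn_integral_eq_integral mu.integrable_bdd_meas bdd_meas_integral_mu
        bdd_meas_intros path_section_bm AE_I2 integral_nonneg_AE mult_nonneg_nonneg; measurable)
  finally have "hex_dist \<xi> k \<le> (LINT a|\<mu> k. LINT d|?D. 1 / eps\<^sup>2 * path_gap \<xi> k a d)"
    using path_gap_le(1) nn by (subst (asm) ennreal_le_iff) (auto intro!: integral_nonneg_AE AE_I2 mult_nonneg_nonneg)
  then show ?thesis by simp
qed

text \<open>The first two steps only smooth the starting point of the three-step block.\<close>

lemma twist5_le: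
  assumes x: "x \<in> space (\<mu> n)" and v: "bdd_meas (\<mu> (n + 5)) v"
    and b: "\<And>y. y \<in> space (\<mu> (n + 5)) \<Longrightarrow> norm (v y) \<le> b" "0 \<le> b"
  shows "norm (twist \<xi> n (twist \<xi> (n + 1) (twist \<xi> (n + 2) (twist \<xi> (n + 3) (twist \<xi> (n + 4) v)))) x)
    \<le> b * exp (- (eps ^ 6 / 4 * hex_dist \<xi> (n + 2)))"
proof -
  define k where "k = Suc (Suc n)"
  have idx: "n + 1 = Suc n" "n + 2 = k" "n + 3 = Suc k" "n + 4 = Suc (Suc k)" "n + 5 = Suc (Suc (Suc k))"
    by (simp_all add: k_def)
  note v = v[unfolded idx] and b = b[unfolded idx]
  let ?C = "\<mu> k" and ?D = "\<mu> (Suc (Suc (Suc k)))"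
  define w where "w = twist \<xi> k (twist \<xi> (Suc k) (twist \<xi> (Suc (Suc k)) v))"
  define \<Psi> where "\<Psi> a = (LINT d|?D. path_gap \<xi> k a d)" for a
  have w: "bdd_meas ?C w" unfolding w_def by (intro twist_bm v)
  have nw: "bdd_meas ?C (\<lambda>a. norm (w a))" using w by (auto simp: bdd_meas_def)
  have tw: "bdd_meas (\<mu> (Suc n)) (twist \<xi> (Suc n) w)"
    using w by (intro twist_bm) (simp add: k_def)
  have ntw: "bdd_meas (\<mu> (Suc n)) (\<lambda>y. norm (twist \<xi> (Suc n) w y))"
    using tw by (auto simp: bdd_meas_def)
  have \<Psi>: "bdd_meas ?C \<Psi>"
    unfolding \<Psi>_def by (intro bdd_meas_integral_mu path_section_bm; measurable)
  have \<Psi>_nonneg: "0 \<le> \<Psi> a" if "a \<in> space ?C" for a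
    unfolding \<Psi>_def using path_gap_le(1)[OF that] by (intro integral_nonneg_AE) auto
  define c where "c = eps ^ 3 / 4"
  have c: "0 \<le> c" using eps by (simp add: c_def)
  have wle: "norm (w a) \<le> b * (1 - c * \<Psi> a)" if "a \<in> space ?C" for a
    unfolding w_def \<Psi>_def c_def by (rule twist3_le[OF that v b])
  have P: "bdd_meas (\<mu> (Suc n)) (\<lambda>y. \<integral>a. g a \<partial>K (Suc n) y)"
    if "bdd_meas ?C g" for g :: "'a \<Rightarrow> real"
    by (intro bdd_meas_integral_K bdd_meas_compose[OF that[unfolded k_def]]; measurable)
  have lin: "bdd_meas ?C (\<lambda>a. b * (1 - c * \<Psi> a))"
    by (intro bdd_meas_intros \<Psi>)
  have "norm (twist \<xi> n (twist \<xi> (Suc n) w) x) \<le> (LINT y|K n x. norm (twist \<xi> (Suc n) w y))"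
    by (rule norm_twist_le[OF x tw])
  also have "\<dots> \<le> (LINT y|K n x. LINT a|K (Suc n) y. norm (w a))"
    by (intro integral_mono integrable_K_bm x ntw P nw norm_twist_le) (use w in \<open>simp_all add: k_def\<close>)
  also have "\<dots> \<le> (LINT y|K n x. LINT a|K (Suc n) y. b * (1 - c * \<Psi> a))"
  proof (rule integral_mono)
    show "integrable (K n x) (\<lambda>y. \<integral>a. norm (w a) \<partial>K (Suc n) y)"
      by (rule integrable_K_bm[OF x P[OF nw]])
    show "integrable (K n x) (\<lambda>y. \<integral>a. b * (1 - c * \<Psi> a) \<partial>K (Suc n) y)"
      by (rule integrable_K_bm[OF x P[OF lin]])
    fix y assume "y \<in> space (K n x)"
    then have y: "y \<in> space (\<mu> (Suc n))" by simp
    show "(LINT a|K (Suc n) y. norm (w a)) \<le> (LINT a|K (Suc n) y. b * (1 - c * \<Psi> a))"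
      by (rule integral_mono[OF integrable_K_bm[OF y nw[unfolded k_def]] integrable_K_bm[OF y lin[unfolded k_def]]])
        (rule wle, simp add: k_def)
  qed
  also have "\<dots> = (LINT y|K n x. b * (1 - c * (LINT a|K (Suc n) y. \<Psi> a)))"
  proof (intro Bochner_Integration.integral_cong refl)
    fix y assume "y \<in> space (K n x)"
    then have y: "y \<in> space (\<mu> (Suc n))" by simp
    interpret Ky: prob_space "K (Suc n) y" by (rule prob_space_K[OF y])
    have "integrable (K (Suc n) y) \<Psi>" using \<Psi> by (intro integrable_K_bm y) (simp add: k_def)
    then show "(LINT a|K (Suc n) y. b * (1 - c * \<Psi> a)) = b * (1 - c * (LINT a|K (Suc n) y. \<Psi> a))"
      by (simp add: measure_K_space[OF y])
  qed
  also have "\<dots> = b * (1 - c * (LINT y|K n x. LINT a|K (Suc n) y. \<Psi> a))"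
  proof -
    interpret Kx: prob_space "K n x" by (rule prob_space_K[OF x])
    show ?thesis using integrable_K_bm[OF x P[OF \<Psi>]] by (simp add: measure_K_space[OF x])
  qed
  \<comment> \<open>The exponent collects \<open>eps ^ 3\<close> from the three-step loss,
    \<open>eps\<close> from the two smoothing steps and \<open>eps\<^sup>2\<close> from the hexagon
    comparison. The resulting loss no longer depends on the starting state.\<close>
  also have "\<dots> \<le> b * (1 - eps ^ 6 / 4 * hex_dist \<xi> k)"
  proof (intro mult_left_mono b diff_left_mono)
    obtain B' where B': "\<And>a. a \<in> space ?C \<Longrightarrow> norm (\<Psi> a) \<le> B'"
      using bdd_measE[OF \<Psi>] by blast
    have "hex_dist \<xi> k \<le> 1 / eps\<^sup>2 * (LINT a|?C. \<Psi> a)" unfolding \<Psi>_def by (rule hex_dist_le_gap)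
    then have "eps ^ 3 * hex_dist \<xi> k \<le> eps ^ 3 * (1 / eps\<^sup>2 * (LINT a|?C. \<Psi> a))"
      using eps by (intro mult_left_mono) auto
    also have "\<dots> = eps * (LINT a|?C. \<Psi> a)"
      using eps by (simp add: power2_eq_square power3_eq_cube)
    also have "\<dots> \<le> (LINT y|K n x. LINT a|K (Suc n) y. \<Psi> a)"
    proof (rule two_step_lower[of \<Psi> n B' x, folded k_def, OF bdd_meas_measurable[OF \<Psi>] _ x])
      show "0 \<le> \<Psi> z \<and> \<Psi> z \<le> B'" if "z \<in> space ?C" for z
        using B'[OF that] \<Psi>_nonneg[OF that] by simp
    qed
    finally have "c * (eps ^ 3 * hex_dist \<xi> k) \<le> c * (LINT y|K n x. LINT a|K (Suc n) y. \<Psi> a)"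
      using c by (rule mult_left_mono)
    then show "eps ^ 6 / 4 * hex_dist \<xi> k \<le> c * (LINT y|K n x. LINT a|K (Suc n) y. \<Psi> a)"
      by (simp add: c_def mult.assoc[symmetric] power_add[symmetric])
  qed
  \<comment> \<open>In exponential form the losses of successive blocks add up.\<close>
  also have "\<dots> \<le> b * exp (- (eps ^ 6 / 4 * hex_dist \<xi> k))"
    using exp_ge_add_one_self[of "- (eps ^ 6 / 4 * hex_dist \<xi> k)"] by (intro mult_left_mono b) simp
  finally show ?thesis by (simp only: w_def idx)
qed

section \<open>Decay of characteristic functions\<close>

text \<open>The conditional characteristic function of the \<open>j\<close> summands from time
  \<open>n\<close> on, given the state at time \<open>n\<close>; the multiplicative counterpart of
  \<open>tail_mean\<close>.\<close>

primrec tail_char :: "real \<Rightarrow> nat \<Rightarrow> nat \<Rightarrow> 'a \<Rightarrow> complex" where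
  "tail_char \<xi> 0 = (\<lambda>n x. 1)"
| "tail_char \<xi> (Suc j) = (\<lambda>n. twist \<xi> n (tail_char \<xi> j (Suc n)))"

lemma tail_char_bm: "bdd_meas (\<mu> n) (tail_char \<xi> j n)"
  by (induction j arbitrary: n) (auto simp: bdd_meas_const intro: twist_bm)

lemma norm_tail_char_le: "x \<in> space (\<mu> n) \<Longrightarrow> norm (tail_char \<xi> j n x) \<le> 1"
  by (induction j arbitrary: n x) (auto intro: twist_bound)

text \<open>One application of \<open>twist5_le\<close> per block of five steps; the last
  \<open>j\<close> steps are only used not to increase the modulus.\<close>

lemma norm_tail_char_le_exp:
  "x \<in> space (\<mu> n) \<Longrightarrow>
   norm (tail_char \<xi> (5 * m + j) n x) \<le> exp (- (eps ^ 6 / 4 * (\<Sum>i<m. hex_dist \<xi> (n + 5 * i + 2))))"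
proof (induction m arbitrary: n x)
  case 0
  show ?case using norm_tail_char_le[OF 0, of \<xi> j] by simp
next
  case (Suc m)
  have j: "5 * Suc m + j = Suc (Suc (Suc (Suc (Suc (5 * m + j)))))" by simp
  let ?v = "tail_char \<xi> (5 * m + j) (n + 5)"
  have eq: "tail_char \<xi> (5 * Suc m + j) n x =
    twist \<xi> n (twist \<xi> (n + 1) (twist \<xi> (n + 2) (twist \<xi> (n + 3) (twist \<xi> (n + 4) ?v)))) x"
  proof -
    have "Suc n = n + 1" "Suc (Suc n) = n + 2" "Suc (Suc (Suc n)) = n + 3"
      "Suc (Suc (Suc (Suc n))) = n + 4" "Suc (Suc (Suc (Suc (Suc n)))) = n + 5"
      by simp_all
    note this[symmetric]
    then show ?thesis unfolding j tail_char.simps by (simp only:)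
  qed
  have "norm (tail_char \<xi> (5 * Suc m + j) n x) \<le> exp (- (eps ^ 6 / 4 * (\<Sum>i<m. hex_dist \<xi> (n + 5 + 5 * i + 2)))) * exp (- (eps ^ 6 / 4 * hex_dist \<xi> (n + 2)))"
    unfolding eq by (rule twist5_le[OF Suc.prems tail_char_bm Suc.IH]) simp_all
  also have "\<dots> = exp (- (eps ^ 6 / 4 * (\<Sum>i<Suc m. hex_dist \<xi> (n + 5 * i + 2))))"
  proof -
    have "exp (- (c * s)) * exp (- (c * t)) = exp (- (c * (t + s)))" for c s t :: real
      by (simp add: mult_exp_exp distrib_left add.commute)
    moreover have "(\<Sum>i<Suc m. hex_dist \<xi> (n + 5 * i + 2)) = hex_dist \<xi> (n + 2) + (\<Sum>i<m. hex_dist \<xi> (n + 5 + 5 * i + 2))"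
      by (subst sum.lessThan_Suc_shift) (simp add: add.assoc)
    ultimately show ?thesis by metis
  qed
  finally show ?case .
qed

abbreviation S :: "nat \<Rightarrow> 'w \<Rightarrow> real" where
  "S N w \<equiv> \<Sum>n<N. f n (X n w) (X (Suc n) w)"

text \<open>The expectation of the phase of the first \<open>n\<close> summands times the
  conditional characteristic function of the rest does not depend on \<open>n\<close>. The cases
  \<open>n = N\<close> and \<open>n = 0\<close> are the two sides.\<close>

lemma char_eq_tail_char:
  "(LINT w|M. cis (\<xi> * S N w)) = (LINT x|\<mu> 0. tail_char \<xi> N 0 x)"
proof -
  have "(LINT w|M. cis (\<xi> * S n w) * tail_char \<xi> (N - n) n (X n w)) = (LINT x|\<mu> 0. tail_char \<xi> N 0 x)"
    if "n \<le> N" for n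
    using that
  proof (induction n)
    case 0
    show ?case
      using integral_law[OF bdd_meas_measurable[OF tail_char_bm]] by simp
  next
    case (Suc n)
    define j where "j = N - Suc n"
    have j: "N - n = Suc j" using Suc.prems by (simp add: j_def)
    note [measurable] = X_adapted[OF order_refl, of n]
    have s_meas: "S n \<in> borel_measurable (F n)"
    proof (rule borel_measurable_sum)
      fix i assume "i \<in> {..<n}"
      then have [measurable]: "X i \<in> F n \<rightarrow>\<^sub>M \<mu> i" "X (Suc i) \<in> F n \<rightarrow>\<^sub>M \<mu> (Suc i)"
        by (auto intro: X_adapted)
      show "(\<lambda>w. f i (X i w) (X (Suc i) w)) \<in> borel_measurable (F n)" by measurable
    qed
    have s: "bdd_meas (F n) (\<lambda>w. cis (\<xi> * S n w))"
      using s_meas by (intro bdd_measI[where B = 1]) auto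
    have adapted: "bdd_meas (F n \<Otimes>\<^sub>M \<mu> (Suc n))
        (case_prod (\<lambda>w y. cis (\<xi> * S n w) * (phase \<xi> n (X n w) y * tail_char \<xi> j (Suc n) y)))"
      unfolding case_prod_beta'
      by (intro bdd_meas_mult bdd_meas_compose[OF s] bdd_meas_compose2[OF phase_bm]
          bdd_meas_compose[OF tail_char_bm]; measurable)
    have "(LINT w|M. cis (\<xi> * S (Suc n) w) * tail_char \<xi> (N - Suc n) (Suc n) (X (Suc n) w))
      = (LINT w|M. cis (\<xi> * S n w) * (phase \<xi> n (X n w) (X (Suc n) w) * tail_char \<xi> j (Suc n) (X (Suc n) w)))"
      by (simp add: j_def phase_def distrib_left cis_mult[symmetric] mult.assoc)
    also have "\<dots> = (LINT w|M. (LINT y|K n (X n w). cis (\<xi> * S n w) * (phase \<xi> n (X n w) y * tail_char \<xi> j (Suc n) y)))"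
      by (rule integral_markov_bm[OF adapted])
    also have "\<dots> = (LINT w|M. cis (\<xi> * S n w) * tail_char \<xi> (N - n) n (X n w))"
      by (simp add: j twist_def)
    finally show ?case using Suc by simp
  qed
  from this[of N] show ?thesis by simp
qed

text \<open>The \<open>r\<close> initial steps do not increase the modulus. Varying \<open>r\<close>
  moves the grid of blocks, so every residue class modulo 5 is reached.\<close>

lemma norm_char_le:
  "norm (LINT w|M. cis (\<xi> * S (r + 5 * m) w)) \<le> exp (- (eps ^ 6 / 4 * (\<Sum>i<m. hex_dist \<xi> (r + 5 * i + 2))))"
proof -
  have "norm (tail_char \<xi> (r + 5 * m) n x) \<le> exp (- (eps ^ 6 / 4 * (\<Sum>i<m. hex_dist \<xi> (n + r + 5 * i + 2))))"
    if "x \<in> space (\<mu> n)" for n x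
    using that
  proof (induction r arbitrary: n x)
    case 0
    then show ?case using norm_tail_char_le_exp[of x n \<xi> m 0] by simp
  next
    case (Suc r)
    have "norm (twist \<xi> n (tail_char \<xi> (r + 5 * m) (Suc n)) x) \<le>
        exp (- (eps ^ 6 / 4 * (\<Sum>i<m. hex_dist \<xi> (Suc n + r + 5 * i + 2))))"
      by (rule twist_bound[OF Suc.prems Suc.IH]) simp_all
    then show ?case by simp
  qed
  from this[of _ 0] show ?thesis
    unfolding char_eq_tail_char by (intro mu.norm_integral_le) auto
qed

lemma norm_cis_minus_1_le: "norm (cis t - 1) \<le> \<bar>t\<bar>"
proof -
  have "(norm (cis t - 1))\<^sup>2 = 2 - 2 * cos t"
    using norm_exp_i_minus_1_squared[of t] by (simp add: cis_conv_exp)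
  also have "\<dots> = (2 * sin (t / 2))\<^sup>2"
    using cos_double_sin[of "t / 2"] by (simp add: power2_eq_square)
  also have "\<dots> \<le> \<bar>t\<bar>\<^sup>2"
    using abs_sin_x_le_abs_x[of "t / 2"] by (intro abs_le_square_iff[THEN iffD1]) (simp add: abs_mult)
  finally show ?thesis by (rule power2_le_imp_le) simp
qed

text \<open>Tightness at one fixed level already bounds the modulus of the characteristic function
  below by \<open>1 / 2\<close>, uniformly in \<open>N\<close>; the exponential upper bound then
  limits the sum of squared structure constants over each residue class.\<close>

theorem tight_imp_summable:
  assumes "\<exists>m. \<forall>\<eta>>0. \<exists>R. \<forall>N\<ge>1. measure M {w \<in> space M. \<bar>S N w - m N\<bar> > R} < \<eta>"
  shows "\<exists>\<xi>\<^sub>0>0. \<forall>\<xi>. \<bar>\<xi>\<bar> \<le> \<xi>\<^sub>0 \<longrightarrow> summable (hex_dist \<xi>)"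
proof -
  obtain m where m: "\<And>\<eta>. 0 < \<eta> \<Longrightarrow> \<exists>R. \<forall>N\<ge>1. measure M {w \<in> space M. \<bar>S N w - m N\<bar> > R} < \<eta>"
    using assms by blast
  \<comment> \<open>The level \<open>1 / 8\<close> and the range of frequencies chosen next are
    balanced: off the bad event the phase is at most \<open>1 / 4\<close>, and on it the distance to
    1 is at most 2, so the mean distance is at most \<open>1 / 2\<close>. Using
    \<open>\<bar>R\<bar> + 1\<close> keeps the denominator positive whatever the sign of
    \<open>R\<close>.\<close>
  obtain R where R: "\<And>N. 1 \<le> N \<Longrightarrow> measure M {w \<in> space M. \<bar>S N w - m N\<bar> > R} < 1 / 8"
    using m[of "1 / 8"] by auto
  define \<xi>\<^sub>0 where "\<xi>\<^sub>0 = 1 / (4 * (\<bar>R\<bar> + 1))"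
  have xi0: "0 < \<xi>\<^sub>0" by (simp add: \<xi>\<^sub>0_def)
  have S_meas [measurable]: "S N \<in> borel_measurable M" for N by measurable
  have half: "1 / 2 \<le> norm (LINT w|M. cis (\<xi> * S N w))" if xi: "\<bar>\<xi>\<bar> \<le> \<xi>\<^sub>0" and N: "1 \<le> N" for \<xi> N
  proof -
    let ?bad = "{w \<in> space M. \<bar>S N w - m N\<bar> > R}"
    let ?z = "\<lambda>w. cis (\<xi> * (S N w - m N))"
    have int: "integrable M ?z" by (rule integrable_bounded[where B = 1]) auto
    \<comment> \<open>Centring by \<open>m N\<close> only rotates the expectation, so the arbitrary
      constants do not affect the modulus.\<close>
    have rot: "(LINT w|M. ?z w) = cis (- (\<xi> * m N)) * (LINT w|M. cis (\<xi> * S N w))"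
    proof -
      have "?z w = cis (- (\<xi> * m N)) * cis (\<xi> * S N w)" for w
        unfolding cis_mult by (simp add: right_diff_distrib)
      then show ?thesis by (simp only: integral_mult_right_zero)
    qed
    have "norm ((LINT w|M. ?z w) - 1) = norm (LINT w|M. ?z w - 1)"
      using int by (simp add: prob_space)
    also have "\<dots> \<le> (LINT w|M. norm (?z w - 1))" by (rule integral_norm_bound)
    also have "\<dots> \<le> (LINT w|M. 1 / 4 + 2 * indicator ?bad w)"
    proof (rule integral_mono)
      show "integrable M (\<lambda>w. norm (?z w - 1))" using int by simp
      show "integrable M (\<lambda>w. 1 / 4 + 2 * indicator ?bad w :: real)"
        by (rule integrable_bounded[where B = 3]) (auto simp: indicator_def)
      fix w assume w: "w \<in> space M"
      show "norm (?z w - 1) \<le> 1 / 4 + 2 * indicator ?bad w"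
      proof (cases "w \<in> ?bad")
        case True
        have "norm (?z w - 1) \<le> norm (?z w) + norm (1 :: complex)" by (rule norm_triangle_ineq4)
        then show ?thesis using True by simp
      next
        case False
        then have "\<bar>S N w - m N\<bar> \<le> \<bar>R\<bar> + 1" using w by auto
        then have "\<bar>\<xi>\<bar> * \<bar>S N w - m N\<bar> \<le> \<xi>\<^sub>0 * (\<bar>R\<bar> + 1)"
          using xi by (intro mult_mono) auto
        also have "\<dots> = 1 / 4" by (simp add: \<xi>\<^sub>0_def)
        finally show ?thesis
          using norm_cis_minus_1_le[of "\<xi> * (S N w - m N)"] False by (simp add: abs_mult)
      qed
    qed
    also have "\<dots> = 1 / 4 + 2 * measure M ?bad"
    proof -
      have "integrable M (indicator ?bad :: 'w \<Rightarrow> real)"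
        by (rule integrable_bounded[where B = 1]) (auto simp: indicator_def)
      then show ?thesis by (simp add: prob_space)
    qed
    also have "\<dots> \<le> 1 / 2" using R[OF N] by simp
    finally have *: "norm ((LINT w|M. ?z w) - 1) \<le> 1 / 2" .
    have "1 - norm (LINT w|M. ?z w) \<le> norm (1 - (LINT w|M. ?z w))"
      using norm_triangle_ineq2[of 1 "\<integral>w. ?z w \<partial>M"] by simp
    then have "1 / 2 \<le> norm (LINT w|M. ?z w)" using * by (simp add: norm_minus_commute)
    then show ?thesis unfolding rot by (simp add: norm_mult)
  qed
  have "summable (hex_dist \<xi>)" if xi: "\<bar>\<xi>\<bar> \<le> \<xi>\<^sub>0" for \<xi>
  proof -
    let ?c = "eps ^ 6 / 4"
    have c: "0 < ?c" using eps by simp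
    \<comment> \<open>From \<open>1 / 2 \<le> exp (- (?c * ?s))\<close>; the empty sum is separate
      because tightness speaks of \<open>N \<ge> 1\<close> only.\<close>
    have block: "(\<Sum>i<n. hex_dist \<xi> (r + 5 * i + 2)) \<le> ln 2 / ?c" for n r
    proof (cases "n = 0")
      case False
      let ?s = "\<Sum>i<n. hex_dist \<xi> (r + 5 * i + 2)"
      have "1 / 2 \<le> exp (- (?c * ?s))"
        using half[OF xi, of "r + 5 * n"] norm_char_le[of \<xi> r n] False by simp
      then have "ln (1 / 2) \<le> ln (exp (- (?c * ?s)))" by (subst ln_le_cancel_iff) auto
      then have "?c * ?s \<le> ln 2" by (simp add: ln_div)
      then show ?thesis using c by (simp only: pos_le_divide_eq mult.commute)
    qed (use eps in simp)
    have split: "(\<Sum>i<5 * n. hex_dist \<xi> (i + 2)) = (\<Sum>r<5. \<Sum>i<n. hex_dist \<xi> (r + 5 * i + 2))" for n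
    proof (induction n)
      case (Suc n)
      have "(\<Sum>i<N + 5. g i) = (\<Sum>i<N. g i) + (g N + g (N + 1) + g (N + 2) + g (N + 3) + g (N + 4))"
        for N and g :: "nat \<Rightarrow> real"
        by (simp add: eval_nat_numeral)
      from this[of "\<lambda>i. hex_dist \<xi> (i + 2)" "5 * n"]
      moreover have "{..<5::nat} = {0, 1, 2, 3, 4}" by auto
      ultimately show ?case using Suc by (simp add: ac_simps)
    qed simp
    have "(\<Sum>i<n. hex_dist \<xi> (i + 2)) \<le> 5 * (ln 2 / ?c)" for n
    proof -
      have "(\<Sum>i<n. hex_dist \<xi> (i + 2)) \<le> (\<Sum>i<5 * n. hex_dist \<xi> (i + 2))"
        by (rule sum_mono2) (auto simp: hex_dist_nonneg)
      also have "\<dots> \<le> (\<Sum>r<(5::nat). ln 2 / ?c)"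
        unfolding split by (intro sum_mono block)
      finally show ?thesis by simp
    qed
    \<comment> \<open>The first two positions are missing because every block begins with two
      smoothing steps; finitely many terms do not matter.\<close>
    then have "summable (\<lambda>i. hex_dist \<xi> (i + 2))"
      by (intro summableI_nonneg_bounded) (auto simp: hex_dist_nonneg)
    then show ?thesis by (simp only: summable_iff_shift)
  qed
  then show ?thesis using xi0 by blast
qed

section \<open>The co-range as a subgroup of the reals\<close>

lemma hex_dist_0 [simp]: "hex_dist 0 k = 0"
  by (simp add: hex_dist_def)

lemma hex_dist_diff_le: "hex_dist (\<xi> - \<zeta>) k \<le> 2 * hex_dist \<xi> k + 2 * hex_dist \<zeta> k"
proof -
  have "hex_dist (\<xi> - \<zeta>) k \<le> (LINT P|hex k. 2 * (2 - 2 * cos (\<xi> * hex_balance f k P)) + 2 * (2 - 2 * cos (\<zeta> * hex_balance f k P)))"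
    unfolding hex_dist_def
  proof (rule integral_mono[OF hex_dist_integrable])
    show "integrable (hex k) (\<lambda>P. 2 * (2 - 2 * cos (\<xi> * hex_balance f k P)) + 2 * (2 - 2 * cos (\<zeta> * hex_balance f k P)))"
      by (intro Bochner_Integration.integrable_add integrable_mult_right hex_dist_integrable)
    show "2 - 2 * cos ((\<xi> - \<zeta>) * hex_balance f k P) \<le> 2 * (2 - 2 * cos (\<xi> * hex_balance f k P)) + 2 * (2 - 2 * cos (\<zeta> * hex_balance f k P))" for P
      using two_minus_two_cos_add_le[of "\<xi> * hex_balance f k P" "- (\<zeta> * hex_balance f k P)"] by (simp add: left_diff_distrib)
  qed
  also have "\<dots> = 2 * hex_dist \<xi> k + 2 * hex_dist \<zeta> k"
    unfolding hex_dist_def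
    by (subst Bochner_Integration.integral_add)
      (simp_all only: integrable_mult_right hex_dist_integrable integral_mult_right_zero)
  finally show ?thesis .
qed

lemma summable_hex_dist_diff:
  assumes "summable (hex_dist \<xi>)" "summable (hex_dist \<zeta>)"
  shows "summable (hex_dist (\<xi> - \<zeta>))"
proof (rule summable_comparison_test')
  show "summable (\<lambda>k. 2 * hex_dist \<xi> k + 2 * hex_dist \<zeta> k)"
    by (intro summable_add summable_mult assms)
  show "norm (hex_dist (\<xi> - \<zeta>) k) \<le> 2 * hex_dist \<xi> k + 2 * hex_dist \<zeta> k" for k
    using hex_dist_diff_le hex_dist_nonneg by simp
qed

text \<open>The hypothesis on \<open>\<xi>\<close> keeps \<open>\<xi> * hex_balance f k P\<close>
  within \<open>[-pi, pi]\<close>, where the quadratic bound holds pointwise.\<close>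

lemma summable_hex_dist_imp_balance:
  assumes sum: "summable (hex_dist \<xi>)" and "\<xi> \<noteq> 0" and xi: "\<bar>\<xi>\<bar> * (6 * B) \<le> pi"
  shows "summable (\<lambda>k. \<integral>P. (hex_balance f k P)\<^sup>2 \<partial>hex k)"
proof (rule summable_comparison_test')
  show "summable (\<lambda>k. 4 / \<xi>\<^sup>2 * hex_dist \<xi> k)" by (intro summable_mult sum)
  fix k
  have "(LINT P|hex k. (hex_balance f k P)\<^sup>2) \<le> (LINT P|hex k. 4 / \<xi>\<^sup>2 * (2 - 2 * cos (\<xi> * hex_balance f k P)))"
  proof (intro integral_mono hex_balance_square_integrable integrable_mult_right hex_dist_integrable)
    fix P assume "P \<in> space (hex k)"
    then have "\<bar>\<xi> * hex_balance f k P\<bar> \<le> \<bar>\<xi>\<bar> * (6 * B)"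
      unfolding abs_mult by (intro mult_left_mono hex_balance_bound) auto
    then have "(\<xi> * hex_balance f k P)\<^sup>2 \<le> 4 * (2 - 2 * cos (\<xi> * hex_balance f k P))"
      using xi by (intro square_le_two_minus_two_cos) simp
    then show "(hex_balance f k P)\<^sup>2 \<le> 4 / \<xi>\<^sup>2 * (2 - 2 * cos (\<xi> * hex_balance f k P))"
      using \<open>\<xi> \<noteq> 0\<close> by (simp add: power_mult_distrib pos_le_divide_eq mult.commute)
  qed
  then have "(LINT P|hex k. (hex_balance f k P)\<^sup>2) \<le> 4 / \<xi>\<^sup>2 * hex_dist \<xi> k"
    by (simp only: hex_dist_def integral_mult_right_zero)
  then show "norm (LINT P|hex k. (hex_balance f k P)\<^sup>2) \<le> 4 / \<xi>\<^sup>2 * hex_dist \<xi> k"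
    by (simp add: integral_nonneg_AE)
qed

definition tight :: bool where
  "tight \<longleftrightarrow> (\<exists>m. \<forall>\<eta>>0. \<exists>R. \<forall>N\<ge>1. measure M {w \<in> space M. \<bar>S N w - m N\<bar> > R} < \<eta>)"

theorem co_range_dichotomy:
  "(tight \<longrightarrow> {\<xi>. summable (hex_dist \<xi>)} = UNIV) \<and>
   (\<not> tight \<longrightarrow> {\<xi>. summable (hex_dist \<xi>)} = {0} \<or>
      (\<exists>t \<ge> pi / (6 * B). {\<xi>. summable (hex_dist \<xi>)} = range (\<lambda>k::int. t * of_int k)))"
proof (intro conjI impI)
  let ?H = "{\<xi>. summable (hex_dist \<xi>)}"
  have zero: "0 \<in> ?H" using summable_zero by (simp add: hex_dist_0[abs_def])
  have diff: "x - y \<in> ?H" if "x \<in> ?H" "y \<in> ?H" for x y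
    using that summable_hex_dist_diff by simp
  {
    assume tight
    from tight_imp_summable[OF this[unfolded tight_def]]
    obtain \<xi>\<^sub>0 where xi0: "0 < \<xi>\<^sub>0" "\<And>\<xi>. \<bar>\<xi>\<bar> \<le> \<xi>\<^sub>0 \<Longrightarrow> \<xi> \<in> ?H"
      by auto
    have "\<xi> \<in> ?H" for \<xi>
    proof -
      obtain n :: nat where n: "\<bar>\<xi>\<bar> / \<xi>\<^sub>0 < n" using reals_Archimedean2 by blast
      \<comment> \<open>Only closure under differences is at hand: subtracting \<open>y\<close> from
        0 \<open>n\<close> times yields \<open>\<xi>\<close>, hence the minus sign.\<close>
      define y where "y = - (\<xi> / real n)"
      have pos: "0 < real n"
        using n divide_nonneg_pos[OF abs_ge_zero[of \<xi>] xi0(1)] by linarith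
      have "\<bar>\<xi>\<bar> < real n * \<xi>\<^sub>0" using n xi0(1) by (simp add: pos_divide_less_eq)
      then have "\<bar>\<xi>\<bar> / real n \<le> \<xi>\<^sub>0" using pos by (simp add: pos_divide_le_eq mult.commute)
      then have "\<bar>y\<bar> \<le> \<xi>\<^sub>0" by (simp add: y_def)
      moreover have "\<xi> = - (real n * y)" using pos by (simp add: y_def)
      moreover have "- (real j * y) \<in> ?H" if "y \<in> ?H" for j
      proof (induction j)
        case (Suc j)
        have "- (real (Suc j) * y) = - (real j * y) - y" by (simp add: algebra_simps)
        then show ?case using diff[OF Suc that] by (simp only:)
      qed (use zero in simp)
      ultimately show ?thesis using xi0(2)[of y] by (simp only:)
    qed
    then show "?H = UNIV" by blast
  }
  assume nt: "\<not> tight"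
  have nosum: "\<not> summable (\<lambda>k. \<integral>P. (hex_balance f k P)\<^sup>2 \<partial>hex k)"
  proof
    assume "summable (\<lambda>k. \<integral>P. (hex_balance f k P)\<^sup>2 \<partial>hex k)"
    from summable_balance_imp_tight[OF this] have tight unfolding tight_def by meson
    with nt show False ..
  qed
  \<comment> \<open>With \<open>B = 0\<close> all balances would vanish and the sums would be tight.
    This also excludes the degenerate quotient \<open>pi / 0\<close>, which is 0.\<close>
  have "0 < B"
  proof (rule ccontr)
    assume "\<not> 0 < B"
    then have "B = 0" using B_nonneg by simp
    then have "(LINT P|hex k. (hex_balance f k P)\<^sup>2) = (LINT P|hex k. 0)" for k
      using hex_balance_bound[of _ k] by (intro Bochner_Integration.integral_cong) auto
    then show False using nosum by simp
  qed
  have "?H = {0} \<or> (\<exists>t > pi / (6 * B). ?H = range (\<lambda>k::int. t * of_int k))"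
  proof (rule discrete_subgroup_real[OF zero diff])
    show "pi / (6 * B) < \<bar>\<xi>\<bar>" if "\<xi> \<in> ?H" "\<xi> \<noteq> 0" for \<xi>
    proof (rule ccontr)
      assume "\<not> pi / (6 * B) < \<bar>\<xi>\<bar>"
      then have "\<bar>\<xi>\<bar> * (6 * B) \<le> pi" using \<open>0 < B\<close> by (simp add: not_less pos_le_divide_eq)
      from summable_hex_dist_imp_balance[OF _ that(2) this] that(1) nosum show False by simp
    qed
    show "0 < pi / (6 * B)" using \<open>0 < B\<close> by simp
  qed
  then show "?H = {0} \<or> (\<exists>t \<ge> pi / (6 * B). ?H = range (\<lambda>k::int. t * of_int k))"
    by (auto intro: less_imp_le)
qed

end

section \<open>The chain and its hexagons\<close>

lemma space_metric_borel [simp]: "space (metric_borel m) = mspace m"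
  unfolding metric_borel_def by (rule space_measure_of) (use openin_subset[of "mtopology_of m"] in auto)

lemma measurable_into_history:
  assumes "\<And>i. i \<in> {1..n} \<Longrightarrow> X i \<in> M \<rightarrow>\<^sub>M metric_borel (S i)"
  shows "(\<lambda>w. \<lambda>i\<in>{1..n}. X i w) \<in> M \<rightarrow>\<^sub>M (\<Pi>\<^sub>M i\<in>{1..n}. metric_borel (S i))"
  using assms by (rule measurable_restrict)

lemma subalgebra_history:
  assumes "\<And>i. i \<in> {1..n} \<Longrightarrow> X i \<in> M \<rightarrow>\<^sub>M metric_borel (S i)"
  shows "subalgebra M (history M S X n)"
  unfolding subalgebra_def history_def
  using sets_image_in_sets[OF refl measurable_into_history[of n X M S, OF assms]]
  by (simp del: One_nat_def)

lemma history_adapted: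
  assumes X: "\<And>i. i \<in> {1..n} \<Longrightarrow> X i \<in> M \<rightarrow>\<^sub>M metric_borel (S i)" and i: "i \<in> {1..n}"
  shows "X i \<in> history M S X n \<rightarrow>\<^sub>M metric_borel (S i)"
proof -
  have "(\<lambda>w. \<lambda>i\<in>{1..n}. X i w) \<in> history M S X n \<rightarrow>\<^sub>M (\<Pi>\<^sub>M i\<in>{1..n}. metric_borel (S i))"
    unfolding history_def
    using measurable_space[OF measurable_into_history[of n X M S, OF X]]
    by (intro measurable_vimage_algebra1) blast
  from measurable_compose[OF this measurable_component_singleton[OF i]] show ?thesis
    using i by simp
qed

text \<open>Integrates the almost sure identity for the conditional probability over an event of the
  past, which is the form assumed in \<open>elliptic_chain\<close>.\<close>

lemma markov_chain_emeasure:
  assumes chain: "markov_chain M S X \<pi>" and n: "1 \<le> n"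
    and A: "A \<in> sets (history M S X n)" and E: "E \<in> sets (metric_borel (S (n + 1)))"
  shows "emeasure M (A \<inter> (X (n + 1) -` E \<inter> space M)) = (\<integral>\<^sup>+w. indicator A w * emeasure (\<pi> n (X n w)) E \<partial>M)"
proof -
  interpret prob_space M using chain by (simp add: markov_chain_def)
  have X [measurable]: "X i \<in> M \<rightarrow>\<^sub>M metric_borel (S i)" if "1 \<le> i" for i
    using chain that by (simp add: markov_chain_def)
  have \<pi>: "\<pi> n \<in> metric_borel (S n) \<rightarrow>\<^sub>M prob_algebra (metric_borel (S (n + 1)))"
    using chain n by (simp add: markov_chain_def)
  have sub: "subalgebra M (history M S X n)" by (rule subalgebra_history) (auto intro: X)
  interpret sub: finite_measure_subalgebra M "history M S X n"
    by (intro finite_measure_subalgebra.intro finite_measure_subalgebra_axioms.intro sub finite_measure_axioms)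
  have [measurable]: "A \<in> sets M" using A sub by (auto simp: subalgebra_def)
  have Xn1 [measurable]: "X (n + 1) -` E \<inter> space M \<in> sets M" by (rule measurable_sets[OF X E]) simp
  let ?I = "indicator (X (n + 1) -` E \<inter> space M) :: _ \<Rightarrow> real"
  let ?q = "\<lambda>w. measure (\<pi> n (X n w)) E"
  have q [measurable]: "?q \<in> borel_measurable M"
    using measurable_compose[OF measurable_compose[OF X[OF n] \<pi>] measurable_measure_prob_algebra[OF E]] .
  have prob: "prob_space (\<pi> n (X n w))" if "w \<in> space M" for w
    using measurable_space[OF \<pi> measurable_space[OF X[OF n] that]] by (simp add: space_prob_algebra)
  have q1: "?q w \<le> 1" if "w \<in> space M" for w
    using prob_space.prob_le_1[OF prob[OF that]] .
  have I: "integrable M ?I"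
    using borel_measurable_indicator[OF Xn1] by (rule integrable_bounded[where B = 1]) (auto simp: indicator_def)
  have int: "integrable M (\<lambda>w. indicator A w * ?q w)"
    by (rule integrable_bounded[where B = 1]) (auto simp: indicator_def q1)
  have AEq: "AE w in M. real_cond_exp M (history M S X n) ?I w = ?q w"
    using chain n E by (simp add: markov_chain_def)
  have "measure M (A \<inter> (X (n + 1) -` E \<inter> space M)) = (\<integral>w\<in>A. ?I w \<partial>M)"
    unfolding set_lebesgue_integral_def by (simp add: indicator_inter_arith[symmetric] Int_assoc[symmetric])
  also have "\<dots> = (\<integral>w\<in>A. real_cond_exp M (history M S X n) ?I w \<partial>M)"
    by (rule sub.real_cond_exp_intA[OF I A])
  also have "\<dots> = (LINT w|M. indicator A w * ?q w)"
    unfolding set_lebesgue_integral_def using AEq by (intro integral_cong_AE) auto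
  finally have "emeasure M (A \<inter> (X (n + 1) -` E \<inter> space M)) = ennreal (LINT w|M. indicator A w * ?q w)"
    by (simp add: emeasure_eq_measure)
  also have "\<dots> = (\<integral>\<^sup>+w. ennreal (indicator A w * ?q w) \<partial>M)"
    by (rule nn_integral_eq_integral[OF int, symmetric]) auto
  also have "\<dots> = (\<integral>\<^sup>+w. indicator A w * emeasure (\<pi> n (X n w)) E \<partial>M)"
    using prob by (intro nn_integral_cong)
      (auto simp: indicator_def prob_space_def finite_measure.emeasure_eq_measure)
  finally show ?thesis .
qed

lemma markov_chain_elliptic:
  assumes chain: "markov_chain M S X \<pi>"
    and elliptic: "uniformly_elliptic S \<pi> \<mu> p"
    and marginals: "\<And>n. n \<ge> 1 \<Longrightarrow> \<mu> n = distr M (metric_borel (S n)) (X n)"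
  obtains eps where "elliptic_chain M (\<lambda>n. history M S X (Suc n)) (\<lambda>n. X (Suc n)) (\<lambda>n. \<mu> (Suc n)) (\<lambda>n. p (Suc n)) eps"
proof -
  obtain eps where eps: "0 < eps" "eps < 1"
    and dens: "\<And>n x. 1 \<le> n \<Longrightarrow> x \<in> mspace (S n) \<Longrightarrow> \<pi> n x = density (\<mu> (n + 1)) (\<lambda>y. ennreal (p n x y))"
    and p: "\<And>n x y. 1 \<le> n \<Longrightarrow> x \<in> mspace (S n) \<Longrightarrow> y \<in> mspace (S (n + 1)) \<Longrightarrow> 0 \<le> p n x y \<and> p n x y \<le> 1 / eps"
    and two: "\<And>n x z. 1 \<le> n \<Longrightarrow> x \<in> mspace (S n) \<Longrightarrow> z \<in> mspace (S (n + 2)) \<Longrightarrow>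
      (LINT y|\<mu> (n + 1). p n x y * p (n + 1) y z) > eps"
    using elliptic unfolding uniformly_elliptic_def by blast
  have sets_mu: "sets (\<mu> (Suc n)) = sets (metric_borel (S (Suc n)))" for n
    by (simp add: marginals)
  have space_mu: "space (\<mu> (Suc n)) = mspace (S (Suc n))" for n
    by (simp add: marginals)
  have X: "X (Suc n) \<in> M \<rightarrow>\<^sub>M metric_borel (S (Suc n))" for n
    using chain by (simp add: markov_chain_def)
  have X1: "X i \<in> M \<rightarrow>\<^sub>M metric_borel (S i)" if "i \<in> {1..n}" for i n
    using chain that by (simp add: markov_chain_def)
  have pm: "case_prod (p (Suc n)) \<in> borel_measurable (\<mu> (Suc n) \<Otimes>\<^sub>M \<mu> (Suc (Suc n)))" for n
  proof -
    have "case_prod (p (Suc n)) \<in> borel_measurable (metric_borel (S (Suc n)) \<Otimes>\<^sub>M metric_borel (S (Suc (Suc n))))"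
      using elliptic by (simp add: uniformly_elliptic_def)
    then show ?thesis
      by (simp add: measurable_cong_sets[OF sets_pair_measure_cong[OF sets_mu sets_mu] refl])
  qed
  have pm_section: "(\<lambda>y. ennreal (p (Suc n) x y)) \<in> borel_measurable (\<mu> (Suc (Suc n)))" if "x \<in> mspace (S (Suc n))" for n x
    using measurable_compose_Pair1[OF _ pm, of x n] that by (simp add: space_mu)
  have dens': "\<pi> (Suc n) x = density (\<mu> (Suc (Suc n))) (\<lambda>y. ennreal (p (Suc n) x y))" if "x \<in> mspace (S (Suc n))" for n x
    using dens[of "Suc n" x] that by simp
  have "elliptic_chain M (\<lambda>n. history M S X (Suc n)) (\<lambda>n. X (Suc n)) (\<lambda>n. \<mu> (Suc n)) (\<lambda>n. p (Suc n)) eps"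
  proof (intro elliptic_chain.intro elliptic_chain_axioms.intro)
    show "prob_space M" using chain by (simp add: markov_chain_def)
    show "subalgebra M (history M S X (Suc n))" for n
      by (rule subalgebra_history) (rule X1)
    show "X (Suc i) \<in> history M S X (Suc n) \<rightarrow>\<^sub>M \<mu> (Suc i)" if "i \<le> n" for i n
      using history_adapted[of "Suc n" X M S "Suc i", OF X1[of _ "Suc n"]] that
      by (simp add: measurable_cong_sets[OF refl sets_mu])
    show "distr M (\<mu> (Suc n)) (X (Suc n)) = \<mu> (Suc n)" for n
    proof -
      have "distr M (\<mu> (Suc n)) (X (Suc n)) = distr M (metric_borel (S (Suc n))) (X (Suc n))"
        by (rule distr_cong[OF refl sets_mu refl])
      also have "\<dots> = \<mu> (Suc n)" by (rule marginals[symmetric]) simp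
      finally show ?thesis .
    qed
    show "case_prod (p (Suc n)) \<in> borel_measurable (\<mu> (Suc n) \<Otimes>\<^sub>M \<mu> (Suc (Suc n)))" for n by (rule pm)
    show "0 \<le> p (Suc n) x y" "p (Suc n) x y \<le> 1 / eps"
      if "x \<in> space (\<mu> (Suc n))" "y \<in> space (\<mu> (Suc (Suc n)))" for n x y
      using p[of "Suc n" x y] that by (simp_all add: space_mu)
    show "(\<integral>\<^sup>+y. ennreal (p (Suc n) x y) \<partial>\<mu> (Suc (Suc n))) = 1" if "x \<in> space (\<mu> (Suc n))" for n x
    proof -
      have x: "x \<in> mspace (S (Suc n))" using that by (simp add: space_mu)
      \<comment> \<open>The density has total mass 1 because it represents a transition
        probability.\<close>
      have "\<pi> (Suc n) \<in> metric_borel (S (Suc n)) \<rightarrow>\<^sub>M prob_algebra (metric_borel (S (Suc (Suc n))))"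
        using chain by (simp add: markov_chain_def)
      from measurable_space[OF this, of x] x have "prob_space (\<pi> (Suc n) x)"
        by (simp add: space_prob_algebra)
      from prob_space.emeasure_space_1[OF this] show ?thesis
        using pm_section[OF x] by (simp add: dens'[OF x] emeasure_density cong: nn_integral_cong)
    qed
    show "eps < (LINT y|\<mu> (Suc (Suc n)). p (Suc n) x y * p (Suc (Suc n)) y z)"
      if "x \<in> space (\<mu> (Suc n))" "z \<in> space (\<mu> (Suc (Suc (Suc n))))" for n x z
      using two[of "Suc n" x z] that by (simp add: space_mu)
    show "emeasure M (A \<inter> (X (Suc (Suc n)) -` E \<inter> space M)) =
        (\<integral>\<^sup>+w. indicator A w * (\<integral>\<^sup>+y. ennreal (p (Suc n) (X (Suc n) w) y) * indicator E y \<partial>\<mu> (Suc (Suc n))) \<partial>M)"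
      if A: "A \<in> sets (history M S X (Suc n))" and E: "E \<in> sets (\<mu> (Suc (Suc n)))" for n A E
    proof -
      have "emeasure M (A \<inter> (X (Suc (Suc n)) -` E \<inter> space M)) =
        (\<integral>\<^sup>+w. indicator A w * emeasure (\<pi> (Suc n) (X (Suc n) w)) E \<partial>M)"
        using markov_chain_emeasure[OF chain _ A, of E] E by (simp add: sets_mu)
      also have "\<dots> = (\<integral>\<^sup>+w. indicator A w * (\<integral>\<^sup>+y. ennreal (p (Suc n) (X (Suc n) w) y) * indicator E y \<partial>\<mu> (Suc (Suc n))) \<partial>M)"
      proof (intro nn_integral_cong arg_cong2[where f = "(*)"] refl)
        fix w assume "w \<in> space M"
        then have x: "X (Suc n) w \<in> mspace (S (Suc n))" using measurable_space[OF X] by simp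
        show "emeasure (\<pi> (Suc n) (X (Suc n) w)) E = (\<integral>\<^sup>+y. ennreal (p (Suc n) (X (Suc n) w) y) * indicator E y \<partial>\<mu> (Suc (Suc n)))"
          unfolding dens'[OF x] by (rule emeasure_density[OF pm_section[OF x] E])
      qed
      finally show ?thesis .
    qed
  qed (fact eps)+
  then show thesis by (rule that)
qed

lemma ess_sup_functional_bound:
  assumes "prob_space M" and bounded: "as_uniformly_bounded M X f"
  shows "n \<ge> 1 \<Longrightarrow> AE w in M. \<bar>f n (X n w) (X (n + 1) w)\<bar> \<le> real_of_ereal (ess_sup_functional M X f)"
proof -
  interpret prob_space M by fact
  let ?e = "\<lambda>n. esssup M (\<lambda>w. ereal \<bar>f n (X n w) (X (n + 1) w)\<bar>)"
  have le: "?e n \<le> ess_sup_functional M X f" if "1 \<le> n" for n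
    unfolding ess_sup_functional_def using that by (intro SUP_upper) auto
  \<comment> \<open>A lower bound by 0, valid since \<open>M\<close> has mass one, rules out minus
    infinity. Together with boundedness the supremum is a real number, and
    \<open>real_of_ereal\<close> loses nothing.\<close>
  have "esssup M (\<lambda>w. 0) \<le> ?e 1" by (rule esssup_mono) auto
  then have "0 \<le> ?e 1" using esssup_const[of M "0 :: ereal"] by (simp add: emeasure_space_1)
  then have "0 \<le> ess_sup_functional M X f" using le[of 1] by (rule order_trans) simp
  with bounded have B: "ess_sup_functional M X f = ereal (real_of_ereal (ess_sup_functional M X f))"
    by (cases "ess_sup_functional M X f") (auto simp: as_uniformly_bounded_def)
  assume "n \<ge> 1"
  from order_trans[OF _ le[OF this]] esssup_AE[of "\<lambda>w. ereal \<bar>f n (X n w) (X (n + 1) w)\<bar>" M]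
  have "AE w in M. ereal \<bar>f n (X n w) (X (n + 1) w)\<bar> \<le> ess_sup_functional M X f" by auto
  then show "AE w in M. \<bar>f n (X n w) (X (n + 1) w)\<bar> \<le> real_of_ereal (ess_sup_functional M X f)"
    by (subst (asm) B) simp
qed

theorem theorem3p1:
  fixes M :: "'w measure"
    and S :: "nat \<Rightarrow> 'a metric"
    and X :: "nat \<Rightarrow> 'w \<Rightarrow> 'a"
    and \<pi> :: "nat \<Rightarrow> 'a \<Rightarrow> 'a measure"
    and \<mu> :: "nat \<Rightarrow> 'a measure"
    and p :: "nat \<Rightarrow> 'a \<Rightarrow> 'a \<Rightarrow> real"
    and f :: "nat \<Rightarrow> 'a \<Rightarrow> 'a \<Rightarrow> real"
  assumes chain: "markov_chain M S X \<pi>"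
    and elliptic: "uniformly_elliptic S \<pi> \<mu> p"
    and marginals: "\<And>n. n \<ge> 1 \<Longrightarrow> \<mu> n = distr M (metric_borel (S n)) (X n)"
    and functional: "additive_functional S f"
    and bounded: "as_uniformly_bounded M X f"
  shows "(center_tight M X f \<longrightarrow> co_range M S X \<mu> p f = UNIV) \<and>
         (\<not> center_tight M X f \<longrightarrow>
            co_range M S X \<mu> p f = {0} \<or>
            (\<exists>t. t \<ge> pi / (6 * real_of_ereal (ess_sup_functional M X f)) \<and>
                 co_range M S X \<mu> p f = range (\<lambda>k::int. t * of_int k)))"
proof -
  obtain eps where "elliptic_chain M (\<lambda>n. history M S X (Suc n)) (\<lambda>n. X (Suc n)) (\<lambda>n. \<mu> (Suc n)) (\<lambda>n. p (Suc n)) eps"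
    by (rule markov_chain_elliptic[OF chain elliptic marginals])
  then interpret C: elliptic_chain M "\<lambda>n. history M S X (Suc n)" "\<lambda>n. X (Suc n)" "\<lambda>n. \<mu> (Suc n)" "\<lambda>n. p (Suc n)" eps .
  define B where "B = real_of_ereal (ess_sup_functional M X f)"
  have AE_B: "AE w in M. \<bar>f (Suc n) (X (Suc n) w) (X (Suc (Suc n)) w)\<bar> \<le> B" for n
    using ess_sup_functional_bound[OF C.prob_space_axioms bounded, of "Suc n"] by (simp add: B_def)
  have "0 \<le> B"
  proof -
    have "AE w in M. 0 \<le> B" using AE_B[of 0] by eventually_elim simp
    then show ?thesis by simp
  qed
  have sets_mu: "sets (\<mu> (Suc n)) = sets (metric_borel (S (Suc n)))" for n
    by (simp add: marginals)
  have f0: "case_prod (f (Suc n)) \<in> borel_measurable (\<mu> (Suc n) \<Otimes>\<^sub>M \<mu> (Suc (Suc n)))" for n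
  proof -
    have "case_prod (f (Suc n)) \<in> borel_measurable (metric_borel (S (Suc n)) \<Otimes>\<^sub>M metric_borel (S (Suc (Suc n))))"
      using functional by (simp add: additive_functional_def)
    then show ?thesis
      by (simp add: measurable_cong_sets[OF sets_pair_measure_cong[OF sets_mu sets_mu] refl])
  qed
  have f_meas [measurable (raw)]: "(\<lambda>z. f (Suc n) (x z) (y z)) \<in> borel_measurable N"
    if [measurable]: "x \<in> N \<rightarrow>\<^sub>M \<mu> (Suc n)" "y \<in> N \<rightarrow>\<^sub>M \<mu> (Suc (Suc n))" for n x y and N :: "'z measure"
    using measurable_compose[OF _ f0, of "\<lambda>z. (x z, y z)" N n] by simp
  \<comment> \<open>Truncation at the essential supremum makes the bound hold everywhere and changes
    the summands only on null sets.\<close>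
  define g where "g n x y = max (- B) (min B (f (Suc n) x y))" for n x y
  interpret G: elliptic_functional M "\<lambda>n. history M S X (Suc n)" "\<lambda>n. X (Suc n)" "\<lambda>n. \<mu> (Suc n)" "\<lambda>n. p (Suc n)" eps g B
  proof
    show "case_prod (g n) \<in> borel_measurable (\<mu> (Suc n) \<Otimes>\<^sub>M \<mu> (Suc (Suc n)))" for n
      unfolding g_def case_prod_beta' by measurable
    show "\<bar>g n x y\<bar> \<le> B" for n x y using \<open>0 \<le> B\<close> by (auto simp: g_def)
  qed
  have fg: "f (Suc n) x y = g n x y" if "\<bar>f (Suc n) x y\<bar> \<le> B" for n x y
    using that by (auto simp: g_def max_def min_def)
  have AE_fg: "AE w in M. f (Suc n) (X (Suc n) w) (X (Suc (Suc n)) w) = g n (X (Suc n) w) (X (Suc (Suc n)) w)" for n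
    using AE_B[of n] by eventually_elim (rule fg)
  have co_range: "co_range M S X \<mu> p f = {\<xi>. summable (G.hex_dist \<xi>)}"
  proof -
    have "(structure_const M S X \<mu> p f (k + 3) \<xi>)\<^sup>2 = G.hex_dist \<xi> k" for k \<xi>
    proof -
      have idx: "k + 3 = Suc (Suc (Suc k))" "Suc (Suc (Suc k)) - 1 = Suc (Suc k)" "Suc (Suc (Suc k)) - 2 = Suc k"
        by simp_all
      have joint: "joint_law M S X (Suc n) = C.J n" for n
        unfolding joint_law_def C.J_def
        by (rule distr_cong) (auto intro!: sets_pair_measure_cong simp: sets_mu)
      have bridge: "bridge \<mu> p (Suc n) = C.br n" for n
        by (intro ext) (simp add: bridge_def)
      have ret: "return (metric_borel (S (Suc k)) \<Otimes>\<^sub>M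
          (metric_borel (S (Suc (Suc k))) \<Otimes>\<^sub>M metric_borel (S (Suc (Suc k)))) \<Otimes>\<^sub>M
          (metric_borel (S (Suc (Suc (Suc k)))) \<Otimes>\<^sub>M metric_borel (S (Suc (Suc (Suc k))))) \<Otimes>\<^sub>M
          metric_borel (S (Suc (Suc (Suc (Suc k)))))) = return (C.hexspace k)"
        by (intro ext return_cong sets_pair_measure_cong sets_mu[symmetric])
      have law: "hexagon_law M S X \<mu> p (k + 3) = C.hex k"
        unfolding hexagon_law_def C.hex_def idx joint bridge Suc_eq_plus1[symmetric] ret ..
      have [measurable]: "C.hex_balance (\<lambda>n. f (Suc n)) k \<in> borel_measurable (C.hexspace k)"
        unfolding C.hex_balance_def[abs_def] case_prod_beta' by measurable
      have bal: "balance f (k + 3) P = C.hex_balance (\<lambda>n. f (Suc n)) k P" for P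
        by (cases P) (auto simp: C.hex_balance_def idx simp del: One_nat_def)
      have "AE v in C.J n. f (Suc n) (fst v) (snd v) = g n (fst v) (snd v)" for n
        unfolding C.J_def using AE_fg[of n] by (subst AE_distr_iff) (auto simp: g_def)
      note AE_edge = this
      have pred: "Measurable.pred (\<mu> (Suc n) \<Otimes>\<^sub>M \<mu> (Suc (Suc n))) (\<lambda>v. f (Suc n) (fst v) (snd v) = g n (fst v) (snd v))" for n
        unfolding g_def by measurable
      \<comment> \<open>The agreement of \<open>f\<close> and \<open>g\<close> is known along the
        chain; \<open>AE_hex_edges\<close> extends it to all six edges of the hexagon, so both
        functionals have the same structure constants.\<close>
      have "AE P in C.hex k. C.hex_balance (\<lambda>n. f (Suc n)) k P = C.hex_balance g k P"
        using C.AE_hex_edges[of "\<lambda>n x y. f (Suc n) x y = g n x y" k, OF pred AE_edge]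
        by (rule eventually_mono) (clarsimp simp: C.hex_balance_def)
      then have "(LINT P|C.hex k. 2 - 2 * cos (\<xi> * C.hex_balance (\<lambda>n. f (Suc n)) k P)) = G.hex_dist \<xi> k"
        unfolding G.hex_dist_def by (intro integral_cong_AE) auto
      then show ?thesis
        unfolding structure_const_def law bal norm_exp_i_minus_1_squared using G.hex_dist_nonneg[of \<xi> k] by simp
    qed
    then show ?thesis by (simp add: co_range_def)
  qed
  have tight: "center_tight M X f \<longleftrightarrow> G.tight"
  proof -
    have "measure M {w \<in> space M. \<bar>partial_sum X f N w - m\<bar> > R} = measure M {w \<in> space M. \<bar>G.S N w - m\<bar> > R}" for N m R
    proof (rule measure_eq_AE)
      have ps: "partial_sum X f N = (\<lambda>w. \<Sum>n<N. f (Suc n) (X (Suc n) w) (X (Suc (Suc n)) w))"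
        by (simp add: partial_sum_def[abs_def] sum.atLeast1_atMost_eq)
      have "AE w in M. \<forall>n. f (Suc n) (X (Suc n) w) (X (Suc (Suc n)) w) = g n (X (Suc n) w) (X (Suc (Suc n)) w)"
        using AE_fg by (simp add: AE_all_countable)
      then show "AE w in M. w \<in> {w \<in> space M. \<bar>partial_sum X f N w - m\<bar> > R} \<longleftrightarrow>
          w \<in> {w \<in> space M. \<bar>G.S N w - m\<bar> > R}"
        by eventually_elim (simp add: ps)
      show "{w \<in> space M. \<bar>partial_sum X f N w - m\<bar> > R} \<in> sets M" unfolding ps by measurable
      show "{w \<in> space M. \<bar>G.S N w - m\<bar> > R} \<in> sets M" by measurable
    qed
    then show ?thesis unfolding center_tight_def G.tight_def by simp
  qed
  show ?thesis
    using G.co_range_dichotomy unfolding co_range tight B_def[symmetric] .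
qed

end
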